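(* Let $s \ge 3$ and $k \ge s+1$ be integers and let $\alpha > 0$ satisfy $$\frac{1}{\alpha} > \binom{k-1}{s-1} - 1 - \frac{s-1}{k-1} + \frac{2\left(1 + \frac{s-1}{k-1}\right)}{\binom{k-1}{s-1} + 2}.$$ Then the random hypergraph $G^s(n, n^{-\alpha})$ obeys the zero-one $k$-law.
   Context: For integers $s \ge 2$, $n \ge 1$ and $p\in[0,1]$, the random $s$-uniform hypergraph $G^s(n,p)$ is the random $s$-uniform hypergraph on vertex set $\{1,\dots,n\}$ in which each of the $\binom{n}{s}$ possible $s$-element edges is present independently with probability $p$. First-order properties of $s$-uniform hypergraphs are those expressible by first-order formulae built from the $s$-ary predicate symbol $N$ (meaning "these $s$ vertices form an edge"), equality, logical connectives, variables and quantifiers $\forall,\exists$ over vertices. The quantifier depth of a formula is the maximum number of nested quantifiers. $G^s(n,p(n))$ obeys the zero-one $k$-law if for every first-order property $L$ expressible by a formula of quantifier depth at most $k$, the probability $\Pr[G^s(n,p(n)) \models L]$ tends either to $0$ or to $1$ as $n\to\infty$. *)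

theory Defs
  imports "HOL-Probability.Probability"
begin

text \<open>
  First-order formulae over equality and one predicate symbol \<open>N\<close>. The datatype does not fix the
  arity of \<open>N\<close>; this is done by \<open>arity_ok\<close> below. Variables are natural numbers.
\<close>

datatype fo =
    Eq nat nat
  | N "nat list"
  | Neg fo
  | Conj fo fo
  | Disj fo fo
  | Imp fo fo
  | Iff fo fo
  | All nat fo
  | Ex nat fo

primrec arity_ok :: "nat \<Rightarrow> fo \<Rightarrow> bool" where
  "arity_ok s (Eq x y) \<longleftrightarrow> True"
| "arity_ok s (N xs) \<longleftrightarrow> length xs = s"
| "arity_ok s (Neg \<phi>) \<longleftrightarrow> arity_ok s \<phi>"
| "arity_ok s (Conj \<phi> \<psi>) \<longleftrightarrow> arity_ok s \<phi> \<and> arity_ok s \<psi>"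
| "arity_ok s (Disj \<phi> \<psi>) \<longleftrightarrow> arity_ok s \<phi> \<and> arity_ok s \<psi>"
| "arity_ok s (Imp \<phi> \<psi>) \<longleftrightarrow> arity_ok s \<phi> \<and> arity_ok s \<psi>"
| "arity_ok s (Iff \<phi> \<psi>) \<longleftrightarrow> arity_ok s \<phi> \<and> arity_ok s \<psi>"
| "arity_ok s (All x \<phi>) \<longleftrightarrow> arity_ok s \<phi>"
| "arity_ok s (Ex x \<phi>) \<longleftrightarrow> arity_ok s \<phi>"

primrec free_vars :: "fo \<Rightarrow> nat set" where
  "free_vars (Eq x y) = {x, y}"
| "free_vars (N xs) = set xs"
| "free_vars (Neg \<phi>) = free_vars \<phi>"
| "free_vars (Conj \<phi> \<psi>) = free_vars \<phi> \<union> free_vars \<psi>"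
| "free_vars (Disj \<phi> \<psi>) = free_vars \<phi> \<union> free_vars \<psi>"
| "free_vars (Imp \<phi> \<psi>) = free_vars \<phi> \<union> free_vars \<psi>"
| "free_vars (Iff \<phi> \<psi>) = free_vars \<phi> \<union> free_vars \<psi>"
| "free_vars (All x \<phi>) = free_vars \<phi> - {x}"
| "free_vars (Ex x \<phi>) = free_vars \<phi> - {x}"

primrec quantifier_depth :: "fo \<Rightarrow> nat" where
  "quantifier_depth (Eq x y) = 0"
| "quantifier_depth (N xs) = 0"
| "quantifier_depth (Neg \<phi>) = quantifier_depth \<phi>"
| "quantifier_depth (Conj \<phi> \<psi>) = max (quantifier_depth \<phi>) (quantifier_depth \<psi>)"
| "quantifier_depth (Disj \<phi> \<psi>) = max (quantifier_depth \<phi>) (quantifier_depth \<psi>)"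
| "quantifier_depth (Imp \<phi> \<psi>) = max (quantifier_depth \<phi>) (quantifier_depth \<psi>)"
| "quantifier_depth (Iff \<phi> \<psi>) = max (quantifier_depth \<phi>) (quantifier_depth \<psi>)"
| "quantifier_depth (All x \<phi>) = Suc (quantifier_depth \<phi>)"
| "quantifier_depth (Ex x \<phi>) = Suc (quantifier_depth \<phi>)"

text \<open>
  In a hypergraph whose edges all have \<open>s\<close> elements, an atom \<open>N [x\<^sub>1, \<dots>, x\<^sub>s]\<close> can only hold if
  the \<open>s\<close> vertices assigned to its variables are pairwise distinct.
\<close>

primrec sat :: "'v set \<Rightarrow> 'v set set \<Rightarrow> (nat \<Rightarrow> 'v) \<Rightarrow> fo \<Rightarrow> bool" where
  "sat V E \<sigma> (Eq x y) \<longleftrightarrow> \<sigma> x = \<sigma> y"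
| "sat V E \<sigma> (N xs) \<longleftrightarrow> \<sigma> ` set xs \<in> E"
| "sat V E \<sigma> (Neg \<phi>) \<longleftrightarrow> \<not> sat V E \<sigma> \<phi>"
| "sat V E \<sigma> (Conj \<phi> \<psi>) \<longleftrightarrow> sat V E \<sigma> \<phi> \<and> sat V E \<sigma> \<psi>"
| "sat V E \<sigma> (Disj \<phi> \<psi>) \<longleftrightarrow> sat V E \<sigma> \<phi> \<or> sat V E \<sigma> \<psi>"
| "sat V E \<sigma> (Imp \<phi> \<psi>) \<longleftrightarrow> (sat V E \<sigma> \<phi> \<longrightarrow> sat V E \<sigma> \<psi>)"
| "sat V E \<sigma> (Iff \<phi> \<psi>) \<longleftrightarrow> (sat V E \<sigma> \<phi> \<longleftrightarrow> sat V E \<sigma> \<psi>)"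
| "sat V E \<sigma> (All x \<phi>) \<longleftrightarrow> (\<forall>v\<in>V. sat V E (\<sigma>(x := v)) \<phi>)"
| "sat V E \<sigma> (Ex x \<phi>) \<longleftrightarrow> (\<exists>v\<in>V. sat V E (\<sigma>(x := v)) \<phi>)"

definition models :: "'v set \<Rightarrow> 'v set set \<Rightarrow> fo \<Rightarrow> bool" where
  "models V E \<phi> \<longleftrightarrow> (\<forall>\<sigma>. range \<sigma> \<subseteq> V \<longrightarrow> sat V E \<sigma> \<phi>)"

definition possible_edges :: "nat \<Rightarrow> nat \<Rightarrow> nat set set" where
  "possible_edges s n = {e. e \<subseteq> {1..n} \<and> card e = s}"

text \<open>The distribution of the edge set of \<open>G\<^sup>s(n, p)\<close>.\<close>

definition random_hypergraph :: "nat \<Rightarrow> nat \<Rightarrow> real \<Rightarrow> nat set set pmf" where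
  "random_hypergraph s n p =
     map_pmf (\<lambda>f. {e \<in> possible_edges s n. f e})
       (Pi_pmf (possible_edges s n) False (\<lambda>_. bernoulli_pmf p))"

definition zero_one_law :: "nat \<Rightarrow> nat \<Rightarrow> (nat \<Rightarrow> real) \<Rightarrow> bool" where
  "zero_one_law k s p \<longleftrightarrow>
     (\<forall>\<phi>. arity_ok s \<phi> \<and> free_vars \<phi> = {} \<and> quantifier_depth \<phi> \<le> k \<longrightarrow>
        (let P = (\<lambda>n. measure_pmf.prob (random_hypergraph s n (p n)) {E. models {1..n} E \<phi>})
         in P \<longlonglongrightarrow> 0 \<or> P \<longlonglongrightarrow> 1))"

end

theory Submission
  imports Defs "HOL-Real_Asymp.Real_Asymp"
begin

text \<open>
  Put \<open>c = binom (k - 2) (s - 1)\<close>, \<open>d = binom (k - 2) (s - 2)\<close> and \<open>C = c + d\<close>. Call a family of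
  \<open>(s - 1)\<close>-subsets of a \<open>(k - 1)\<close>-set rare if it has at least \<open>1 / \<alpha>\<close> members; under the hypothesis
  only families with \<open>C\<close> or \<open>C - 1\<close> members can be rare. Almost surely every family that is not rare
  is the link of some vertex over every \<open>(k - 1)\<close>-set. Hence in the \<open>k\<close>-round Ehrenfeucht game
  Duplicator only has to make sure that after \<open>k - 1\<close> rounds the same rare families are realised as
  links on both sides. This is possible because almost surely, over every \<open>(k - 2)\<close>-set \<open>W\<close>, there
  is a vertex \<open>x\<close> with any prescribed link in \<open>W\<close> such that exactly a prescribed set of rare families
  is realised over \<open>insert x W\<close>. The densest such requirement asks for \<open>x\<close> together with \<open>C + 1\<close>
  further vertices, one for each family with at least \<open>C - 1\<close> members. It adds \<open>C + 2\<close> vertices and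
  \<open>C\<^sup>2 + c\<close> edges, and the hypothesis says precisely that \<open>1 / \<alpha>\<close> exceeds
  \<open>(C\<^sup>2 + c) / (C + 2)\<close>.

  For fixed \<open>W\<close> the failure probability has to be smaller than any power of \<open>n\<close>. First the links of all
  single vertices in \<open>W\<close> are exposed, which fixes the sizes of the classes of vertices with equal link
  up to small factors. Inside the class of the prescribed link a large set \<open>X\<close> of candidates for \<open>x\<close> is
  chosen and the edges containing two vertices of \<open>X\<close> are exposed; most candidates see no rare family
  inside \<open>X\<close>. For these the remaining events are independent.
\<close>

section \<open>Ehrenfeucht game on hypergraphs with few rare links\<close>

definition label :: "'v set set \<Rightarrow> nat \<Rightarrow> 'v set \<Rightarrow> 'v \<Rightarrow> 'v set set" where
  "label E s W x = {Y. Y \<subseteq> W \<and> card Y = s - 1 \<and> insert x Y \<in> E}"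

definition pair_label :: "'v set set \<Rightarrow> nat \<Rightarrow> 'v set \<Rightarrow> 'v \<Rightarrow> 'v \<Rightarrow> 'v set set" where
  "pair_label E s W x z = {Y. Y \<subseteq> W \<and> card Y = s - 2 \<and> insert x (insert z Y) \<in> E}"

text \<open>This is the link of \<open>z\<close> over \<open>insert x W\<close> with
  \<open>x\<close> removed from each member, as \<open>pattern_eq_strip\<close> shows; the members
  with \<open>s - 2\<close> elements are those that contained \<open>x\<close>. Since only subsets
  of \<open>W\<close> occur, patterns seen from different \<open>x\<close> can be compared and
  prescribed in advance.\<close>

definition pattern :: "'v set set \<Rightarrow> nat \<Rightarrow> 'v set \<Rightarrow> 'v \<Rightarrow> 'v \<Rightarrow> 'v set set" where
  "pattern E s W x z = label E s W z \<union> pair_label E s W x z"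

definition subs :: "nat \<Rightarrow> 'v set \<Rightarrow> 'v set set" where
  "subs r W = {Y. Y \<subseteq> W \<and> card Y = r}"

text \<open>The expected number of vertices with a given link of b members is about n^(1 - \<alpha>
  b), so these are the families whose expected number of realisations stays bounded. They use the
  same encoding by subsets of \<open>W\<close> as \<open>pattern\<close>, so that one collection
  serves all \<open>x\<close>.\<close>

definition rare :: "real \<Rightarrow> nat \<Rightarrow> 'v set \<Rightarrow> 'v set set set" where
  "rare \<alpha> s W = {B. B \<subseteq> subs (s - 1) W \<union> subs (s - 2) W \<and> \<alpha> * real (card B) \<ge> 1}"

definition link_realised :: "'v set \<Rightarrow> 'v set set \<Rightarrow> nat \<Rightarrow> 'v set \<Rightarrow> 'v set set \<Rightarrow> bool" where
  "link_realised V E s W B \<longleftrightarrow> (\<exists>v\<in>V - W. label E s W v = B)"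

definition common_links :: "real \<Rightarrow> nat \<Rightarrow> nat \<Rightarrow> 'v set \<Rightarrow> 'v set set \<Rightarrow> bool" where
  "common_links \<alpha> s k V E \<longleftrightarrow>
     (\<forall>W B. W \<subseteq> V \<and> card W = k - 1 \<and> B \<subseteq> subs (s - 1) W \<and> \<alpha> * real (card B) < 1
        \<longrightarrow> link_realised V E s W B)"

text \<open>Asking for \<open>S\<close> as the exact set of rare patterns both forces the members of
  \<open>S\<close> and forbids the other rare ones: Duplicator must neither lose nor create a rare
  link.\<close>

definition rich :: "real \<Rightarrow> nat \<Rightarrow> nat \<Rightarrow> 'v set \<Rightarrow> 'v set set \<Rightarrow> bool" where
  "rich \<alpha> s k V E \<longleftrightarrow>
     (\<forall>W A S. W \<subseteq> V \<and> card W = k - 2 \<and> A \<subseteq> subs (s - 1) W \<and> S \<subseteq> rare \<alpha> s W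
        \<longrightarrow> (\<exists>x\<in>V - W. label E s W x = A \<and>
               pattern E s W x ` (V - W - {x}) \<inter> rare \<alpha> s W = S))"

definition good :: "real \<Rightarrow> nat \<Rightarrow> nat \<Rightarrow> 'v set \<Rightarrow> 'v set set \<Rightarrow> bool" where
  "good \<alpha> s k V E \<longleftrightarrow> finite V \<and> k \<le> card V \<and> (\<forall>e\<in>E. card e = s) \<and>
     common_links \<alpha> s k V E \<and> rich \<alpha> s k V E"

text \<open>A partial isomorphism with the vertices chosen so far as domain \<open>W\<close>, and
  with \<open>j\<close> rounds left. The inequality \<open>card W + j \<le> k\<close> leaves room
  for repeated choices and forgotten vertices. With \<open>k - 1\<close> vertices placed and one
  round left, the final answer depends only on which links are realised, hence the last
  clause.\<close>

definition position ::
  "nat \<Rightarrow> nat \<Rightarrow> 'v set \<Rightarrow> 'v set set \<Rightarrow> 'w set \<Rightarrow> 'w set set \<Rightarrow> 'v set \<Rightarrow> ('v \<Rightarrow> 'w) \<Rightarrow> nat \<Rightarrow> bool"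
where
  "position s k V E V' E' W \<pi> j \<longleftrightarrow>
     finite W \<and> W \<subseteq> V \<and> \<pi> ` W \<subseteq> V' \<and> inj_on \<pi> W \<and>
     (\<forall>Y\<subseteq>W. Y \<in> E \<longleftrightarrow> \<pi> ` Y \<in> E') \<and> card W + j \<le> k \<and>
     (card W = k - 1 \<and> j = 1 \<longrightarrow>
        (\<forall>B\<subseteq>subs (s - 1) W. link_realised V E s W B \<longleftrightarrow>
           link_realised V' E' s (\<pi> ` W) ((`) \<pi> ` B)))"

lemma label_subs: "label E s W x \<subseteq> subs (s - 1) W"
  by (auto simp: label_def subs_def)

lemma finite_subs: "finite W \<Longrightarrow> finite (subs r W)"
  by (auto simp: subs_def)

lemma card_subs: "finite W \<Longrightarrow> card (subs r W) = card W choose r"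
  by (simp add: subs_def n_subsets)

lemma inj_on_image_subs: "inj_on \<pi> W \<Longrightarrow> \<Y> \<subseteq> Pow W \<Longrightarrow> inj_on ((`) \<pi>) \<Y>"
  by (meson inj_on_image_Pow inj_on_subset)

lemma subs_image:
  assumes "inj_on \<pi> W"
  shows "subs r (\<pi> ` W) = (`) \<pi> ` subs r W"
proof
  show "(`) \<pi> ` subs r W \<subseteq> subs r (\<pi> ` W)"
    using assms by (auto simp: subs_def card_image inj_on_subset)
  show "subs r (\<pi> ` W) \<subseteq> (`) \<pi> ` subs r W"
  proof
    fix Y assume Y: "Y \<in> subs r (\<pi> ` W)"
    then obtain Z where Z: "Z \<subseteq> W" "Y = \<pi> ` Z"
      by (auto simp: subs_def subset_image_iff)
    then have "card Z = r" using Y assms by (auto simp: subs_def card_image inj_on_subset)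
    then show "Y \<in> (`) \<pi> ` subs r W" using Z by (auto simp: subs_def)
  qed
qed

text \<open>The clause on realised links survives because a \<open>W0\<close> with
  \<open>k - 1\<close> elements and a round left forces \<open>W0 = W\<close> and
  \<open>j = 1\<close> through \<open>card W + j \<le> k\<close>. This is what lets a position be
  passed on to subformulae with fewer free variables or smaller depth.\<close>

lemma position_subset:
  assumes "position s k V E V' E' W \<pi> j" "W0 \<subseteq> W" "j0 \<le> j"
  shows "position s k V E V' E' W0 \<pi> j0"
proof -
  have fin: "finite W" using assms by (simp add: position_def)
  have "card W0 \<le> card W" using fin assms by (simp add: card_mono)
  moreover have "W0 = W \<and> j = 1" if "card W0 = k - 1" "j0 = 1"
  proof -
    have "card W + j \<le> k" using assms by (simp add: position_def)
    then have "card W = card W0" "j = 1" using that \<open>card W0 \<le> card W\<close> assms(3) by auto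
    then show ?thesis using fin assms(2) by (simp add: card_subset_eq)
  qed
  ultimately show ?thesis
    using assms unfolding position_def
    by (auto intro: finite_subset inj_on_subset)
qed

text \<open>The two hypergraphs can exchange roles, so Duplicator's answers in one direction yield
  those in the other.\<close>

lemma position_inverse:
  assumes "position s k V E V' E' W \<pi> j"
  shows "position s k V' E' V E (\<pi> ` W) (inv_into W \<pi>) j"
proof -
  have inj: "inj_on \<pi> W" and fin: "finite W" using assms by (auto simp: position_def)
  have inv: "inv_into W \<pi> ` \<pi> ` Y = Y" if "Y \<subseteq> W" for Y
    using inj that by (force simp: image_image inv_into_f_f image_iff subset_iff)
  have edges: "Y \<in> E' \<longleftrightarrow> inv_into W \<pi> ` Y \<in> E" if Y: "Y \<subseteq> \<pi> ` W" for Y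
  proof -
    obtain Z where "Z \<subseteq> W" "Y = \<pi> ` Z" using Y by (auto simp: subset_image_iff)
    then show ?thesis using assms inv by (auto simp: position_def)
  qed
  have links: "link_realised V' E' s (\<pi> ` W) B \<longleftrightarrow>
      link_realised V E s (inv_into W \<pi> ` \<pi> ` W) ((`) (inv_into W \<pi>) ` B)"
    if c: "card (\<pi> ` W) = k - 1" "j = 1" and B: "B \<subseteq> subs (s - 1) (\<pi> ` W)" for B
  proof -
    obtain B0 where B0: "B0 \<subseteq> subs (s - 1) W" "B = (`) \<pi> ` B0"
      using B subs_image[OF inj] by (metis subset_imageE)
    have "(`) (inv_into W \<pi>) ` B = (\<lambda>Y. inv_into W \<pi> ` \<pi> ` Y) ` B0"
      unfolding B0(2) by (simp only: image_image)
    also have "\<dots> = (\<lambda>Y. Y) ` B0"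
    proof (rule image_cong)
      fix Y assume "Y \<in> B0"
      then have "Y \<subseteq> W" using B0(1) by (auto simp: subs_def)
      then show "inv_into W \<pi> ` \<pi> ` Y = Y" by (rule inv)
    qed simp
    finally have "(`) (inv_into W \<pi>) ` B = B0" by simp
    then show ?thesis using assms c B0 inj inv[of W]
      by (auto simp: position_def card_image)
  qed
  have "inj_on (inv_into W \<pi>) (\<pi> ` W)" by (simp add: inj_on_inv_into)
  with inv[of W] edges links assms show ?thesis
    unfolding position_def by (auto simp: card_image)
qed

text \<open>Only subsets containing \<open>v\<close> are new, and among these only the ones with
  \<open>s\<close> elements can be edges on either side. So it is enough that the links of
  \<open>v\<close> and \<open>v'\<close> over \<open>W\<close> correspond.\<close>

lemma edges_iso_insert:
  assumes E: "\<forall>e\<in>E. card e = s" "\<forall>e\<in>E'. card e = s" and "s \<ge> 1" "finite W"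
    and inj: "inj_on \<pi> W" and iso: "\<forall>Y\<subseteq>W. Y \<in> E \<longleftrightarrow> \<pi> ` Y \<in> E'"
    and v: "v \<notin> W" "v' \<notin> \<pi> ` W"
    and lab: "\<And>Y. Y \<in> subs (s - 1) W \<Longrightarrow> insert v Y \<in> E \<longleftrightarrow> insert v' (\<pi> ` Y) \<in> E'"
  shows "\<forall>Y\<subseteq>insert v W. Y \<in> E \<longleftrightarrow> (\<pi>(v := v')) ` Y \<in> E'"
proof (intro allI impI)
  fix Y assume Y: "Y \<subseteq> insert v W"
  show "Y \<in> E \<longleftrightarrow> (\<pi>(v := v')) ` Y \<in> E'"
  proof (cases "v \<in> Y")
    case False
    then have "Y \<subseteq> W" "(\<pi>(v := v')) ` Y = \<pi> ` Y" using Y by (auto intro: image_cong)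
    then show ?thesis using iso by simp
  next
    case True
    define Z where "Z = Y - {v}"
    have Z: "Z \<subseteq> W" "Y = insert v Z" "v \<notin> Z" using True Y by (auto simp: Z_def)
    have fZ: "finite Z" using Z assms(4) finite_subset by blast
    have im: "(\<pi>(v := v')) ` Y = insert v' (\<pi> ` Z)" using Z by auto
    have "v' \<notin> \<pi> ` Z" using v Z by auto
    then have c: "card Y = Suc (card Z)" "card (insert v' (\<pi> ` Z)) = Suc (card Z)"
      using Z fZ inj by (auto simp: card_image inj_on_subset)
    show ?thesis
    proof (cases "card Z = s - 1")
      case True
      then show ?thesis using lab[of Z] Z im by (simp add: subs_def)
    next
      case False
      then have "Y \<notin> E" "insert v' (\<pi> ` Z) \<notin> E'" using E c assms(3) by force+
      then show ?thesis using im by simp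
    qed
  qed
qed

text \<open>Families of \<open>(s - 1)\<close>-subsets of \<open>insert v W\<close> are encoded as families of subsets of \<open>W\<close>
  by deleting \<open>v\<close>.\<close>

definition strip :: "nat \<Rightarrow> 'v set \<Rightarrow> 'v \<Rightarrow> 'v set set \<Rightarrow> 'v set set" where
  "strip s W v B = {Y \<in> subs (s - 1) W. Y \<in> B} \<union> {Y \<in> subs (s - 2) W. insert v Y \<in> B}"

lemma strip_eq_image:
  assumes "v \<notin> W" "finite W" "s \<ge> 2" "B \<subseteq> subs (s - 1) (insert v W)"
  shows "strip s W v B = (\<lambda>Y. Y - {v}) ` B"
proof
  show "strip s W v B \<subseteq> (\<lambda>Y. Y - {v}) ` B"
  proof
    fix Y assume Y: "Y \<in> strip s W v B"
    then have "v \<notin> Y" using assms by (auto simp: strip_def subs_def)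
    then have "Y - {v} = Y" "insert v Y - {v} = Y" by auto
    moreover have "Y \<in> B \<or> insert v Y \<in> B" using Y by (auto simp: strip_def)
    ultimately show "Y \<in> (\<lambda>Y. Y - {v}) ` B" by (metis image_eqI)
  qed
  show "(\<lambda>Y. Y - {v}) ` B \<subseteq> strip s W v B"
  proof
    fix Z assume "Z \<in> (\<lambda>Y. Y - {v}) ` B"
    then obtain Y where Y: "Y \<in> B" "Z = Y - {v}" by auto
    have YW: "Y \<subseteq> insert v W" "card Y = s - 1" using Y assms by (auto simp: subs_def)
    have "finite Y" using YW assms finite_subset by blast
    show "Z \<in> strip s W v B"
    proof (cases "v \<in> Y")
      case True
      then have "card Z = s - 2" using Y YW \<open>finite Y\<close> by simp
      then show ?thesis using True Y YW by (auto simp: strip_def subs_def insert_absorb)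
    next
      case False
      then show ?thesis using Y YW by (auto simp: strip_def subs_def)
    qed
  qed
qed

text \<open>All members of \<open>B\<close> have the same cardinality, so the size of
  \<open>Y - {v}\<close> reveals whether \<open>v\<close> was in \<open>Y\<close>.\<close>

lemma inj_on_strip:
  assumes "v \<notin> W" "finite W" "s \<ge> 2" "B \<subseteq> subs (s - 1) (insert v W)"
  shows "inj_on (\<lambda>Y. Y - {v}) B"
proof (rule inj_onI)
  fix Y Z assume *: "Y \<in> B" "Z \<in> B" "Y - {v} = Z - {v}"
  have f: "finite Y" "finite Z" using * assms finite_subset by (auto simp: subs_def intro!: finite_subset[of _ "insert v W"])
  have "card Y = s - 1" "card Z = s - 1" using * assms(4) by (auto simp: subs_def)
  then have "card Y = card Z" by simp
  then have "v \<in> Y \<longleftrightarrow> v \<in> Z" using *(3) f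
    by (metis card_Diff_singleton_if Diff_empty Diff_insert0 card_Diff1_less nless_le)
  then show "Y = Z" using *(3) by blast
qed

lemma card_strip:
  assumes "v \<notin> W" "finite W" "s \<ge> 2" "B \<subseteq> subs (s - 1) (insert v W)"
  shows "card (strip s W v B) = card B"
  using strip_eq_image[OF assms] inj_on_strip[OF assms] by (simp add: card_image)

lemma strip_subset: "strip s W v B \<subseteq> subs (s - 1) W \<union> subs (s - 2) W"
  by (auto simp: strip_def)

lemma pattern_eq_strip:
  assumes "v \<notin> W" "finite W" "s \<ge> 3"
  shows "pattern E s W v z = strip s W v (label E s (insert v W) z)"
proof -
  have c: "card (insert v Y) = s - 1" if "Y \<subseteq> W" "card Y = s - 2" for Y
  proof -
    have "finite Y" "v \<notin> Y" using that assms finite_subset by auto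
    then show ?thesis using that assms by simp
  qed
  have "Y \<in> pattern E s W v z \<longleftrightarrow> Y \<in> strip s W v (label E s (insert v W) z)" for Y
    using c[of Y] by (auto simp: pattern_def strip_def label_def pair_label_def subs_def insert_commute)
  then show ?thesis by blast
qed

lemma strip_inject:
  assumes "v \<notin> W" "finite W" "s \<ge> 2" "B \<subseteq> subs (s - 1) (insert v W)" "B' \<subseteq> subs (s - 1) (insert v W)"
  shows "strip s W v B = strip s W v B' \<longleftrightarrow> B = B'"
proof
  assume "strip s W v B = strip s W v B'"
  then have "(\<lambda>Y. Y - {v}) ` B = (\<lambda>Y. Y - {v}) ` B'" using strip_eq_image assms by metis
  then show "B = B'"
    using inj_on_strip[of v W s "B \<union> B'"] assms inj_on_image_eq_iff[of "\<lambda>Y. Y - {v}" "B \<union> B'" B B']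
    by auto
qed simp

lemma link_realised_iff_pattern:
  assumes "v \<notin> W" "finite W" "s \<ge> 3" "B \<subseteq> subs (s - 1) (insert v W)"
  shows "link_realised V E s (insert v W) B \<longleftrightarrow> strip s W v B \<in> pattern E s W v ` (V - W - {v})"
proof -
  have "label E s (insert v W) z = B \<longleftrightarrow> pattern E s W v z = strip s W v B" for z
    using strip_inject[of v W s "label E s (insert v W) z" B] assms label_subs[of E s "insert v W" z]
    by (simp add: pattern_eq_strip)
  then have "link_realised V E s (insert v W) B \<longleftrightarrow>
      (\<exists>z\<in>V - insert v W. pattern E s W v z = strip s W v B)"
    by (simp add: link_realised_def)
  moreover have "V - insert v W = V - W - {v}" by auto
  ultimately show ?thesis by (auto simp: image_iff)
qed

lemma strip_image:
  assumes "v \<notin> W" "finite W" "s \<ge> 2" "B \<subseteq> subs (s - 1) (insert v W)"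
    and "inj_on \<pi> W" "v' \<notin> \<pi> ` W"
  shows "strip s (\<pi> ` W) v' ((`) (\<pi>(v := v')) ` B) = (`) \<pi> ` strip s W v B"
proof -
  let ?p = "\<pi>(v := v')"
  have inj: "inj_on ?p (insert v W)" using assms by (auto simp: inj_on_def)
  have im: "?p ` insert v W = insert v' (\<pi> ` W)" using assms by auto
  have sub: "(`) ?p ` B \<subseteq> subs (s - 1) (insert v' (\<pi> ` W))"
    using subs_image[OF inj, of "s - 1"] assms(4) im by auto
  have "strip s (\<pi> ` W) v' ((`) ?p ` B) = (\<lambda>Y. ?p ` Y - {v'}) ` B"
    using strip_eq_image[OF assms(6) _ assms(3) sub] assms(2) by (simp add: image_image)
  also have "\<dots> = (\<lambda>Y. \<pi> ` (Y - {v})) ` B"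
  proof (rule image_cong)
    fix Y assume "Y \<in> B"
    then have "Y \<subseteq> insert v W" using assms by (auto simp: subs_def)
    then show "?p ` Y - {v'} = \<pi> ` (Y - {v})" using assms by (auto simp: image_iff)
  qed simp
  also have "\<dots> = (`) \<pi> ` strip s W v B"
    using strip_eq_image[OF assms(1-4)] by (simp add: image_image)
  finally show ?thesis .
qed

text \<open>With \<open>k - 1\<close> vertices placed, the last clause of \<open>position\<close>
  supplies the answer. Before that \<open>rich\<close> supplies it: the answer must copy the link of
  \<open>v\<close> and, if it completes a set of \<open>k - 1\<close> vertices, also the rare
  patterns seen from \<open>v\<close>.\<close>

lemma position_extend:
  assumes gV: "good \<alpha> s k V E" and gV': "good \<alpha> s k V' E'"
    and s: "s \<ge> 3" and k: "k \<ge> s + 1"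
    and pos: "position s k V E V' E' W \<pi> (Suc j)" and v: "v \<in> V" "v \<notin> W"
  shows "\<exists>v'\<in>V'. position s k V E V' E' (insert v W) (\<pi>(v := v')) j"
proof -
  have fin: "finite W" and inj: "inj_on \<pi> W" and WV: "W \<subseteq> V" "\<pi> ` W \<subseteq> V'"
    and iso: "\<forall>Y\<subseteq>W. Y \<in> E \<longleftrightarrow> \<pi> ` Y \<in> E'" and c: "card W + Suc j \<le> k"
    using pos by (auto simp: position_def)
  have cE: "\<forall>e\<in>E. card e = s" "\<forall>e\<in>E'. card e = s" using gV gV' by (auto simp: good_def)
  have cV': "finite V'" "k \<le> card V'" using gV' by (auto simp: good_def)
  define A where "A = label E s W v"
  have A: "A \<subseteq> subs (s - 1) W" unfolding A_def by (rule label_subs)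
  have A_im: "insert v Y \<in> E \<longleftrightarrow> \<pi> ` Y \<in> (`) \<pi> ` A" if "Y \<in> subs (s - 1) W" for Y
  proof -
    have "\<pi> ` Y \<in> (`) \<pi> ` A \<longleftrightarrow> Y \<in> A"
      using inj_on_image_subs[OF inj, of "Pow W"] that A
      by (intro inj_on_image_mem_iff[of _ "Pow W"]) (auto simp: subs_def)
    then show ?thesis using that by (simp add: A_def label_def subs_def)
  qed
  have im_fin: "finite (insert v W)" "card (insert v W) = Suc (card W)" using fin v by auto
  have close: "position s k V E V' E' (insert v W) (\<pi>(v := v')) j"
    if v': "v' \<in> V' - \<pi> ` W"
      and lab: "\<And>Y. Y \<in> subs (s - 1) W \<Longrightarrow> insert v' (\<pi> ` Y) \<in> E' \<longleftrightarrow> \<pi> ` Y \<in> (`) \<pi> ` A"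
      and links: "\<And>B. card (insert v W) = k - 1 \<Longrightarrow> j = 1 \<Longrightarrow> B \<subseteq> subs (s - 1) (insert v W) \<Longrightarrow>
         link_realised V E s (insert v W) B \<longleftrightarrow>
           link_realised V' E' s (insert v' (\<pi> ` W)) ((`) (\<pi>(v := v')) ` B)" for v'
  proof -
    have "\<forall>Y\<subseteq>insert v W. Y \<in> E \<longleftrightarrow> (\<pi>(v := v')) ` Y \<in> E'"
      using v' lab A_im v s
      by (intro edges_iso_insert[OF cE _ fin inj iso]) auto
    moreover have "inj_on (\<pi>(v := v')) (insert v W)"
      using inj v v' by (auto simp: inj_on_def)
    moreover have im: "(\<pi>(v := v')) ` insert v W = insert v' (\<pi> ` W)" using v by auto
    ultimately show ?thesis
      unfolding position_def im using im_fin WV v v' c links by auto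
  qed
  show ?thesis
  proof (cases "card W = k - 1")
    case True
    then have "j = 0" using c k by simp
    have "link_realised V E s W A" using v by (auto simp: link_realised_def A_def)
    then have "link_realised V' E' s (\<pi> ` W) ((`) \<pi> ` A)"
      using pos True \<open>j = 0\<close> A by (auto simp: position_def)
    then obtain v' where v': "v' \<in> V' - \<pi> ` W" "label E' s (\<pi> ` W) v' = (`) \<pi> ` A"
      by (auto simp: link_realised_def)
    have "insert v' (\<pi> ` Y) \<in> E' \<longleftrightarrow> \<pi> ` Y \<in> (`) \<pi> ` A" if "Y \<in> subs (s - 1) W" for Y
    proof -
      have "\<pi> ` Y \<in> subs (s - 1) (\<pi> ` W)" using that subs_image[OF inj] by auto
      then show ?thesis unfolding v'(2)[symmetric] by (auto simp: label_def subs_def)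
    qed
    then show ?thesis using close[of v'] v' \<open>j = 0\<close> by auto
  next
    case False
    then have c2: "card W \<le> k - 2" using c by simp
    have cW': "card (\<pi> ` W) = card W" using inj by (simp add: card_image)
    \<comment> \<open>\<open>rich\<close> speaks of sets with exactly \<open>k - 2\<close> elements,
      so a smaller image is padded. The prescribed rare patterns \<open>S'\<close> matter only if no
      padding took place, because only then does the answer complete \<open>k - 1\<close>
      vertices.\<close>
    obtain W' where W': "\<pi> ` W \<subseteq> W'" "W' \<subseteq> V'" "card W' = k - 2"
    proof -
      have "card (\<pi> ` W) \<le> k - 2" "k - 2 \<le> card V'" using cV' c2 cW' by linarith+
      then show ?thesis using exists_subset_between[OF _ _ WV(2) cV'(1)] that by blast
    qed
    have fW': "finite W'" using W' cV' finite_subset by blast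
    define S where "S = pattern E s W v ` (V - W - {v}) \<inter> rare \<alpha> s W"
    define S' where "S' = (if W' = \<pi> ` W then (`) ((`) \<pi>) ` S else {})"
    have A': "(`) \<pi> ` A \<subseteq> subs (s - 1) W'"
    proof -
      have "(`) \<pi> ` A \<subseteq> subs (s - 1) (\<pi> ` W)" using A subs_image[OF inj, of "s - 1"] by blast
      also have "\<dots> \<subseteq> subs (s - 1) W'" using W'(1) by (auto simp: subs_def)
      finally show ?thesis .
    qed
    let ?Y = "subs (s - 1) W \<union> subs (s - 2) W"
    have injY: "inj_on ((`) \<pi>) ?Y"
      by (rule inj_on_image_subs[OF inj]) (auto simp: subs_def)
    have rare_im: "(`) \<pi> ` \<tau> \<in> rare \<alpha> s (\<pi> ` W) \<longleftrightarrow> \<tau> \<in> rare \<alpha> s W" if "\<tau> \<subseteq> ?Y" for \<tau>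
    proof -
      have "card ((`) \<pi> ` \<tau>) = card \<tau>" using injY that by (simp add: card_image inj_on_subset)
      moreover have "(`) \<pi> ` \<tau> \<subseteq> subs (s - 1) (\<pi> ` W) \<union> subs (s - 2) (\<pi> ` W)"
        using that by (auto simp: subs_image[OF inj])
      ultimately show ?thesis using that by (simp add: rare_def)
    qed
    have "S' \<subseteq> rare \<alpha> s W'"
      using rare_im by (auto simp: S'_def S_def rare_def)
    then obtain v' where v': "v' \<in> V' - W'" "label E' s W' v' = (`) \<pi> ` A"
       "pattern E' s W' v' ` (V' - W' - {v'}) \<inter> rare \<alpha> s W' = S'"
      using gV' W' A' unfolding good_def rich_def by meson
    have v'W: "v' \<in> V' - \<pi> ` W" using v' W' by auto
    have lab: "insert v' (\<pi> ` Y) \<in> E' \<longleftrightarrow> \<pi> ` Y \<in> (`) \<pi> ` A" if "Y \<in> subs (s - 1) W" for Y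
    proof -
      have "\<pi> ` Y \<in> subs (s - 1) (\<pi> ` W)" using that subs_image[OF inj, of "s - 1"] by blast
      then have "\<pi> ` Y \<in> subs (s - 1) W'" using W'(1) unfolding subs_def by blast
      then show ?thesis unfolding v'(2)[symmetric] by (auto simp: label_def subs_def)
    qed
    have links: "link_realised V E s (insert v W) B \<longleftrightarrow>
           link_realised V' E' s (insert v' (\<pi> ` W)) ((`) (\<pi>(v := v')) ` B)"
      if cv: "card (insert v W) = k - 1" and B: "B \<subseteq> subs (s - 1) (insert v W)" for B
    proof -
      let ?p = "\<pi>(v := v')"
      have "card W = k - 2" using cv im_fin by simp
      then have W'eq: "W' = \<pi> ` W" using W' fW' cW' by (metis card_subset_eq)
      have injp: "inj_on ?p (insert v W)" using inj v v'W by (auto simp: inj_on_def)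
      have im: "?p ` insert v W = insert v' (\<pi> ` W)" using v by auto
      have Bp: "(`) ?p ` B \<subseteq> subs (s - 1) (insert v' (\<pi> ` W))"
        using subs_image[OF injp, of "s - 1"] B im by auto
      have cB: "card ((`) ?p ` B) = card B"
        using B inj_on_image_subs[OF injp, of B] by (intro card_image) (auto simp: subs_def)
      show ?thesis
      \<comment> \<open>Families that are not rare are realised on both sides by
        \<open>common_links\<close>; rare ones are compared through the stripped encoding and the
        choice of \<open>S'\<close>.\<close>
      proof (cases "\<alpha> * real (card B) < 1")
        case True
        have "insert v W \<subseteq> V" using v WV by auto
        then have "link_realised V E s (insert v W) B"
          using gV True B cv by (auto simp: good_def common_links_def)
        moreover have "card (insert v' (\<pi> ` W)) = k - 1"
          using cv injp im by (metis card_image)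
        moreover have "insert v' (\<pi> ` W) \<subseteq> V'" using v' WV by auto
        ultimately show ?thesis
          using gV' True Bp cB by (auto simp: good_def common_links_def)
      next
        case False
        let ?\<tau> = "strip s W v B"
        have s2: "s \<ge> 2" using s by simp
        have tau: "?\<tau> \<subseteq> ?Y" by (rule strip_subset)
        have "card ?\<tau> = card B" using card_strip[OF v(2) fin s2 B] .
        then have rt: "?\<tau> \<in> rare \<alpha> s W" using tau False by (simp add: rare_def)
        have "link_realised V E s (insert v W) B \<longleftrightarrow> ?\<tau> \<in> S"
          using link_realised_iff_pattern[OF v(2) fin s B] rt by (simp add: S_def)
        also have "\<dots> \<longleftrightarrow> (`) \<pi> ` ?\<tau> \<in> (`) ((`) \<pi>) ` S"
        proof -
          have "inj_on ((`) ((`) \<pi>)) (Pow ?Y)" using injY by (rule inj_on_image_Pow)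
          then show ?thesis using tau
            by (subst inj_on_image_mem_iff[of _ "Pow ?Y"]) (auto simp: S_def rare_def)
        qed
        also have "\<dots> \<longleftrightarrow> (`) \<pi> ` ?\<tau> \<in> pattern E' s (\<pi> ` W) v' ` (V' - \<pi> ` W - {v'})"
        proof -
          have "(`) \<pi> ` ?\<tau> \<in> rare \<alpha> s (\<pi> ` W)" using rare_im[OF tau] rt by blast
          moreover have "pattern E' s (\<pi> ` W) v' ` (V' - \<pi> ` W - {v'}) \<inter> rare \<alpha> s (\<pi> ` W)
              = (`) ((`) \<pi>) ` S" using v'(3) unfolding S'_def if_P[OF W'eq] unfolding W'eq .
          ultimately show ?thesis by (metis Int_iff)
        qed
        also have "\<dots> \<longleftrightarrow> link_realised V' E' s (insert v' (\<pi> ` W)) ((`) ?p ` B)"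
          using link_realised_iff_pattern[of v' "\<pi> ` W" s "(`) ?p ` B" V' E'] v'W fin s Bp
            strip_image[OF v(2) fin s2 B inj, of v'] by simp
        finally show ?thesis .
      qed
    qed
    show ?thesis using close[OF v'W lab links] v'W by auto
  qed
qed

section \<open>Forth and back moves, and the transfer of formulae\<close>

lemma position_forth:
  assumes "good \<alpha> s k V E" "good \<alpha> s k V' E'" "s \<ge> 3" "k \<ge> s + 1"
    and pos: "position s k V E V' E' W \<pi> (Suc j)" and v: "v \<in> V"
  shows "\<exists>\<pi>'. position s k V E V' E' (insert v W) \<pi>' j \<and> (\<forall>w\<in>W. \<pi>' w = \<pi> w)"
proof (cases "v \<in> W")
  case True
  then show ?thesis using position_subset[OF pos, of W j] by (auto simp: insert_absorb)
next
  case False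
  obtain v' where "position s k V E V' E' (insert v W) (\<pi>(v := v')) j"
    using position_extend[OF assms False] by blast
  moreover have "\<forall>w\<in>W. (\<pi>(v := v')) w = \<pi> w" using False by auto
  ultimately show ?thesis by blast
qed

lemma position_back:
  assumes "good \<alpha> s k V E" "good \<alpha> s k V' E'" "s \<ge> 3" "k \<ge> s + 1"
    and pos: "position s k V E V' E' W \<pi> (Suc j)" and v: "v' \<in> V'"
  shows "\<exists>v\<in>V. \<exists>\<pi>'. position s k V E V' E' (insert v W) \<pi>' j \<and> (\<forall>w\<in>W. \<pi>' w = \<pi> w) \<and> \<pi>' v = v'"
proof -
  have inj: "inj_on \<pi> W" using pos by (simp add: position_def)
  obtain \<rho> where \<rho>: "position s k V' E' V E (insert v' (\<pi> ` W)) \<rho> j"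
    and eq: "\<forall>w\<in>\<pi> ` W. \<rho> w = inv_into W \<pi> w"
    using position_forth[OF assms(2,1,3,4) position_inverse[OF pos] v] by blast
  let ?D = "insert v' (\<pi> ` W)"
  have eqW: "\<rho> (\<pi> w) = w" if "w \<in> W" for w using eq inj that by simp
  have inj\<rho>: "inj_on \<rho> ?D" and im: "\<rho> ` ?D \<subseteq> V" using \<rho> by (simp_all add: position_def)
  have "\<rho> ` ?D = insert (\<rho> v') W"
    using eqW by (auto simp: image_image)
  then have "position s k V E V' E' (insert (\<rho> v') W) (inv_into ?D \<rho>) j"
    using position_inverse[OF \<rho>] by simp
  moreover have "inv_into ?D \<rho> w = \<pi> w" if "w \<in> W" for w
    using inv_into_f_f[OF inj\<rho>, of "\<pi> w"] eqW that by simp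
  moreover have "inv_into ?D \<rho> (\<rho> v') = v'" using inv_into_f_f[OF inj\<rho>] by simp
  ultimately show ?thesis using im by blast
qed

text \<open>Both quantifiers use the same two directions. The position holds only the values of the
  free variables other than \<open>x\<close>; the vertex chosen for \<open>x\<close> uses up one
  round, which is the round that the quantifier contributes to the depth.\<close>

lemma sat_transfer_step:
  assumes good: "good \<alpha> s k V E" "good \<alpha> s k V' E'" "s \<ge> 3" "k \<ge> s + 1"
    and pos: "position s k V E V' E' (\<sigma> ` (free_vars \<phi> - {x})) \<pi> (Suc (quantifier_depth \<phi>))"
    and eq: "\<forall>y\<in>free_vars \<phi> - {x}. \<sigma>' y = \<pi> (\<sigma> y)"
    and IH: "\<And>\<sigma> \<sigma>' \<pi>. position s k V E V' E' (\<sigma> ` free_vars \<phi>) \<pi> (quantifier_depth \<phi>) \<Longrightarrow>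
      \<forall>x\<in>free_vars \<phi>. \<sigma>' x = \<pi> (\<sigma> x) \<Longrightarrow> sat V E \<sigma> \<phi> \<longleftrightarrow> sat V' E' \<sigma>' \<phi>"
  shows "v \<in> V \<Longrightarrow> \<exists>v'\<in>V'. sat V E (\<sigma>(x := v)) \<phi> \<longleftrightarrow> sat V' E' (\<sigma>'(x := v')) \<phi>"
    and "v' \<in> V' \<Longrightarrow> \<exists>v\<in>V. sat V E (\<sigma>(x := v)) \<phi> \<longleftrightarrow> sat V' E' (\<sigma>'(x := v')) \<phi>"
proof -
  let ?W = "\<sigma> ` (free_vars \<phi> - {x})"
  have use: "sat V E (\<sigma>(x := v)) \<phi> \<longleftrightarrow> sat V' E' (\<sigma>'(x := \<pi>' v)) \<phi>"
    if p: "position s k V E V' E' (insert v ?W) \<pi>' (quantifier_depth \<phi>)"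
      and ag: "\<forall>w\<in>?W. \<pi>' w = \<pi> w" for v \<pi>'
  proof (rule IH)
    show "position s k V E V' E' ((\<sigma>(x := v)) ` free_vars \<phi>) \<pi>' (quantifier_depth \<phi>)"
      by (rule position_subset[OF p]) auto
    show "\<forall>y\<in>free_vars \<phi>. (\<sigma>'(x := \<pi>' v)) y = \<pi>' ((\<sigma>(x := v)) y)"
      using eq ag by auto
  qed
  {
    assume "v \<in> V"
    then obtain \<pi>' where p: "position s k V E V' E' (insert v ?W) \<pi>' (quantifier_depth \<phi>)"
      "\<forall>w\<in>?W. \<pi>' w = \<pi> w"
      using position_forth[OF good pos] by blast
    moreover have "\<pi>' v \<in> V'" using p by (simp add: position_def)
    ultimately show "\<exists>v'\<in>V'. sat V E (\<sigma>(x := v)) \<phi> \<longleftrightarrow> sat V' E' (\<sigma>'(x := v')) \<phi>"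
      using use by blast
  }
  {
    assume "v' \<in> V'"
    then obtain v \<pi>' where "v \<in> V" "position s k V E V' E' (insert v ?W) \<pi>' (quantifier_depth \<phi>)"
      "\<forall>w\<in>?W. \<pi>' w = \<pi> w" "\<pi>' v = v'"
      using position_back[OF good pos] by blast
    then show "\<exists>v\<in>V. sat V E (\<sigma>(x := v)) \<phi> \<longleftrightarrow> sat V' E' (\<sigma>'(x := v')) \<phi>"
      using use by blast
  }
qed

lemma sat_transfer:
  assumes "good \<alpha> s k V E" "good \<alpha> s k V' E'" "s \<ge> 3" "k \<ge> s + 1"
    and "position s k V E V' E' (\<sigma> ` free_vars \<phi>) \<pi> (quantifier_depth \<phi>)"
    and "\<forall>x\<in>free_vars \<phi>. \<sigma>' x = \<pi> (\<sigma> x)"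
  shows "sat V E \<sigma> \<phi> \<longleftrightarrow> sat V' E' \<sigma>' \<phi>"
  using assms(5,6)
proof (induction \<phi> arbitrary: \<sigma> \<sigma>' \<pi>)
  case (Eq x y)
  then have "inj_on \<pi> {\<sigma> x, \<sigma> y}" by (simp add: position_def)
  then have "\<pi> (\<sigma> x) = \<pi> (\<sigma> y) \<longleftrightarrow> \<sigma> x = \<sigma> y" by (rule inj_on_eq_iff) simp_all
  moreover have "\<sigma>' x = \<pi> (\<sigma> x)" "\<sigma>' y = \<pi> (\<sigma> y)" using Eq(2) unfolding free_vars.simps by blast+
  ultimately show ?case unfolding sat.simps by metis
next
  case (N xs)
  have "\<sigma>' ` set xs = \<pi> ` \<sigma> ` set xs" using N(2) by (auto simp: image_image)
  moreover have "\<sigma> ` set xs \<in> E \<longleftrightarrow> \<pi> ` \<sigma> ` set xs \<in> E'"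
    using N(1) unfolding position_def free_vars.simps by blast
  ultimately show ?case by simp
next
  case (Neg \<phi>)
  then show ?case by simp
next
  case (Conj \<phi> \<psi>)
  have "sat V E \<sigma> \<phi> \<longleftrightarrow> sat V' E' \<sigma>' \<phi>"
    by (rule Conj.IH(1)[OF position_subset[OF Conj.prems(1)]]) (use Conj.prems(2) in auto)
  moreover have "sat V E \<sigma> \<psi> \<longleftrightarrow> sat V' E' \<sigma>' \<psi>"
    by (rule Conj.IH(2)[OF position_subset[OF Conj.prems(1)]]) (use Conj.prems(2) in auto)
  ultimately show ?case by simp
next
  case (Disj \<phi> \<psi>)
  have "sat V E \<sigma> \<phi> \<longleftrightarrow> sat V' E' \<sigma>' \<phi>"
    by (rule Disj.IH(1)[OF position_subset[OF Disj.prems(1)]]) (use Disj.prems(2) in auto)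
  moreover have "sat V E \<sigma> \<psi> \<longleftrightarrow> sat V' E' \<sigma>' \<psi>"
    by (rule Disj.IH(2)[OF position_subset[OF Disj.prems(1)]]) (use Disj.prems(2) in auto)
  ultimately show ?case by simp
next
  case (Imp \<phi> \<psi>)
  have "sat V E \<sigma> \<phi> \<longleftrightarrow> sat V' E' \<sigma>' \<phi>"
    by (rule Imp.IH(1)[OF position_subset[OF Imp.prems(1)]]) (use Imp.prems(2) in auto)
  moreover have "sat V E \<sigma> \<psi> \<longleftrightarrow> sat V' E' \<sigma>' \<psi>"
    by (rule Imp.IH(2)[OF position_subset[OF Imp.prems(1)]]) (use Imp.prems(2) in auto)
  ultimately show ?case by simp
next
  case (Iff \<phi> \<psi>)
  have "sat V E \<sigma> \<phi> \<longleftrightarrow> sat V' E' \<sigma>' \<phi>"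
    by (rule Iff.IH(1)[OF position_subset[OF Iff.prems(1)]]) (use Iff.prems(2) in auto)
  moreover have "sat V E \<sigma> \<psi> \<longleftrightarrow> sat V' E' \<sigma>' \<psi>"
    by (rule Iff.IH(2)[OF position_subset[OF Iff.prems(1)]]) (use Iff.prems(2) in auto)
  ultimately show ?case by simp
next
  case (All x \<phi>)
  have p: "position s k V E V' E' (\<sigma> ` (free_vars \<phi> - {x})) \<pi> (Suc (quantifier_depth \<phi>))"
    "\<forall>y\<in>free_vars \<phi> - {x}. \<sigma>' y = \<pi> (\<sigma> y)"
    using All.prems by simp_all
  have fwd: "\<exists>v'\<in>V'. sat V E (\<sigma>(x := v)) \<phi> \<longleftrightarrow> sat V' E' (\<sigma>'(x := v')) \<phi>" if "v \<in> V" for v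
    by (rule sat_transfer_step(1)[OF assms(1-4) p All.IH that])
  have bwd: "\<exists>v\<in>V. sat V E (\<sigma>(x := v)) \<phi> \<longleftrightarrow> sat V' E' (\<sigma>'(x := v')) \<phi>" if "v' \<in> V'" for v'
    by (rule sat_transfer_step(2)[OF assms(1-4) p All.IH that])
  show ?case unfolding sat.simps using fwd bwd by blast
next
  case (Ex x \<phi>)
  have p: "position s k V E V' E' (\<sigma> ` (free_vars \<phi> - {x})) \<pi> (Suc (quantifier_depth \<phi>))"
    "\<forall>y\<in>free_vars \<phi> - {x}. \<sigma>' y = \<pi> (\<sigma> y)"
    using Ex.prems by simp_all
  have fwd: "\<exists>v'\<in>V'. sat V E (\<sigma>(x := v)) \<phi> \<longleftrightarrow> sat V' E' (\<sigma>'(x := v')) \<phi>" if "v \<in> V" for v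
    by (rule sat_transfer_step(1)[OF assms(1-4) p Ex.IH that])
  have bwd: "\<exists>v\<in>V. sat V E (\<sigma>(x := v)) \<phi> \<longleftrightarrow> sat V' E' (\<sigma>'(x := v')) \<phi>" if "v' \<in> V'" for v'
    by (rule sat_transfer_step(2)[OF assms(1-4) p Ex.IH that])
  show ?case unfolding sat.simps using fwd bwd by blast
qed

lemma models_transfer:
  assumes good: "good \<alpha> s k V E" "good \<alpha> s k V' E'" and s: "s \<ge> 3" "k \<ge> s + 1"
    and \<phi>: "free_vars \<phi> = {}" "quantifier_depth \<phi> \<le> k"
  shows "models V E \<phi> \<longleftrightarrow> models V' E' \<phi>"
proof -
  \<comment> \<open>For a closed formula nothing is placed at the start. The empty map is a position
    because the empty set is an edge on neither side.\<close>
  have "{} \<notin> E" "{} \<notin> E'" using good s unfolding good_def by force+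
  then have "position s k V E V' E' (\<sigma> ` free_vars \<phi>) \<pi> (quantifier_depth \<phi>)" for \<sigma> \<pi>
    using \<phi> s by (simp add: position_def)
  then have sat: "sat V E \<sigma> \<phi> \<longleftrightarrow> sat V' E' \<sigma>' \<phi>" for \<sigma> \<sigma>'
    using sat_transfer[OF good s] \<phi> by simp
  have "V \<noteq> {}" "V' \<noteq> {}" using good s by (auto simp: good_def)
  then obtain a b where "a \<in> V" "b \<in> V'" by blast
  then have "range (\<lambda>_. a) \<subseteq> V" "range (\<lambda>_. b) \<subseteq> V'" by auto
  then show ?thesis unfolding models_def using sat by blast
qed

section \<open>Events depending on disjoint sets of coordinates\<close>

abbreviation (input) mix :: "'i set \<Rightarrow> ('i \<Rightarrow> 'a) \<Rightarrow> ('i \<Rightarrow> 'a) \<Rightarrow> 'i \<Rightarrow> 'a" where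
  "mix J g h \<equiv> (\<lambda>i. if i \<in> J then g i else h i)"

definition depends_on :: "(('i \<Rightarrow> 'a) \<Rightarrow> 'b) \<Rightarrow> 'i set \<Rightarrow> bool" where
  "depends_on F J \<longleftrightarrow> (\<forall>f g. (\<forall>i\<in>J. f i = g i) \<longrightarrow> F f = F g)"

lemma depends_onI: "(\<And>f g. (\<And>i. i \<in> J \<Longrightarrow> f i = g i) \<Longrightarrow> F f = F g) \<Longrightarrow> depends_on F J"
  unfolding depends_on_def by blast

lemma depends_onD: "depends_on F J \<Longrightarrow> (\<And>i. i \<in> J \<Longrightarrow> f i = g i) \<Longrightarrow> F f = F g"
  unfolding depends_on_def by blast

lemma depends_on_comp: "depends_on F J \<Longrightarrow> depends_on (\<lambda>f. G (F f)) J"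
  unfolding depends_on_def by metis

text \<open>Two independent samples may be spliced along \<open>J\<close>, since the coordinates in
  \<open>I \<inter> J\<close> and in \<open>I - J\<close> are independent. Outside \<open>I\<close>
  both samples take the default \<open>d\<close>, so \<open>J\<close> can be any set.\<close>

lemma Pi_pmf_resample:
  assumes "finite I"
  shows "Pi_pmf I d q = map_pmf (\<lambda>(g, h). mix J g h) (pair_pmf (Pi_pmf I d q) (Pi_pmf I d q))"
proof -
  let ?P = "Pi_pmf I d q"
  have out: "f i = d" if "f \<in> set_pmf ?P" "i \<notin> I" for f i
    using set_Pi_pmf_subset[OF assms, of d q] that by auto
  have "Pi_pmf I d q = Pi_pmf ((I \<inter> J) \<union> (I - J)) d q" by (simp add: Int_Diff_Un)
  also have "\<dots> = map_pmf (\<lambda>(f, g) x. if x \<in> I \<inter> J then f x else g x)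
      (pair_pmf (Pi_pmf (I \<inter> J) d q) (Pi_pmf (I - J) d q))"
    using assms by (intro Pi_pmf_union) auto
  also have "Pi_pmf (I \<inter> J) d q = map_pmf (\<lambda>f x. if x \<in> I \<inter> J then f x else d) ?P"
    using assms by (intro Pi_pmf_subset) auto
  also have "Pi_pmf (I - J) d q = map_pmf (\<lambda>f x. if x \<in> I - J then f x else d) ?P"
    using assms by (intro Pi_pmf_subset) auto
  also have "map_pmf (\<lambda>(f, g) x. if x \<in> I \<inter> J then f x else g x)
      (pair_pmf (map_pmf (\<lambda>f x. if x \<in> I \<inter> J then f x else d) ?P)
         (map_pmf (\<lambda>f x. if x \<in> I - J then f x else d) ?P)) =
      map_pmf (\<lambda>(g, h). mix J g h) (pair_pmf ?P ?P)"
    unfolding map_pair[symmetric] map_pmf_comp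
    by (intro map_pmf_cong refl) (auto simp: fun_eq_iff dest: out)
  finally show ?thesis .
qed

text \<open>Fubini: the section of \<open>A\<close> at \<open>x\<close> has probability at most 1 if
  \<open>x\<close> is in \<open>B\<close> and at most \<delta> otherwise.\<close>

lemma prob_pair_pmf_le:
  assumes "\<And>x. x \<notin> B \<Longrightarrow> measure_pmf.prob Q {y. (x, y) \<in> A} \<le> \<delta>" "\<delta> \<ge> 0"
  shows "measure_pmf.prob (pair_pmf M Q) A \<le> measure_pmf.prob M B + \<delta>"
proof -
  have "emeasure (pair_pmf M Q) A = (\<integral>\<^sup>+x. \<integral>\<^sup>+y. indicator A (x, y) \<partial>Q \<partial>M)"
    by (simp add: nn_integral_pair_pmf'[symmetric])
  also have "\<dots> = (\<integral>\<^sup>+x. emeasure Q {y. (x, y) \<in> A} \<partial>M)"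
  proof (rule nn_integral_cong)
    fix x
    have "(\<integral>\<^sup>+y. indicator A (x, y) \<partial>Q) = (\<integral>\<^sup>+y. indicator {y. (x, y) \<in> A} y \<partial>Q)"
      by (intro nn_integral_cong) (auto simp: indicator_def)
    then show "(\<integral>\<^sup>+y. indicator A (x, y) \<partial>Q) = emeasure Q {y. (x, y) \<in> A}" by simp
  qed
  also have "\<dots> \<le> (\<integral>\<^sup>+x. indicator B x + ennreal \<delta> \<partial>M)"
  proof (rule nn_integral_mono)
    fix x
    show "emeasure Q {y. (x, y) \<in> A} \<le> indicator B x + ennreal \<delta>"
    proof (cases "x \<in> B")
      case True
      have "emeasure Q {y. (x, y) \<in> A} \<le> 1" by (rule measure_pmf.emeasure_le_1)
      then show ?thesis using True by (simp add: add_increasing2)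
    next
      case False
      then show ?thesis using assms(1)[OF False] assms(2)
        by (simp add: measure_pmf.emeasure_eq_measure ennreal_leI)
    qed
  qed
  also have "\<dots> = emeasure M B + ennreal \<delta>"
    by (subst nn_integral_add) auto
  finally show ?thesis
    using assms(2) by (simp add: measure_pmf.emeasure_eq_measure ennreal_plus[symmetric] del: ennreal_plus)
qed

lemma prob_pair_pmf_Times:
  "measure_pmf.prob (pair_pmf M Q) (A \<times> B) = measure_pmf.prob M A * measure_pmf.prob Q B"
proof -
  have "emeasure (pair_pmf M Q) (A \<times> B) = (\<integral>\<^sup>+x. \<integral>\<^sup>+y. indicator A x * indicator B y \<partial>Q \<partial>M)"
    by (subst nn_integral_indicator[symmetric], simp, subst nn_integral_pair_pmf')
       (simp add: indicator_times)
  also have "\<dots> = emeasure M A * emeasure Q B"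
    by (simp add: nn_integral_cmult nn_integral_multc)
  finally show ?thesis
    by (simp add: measure_pmf.emeasure_eq_measure ennreal_mult''[symmetric] ennreal_mult[symmetric])
qed

text \<open>Exposing the coordinates in \<open>J\<close> first: it suffices to bound the conditional probability of
  the event for the exposures that satisfy \<open>G\<close>.\<close>

lemma prob_Pi_pmf_expose:
  assumes "finite I" "\<delta> \<ge> 0"
    and "\<And>g. G g \<Longrightarrow> measure_pmf.prob (Pi_pmf I d q) {h. F (mix J g h)} \<le> \<delta>"
  shows "measure_pmf.prob (Pi_pmf I d q) {f. F f} \<le> measure_pmf.prob (Pi_pmf I d q) {f. \<not> G f} + \<delta>"
proof -
  let ?P = "Pi_pmf I d q"
  have "measure_pmf.prob ?P {f. F f} =
      measure_pmf.prob (pair_pmf ?P ?P) {(g, h). F (mix J g h)}"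
    by (subst Pi_pmf_resample[OF assms(1), of d q J]) (simp add: vimage_def case_prod_unfold)
  also have "\<dots> \<le> measure_pmf.prob ?P {f. \<not> G f} + \<delta>"
    by (rule prob_pair_pmf_le) (use assms in auto)
  finally show ?thesis .
qed

text \<open>After resampling along \<open>J\<close>, \<open>F\<close> sees only the first sample and
  \<open>G\<close> only the second, so the joint event is a rectangle.\<close>

lemma prob_Pi_pmf_indep2:
  assumes "finite I" and F: "depends_on F J" and G: "depends_on G K" and JK: "J \<inter> K = {}"
  shows "measure_pmf.prob (Pi_pmf I d q) {f. F f \<and> G f} =
    measure_pmf.prob (Pi_pmf I d q) {f. F f} * measure_pmf.prob (Pi_pmf I d q) {f. G f}"
proof -
  let ?P = "Pi_pmf I d q"
  have 1: "F (mix J g h) = F g" for g h by (rule depends_onD[OF F]) auto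
  have 2: "G (mix J g h) = G h" for g h by (rule depends_onD[OF G]) (use JK in auto)
  have "measure_pmf.prob ?P {f. F f \<and> G f} =
      measure_pmf.prob (pair_pmf ?P ?P) ((\<lambda>(g, h). mix J g h) -` {f. F f \<and> G f})"
    by (subst Pi_pmf_resample[OF assms(1), of d q J]) (rule measure_map_pmf)
  also have "(\<lambda>(g, h). mix J g h) -` {f. F f \<and> G f} = {g. F g} \<times> {h. G h}"
    using 1 2 by auto
  finally show ?thesis by (simp only: prob_pair_pmf_Times)
qed

lemma prob_Pi_pmf_indep:
  fixes F :: "'t \<Rightarrow> ('i \<Rightarrow> 'a) \<Rightarrow> bool"
  assumes "finite I" "finite T" "\<And>t. t \<in> T \<Longrightarrow> depends_on (F t) (J t)" "disjoint_family_on J T"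
  shows "measure_pmf.prob (Pi_pmf I d q) {f. \<forall>t\<in>T. F t f} =
    (\<Prod>t\<in>T. measure_pmf.prob (Pi_pmf I d q) {f. F t f})"
  using assms(2,3,4)
proof (induction T)
  case empty
  then show ?case by (simp add: measure_pmf.prob_space[simplified])
next
  case (insert t T)
  have "measure_pmf.prob (Pi_pmf I d q) {f. \<forall>t\<in>insert t T. F t f} =
      measure_pmf.prob (Pi_pmf I d q) {f. F t f \<and> (\<forall>t\<in>T. F t f)}"
    by simp
  also have "\<dots> = measure_pmf.prob (Pi_pmf I d q) {f. F t f} *
      measure_pmf.prob (Pi_pmf I d q) {f. \<forall>t\<in>T. F t f}"
  proof (rule prob_Pi_pmf_indep2[OF assms(1)])
    show "depends_on (F t) (J t)" using insert by simp
    show "depends_on (\<lambda>f. \<forall>t\<in>T. F t f) (\<Union>t\<in>T. J t)"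
    proof (rule depends_onI)
      fix f g :: "'i \<Rightarrow> 'a" assume "\<And>i. i \<in> (\<Union>t\<in>T. J t) \<Longrightarrow> f i = g i"
      then have "F t f = F t g" if "t \<in> T" for t
        using that insert.prems(1)[of t] by (intro depends_onD[of "F t" "J t"]) auto
      then show "(\<forall>t\<in>T. F t f) = (\<forall>t\<in>T. F t g)" by simp
    qed
    show "J t \<inter> (\<Union>t\<in>T. J t) = {}"
      using insert.hyps insert.prems(2) by (auto simp: disjoint_family_on_def)
  qed
  also have "measure_pmf.prob (Pi_pmf I d q) {f. \<forall>t\<in>T. F t f} =
      (\<Prod>t\<in>T. measure_pmf.prob (Pi_pmf I d q) {f. F t f})"
    using insert by (simp add: disjoint_family_on_def)
  finally show ?case using insert.hyps by simp
qed

text \<open>Union bound over the sets of \<open>m\<close> indices all of whose events occur; by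
  independence each such set contributes at most \<open>r ^ m\<close>.\<close>

lemma prob_Pi_pmf_count_ge:
  assumes "finite I" "finite T" "\<And>t. t \<in> T \<Longrightarrow> depends_on (F t) (J t)" "disjoint_family_on J T"
    and prob: "\<And>t. t \<in> T \<Longrightarrow> measure_pmf.prob (Pi_pmf I d q) {f. F t f} \<le> r"
  shows "measure_pmf.prob (Pi_pmf I d q) {f. m \<le> card {t\<in>T. F t f}} \<le> real (card T choose m) * r ^ m"
proof -
  let ?P = "Pi_pmf I d q"
  have "{f. m \<le> card {t\<in>T. F t f}} \<subseteq> (\<Union>U\<in>{U. U \<subseteq> T \<and> card U = m}. {f. \<forall>t\<in>U. F t f})"
  proof
    fix f assume "f \<in> {f. m \<le> card {t\<in>T. F t f}}"
    then obtain U where "U \<subseteq> {t\<in>T. F t f}" "card U = m"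
      by (metis mem_Collect_eq obtain_subset_with_card_n)
    then show "f \<in> (\<Union>U\<in>{U. U \<subseteq> T \<and> card U = m}. {f. \<forall>t\<in>U. F t f})" by blast
  qed
  then have "measure_pmf.prob ?P {f. m \<le> card {t\<in>T. F t f}} \<le>
      measure_pmf.prob ?P (\<Union>U\<in>{U. U \<subseteq> T \<and> card U = m}. {f. \<forall>t\<in>U. F t f})"
    by (intro measure_pmf.finite_measure_mono) auto
  also have "\<dots> \<le> (\<Sum>U\<in>{U. U \<subseteq> T \<and> card U = m}. measure_pmf.prob ?P {f. \<forall>t\<in>U. F t f})"
    using assms(2) by (intro measure_pmf.finite_measure_subadditive_finite) auto
  also have "\<dots> \<le> (\<Sum>U\<in>{U. U \<subseteq> T \<and> card U = m}. r ^ m)"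
  proof (rule sum_mono)
    fix U assume U: "U \<in> {U. U \<subseteq> T \<and> card U = m}"
    then have fU: "finite U" using assms(2) finite_subset by auto
    have "measure_pmf.prob ?P {f. \<forall>t\<in>U. F t f} = (\<Prod>t\<in>U. measure_pmf.prob ?P {f. F t f})"
      using U assms(3,4) by (intro prob_Pi_pmf_indep[OF assms(1) fU, of F J]) (auto simp: disjoint_family_on_def)
    also have "\<dots> \<le> (\<Prod>t\<in>U. r)"
      using U prob by (intro prod_mono) auto
    finally show "measure_pmf.prob ?P {f. \<forall>t\<in>U. F t f} \<le> r ^ m" using U by simp
  qed
  also have "\<dots> = real (card T choose m) * r ^ m"
    using assms(2) by (simp add: n_subsets)
  finally show ?thesis .
qed

lemma prob_Pi_pmf_bernoulli_pattern:
  fixes I :: "'i set"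
  assumes "finite I" "J \<subseteq> I" "B \<subseteq> J" "0 \<le> p" "p \<le> 1"
  shows "measure_pmf.prob (Pi_pmf I False (\<lambda>_. bernoulli_pmf p)) {f. \<forall>j\<in>J. f j \<longleftrightarrow> j \<in> B} =
    p ^ card B * (1 - p) ^ (card J - card B)"
proof -
  let ?P = "Pi_pmf I False (\<lambda>_. bernoulli_pmf p)"
  have fJ: "finite J" using assms finite_subset by auto
  have comp: "measure_pmf.prob ?P {f. f j \<longleftrightarrow> j \<in> B} = (if j \<in> B then p else 1 - p)" if "j \<in> J" for j
  proof -
    have "bernoulli_pmf p = map_pmf (\<lambda>f. f j) ?P"
      using Pi_pmf_component[OF assms(1), of j False "\<lambda>_. bernoulli_pmf p"] that assms(2) by auto
    then have "measure_pmf.prob (bernoulli_pmf p) {b. b \<longleftrightarrow> j \<in> B} =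
        measure_pmf.prob ?P ((\<lambda>f. f j) -` {b. b \<longleftrightarrow> j \<in> B})"
      by (metis measure_map_pmf)
    moreover have "{b. b \<longleftrightarrow> j \<in> B} = {j \<in> B}" by auto
    ultimately show ?thesis using assms(4,5)
      by (cases "j \<in> B") (simp_all add: vimage_def measure_pmf_single)
  qed
  have "measure_pmf.prob ?P {f. \<forall>j\<in>J. f j \<longleftrightarrow> j \<in> B} = (\<Prod>j\<in>J. measure_pmf.prob ?P {f. f j \<longleftrightarrow> j \<in> B})"
    by (rule prob_Pi_pmf_indep[OF assms(1) fJ, where J = "\<lambda>j. {j}"])
       (auto simp: depends_on_def disjoint_family_on_def)
  also have "\<dots> = (\<Prod>j\<in>J. if j \<in> B then p else 1 - p)" using comp by simp
  also have "\<dots> = (\<Prod>j\<in>J \<inter> B. p) * (\<Prod>j\<in>J - B. 1 - p)"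
    using fJ by (simp add: prod.If_cases Int_def Diff_eq Compl_eq)
  also have "\<dots> = p ^ card B * (1 - p) ^ (card J - card B)"
  proof -
    have "J \<inter> B = B" "finite B" using assms(3) fJ finite_subset by auto
    then show ?thesis using card_Diff_subset[of B J] assms(3) by simp
  qed
  finally show ?thesis .
qed

text \<open>The lower bound is the probability that, for some choice of one index \<open>\<zeta> \<tau> \<in> Z \<tau>\<close> for each
  \<open>\<tau> \<in> S\<close>, the index \<open>\<zeta> \<tau>\<close> takes the value \<open>\<tau>\<close> and no other index takes a value in \<open>R\<close>. These events
  are disjoint for distinct \<open>\<zeta>\<close>.\<close>

lemma prob_Pi_pmf_values_exactly:
  assumes "finite I" "finite T" "\<And>z. z \<in> T \<Longrightarrow> depends_on (X z) (J z)" "disjoint_family_on J T"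
    and S: "finite S" "S \<subseteq> R" and Z: "\<And>\<tau>. \<tau> \<in> S \<Longrightarrow> Z \<tau> \<subseteq> T" "disjoint_family_on Z S"
    and a: "\<And>\<tau>. \<tau> \<in> S \<Longrightarrow> 0 \<le> a \<tau>"
       "\<And>\<tau> z. \<tau> \<in> S \<Longrightarrow> z \<in> Z \<tau> \<Longrightarrow> a \<tau> \<le> measure_pmf.prob (Pi_pmf I d q) {f. X z f = \<tau>}"
    and r: "\<And>z. z \<in> T \<Longrightarrow> measure_pmf.prob (Pi_pmf I d q) {f. X z f \<in> R} \<le> r z"
       "\<And>z. z \<in> T \<Longrightarrow> r z \<le> 1"
  shows "(\<Prod>\<tau>\<in>S. real (card (Z \<tau>)) * a \<tau>) * (\<Prod>z\<in>T. 1 - r z) \<le>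
    measure_pmf.prob (Pi_pmf I d q) {f. (\<lambda>z. X z f) ` T \<inter> R = S}"
proof -
  let ?P = "Pi_pmf I d q"
  define Ev where "Ev \<zeta> = {f. (\<forall>z\<in>T. (\<forall>\<tau>\<in>S. z = \<zeta> \<tau> \<longrightarrow> X z f = \<tau>) \<and> (z \<notin> \<zeta> ` S \<longrightarrow> X z f \<notin> R))}" for \<zeta>
  have fZ: "finite (Z \<tau>)" if "\<tau> \<in> S" for \<tau> using Z(1)[OF that] assms(2) finite_subset by blast
  have fPiE: "finite (PiE S Z)" using S fZ by (intro finite_PiE) auto
  have r0: "0 \<le> r z" if "z \<in> T" for z
    using order_trans[OF measure_nonneg r(1)[OF that]] .
  have bound: "(\<Prod>\<tau>\<in>S. a \<tau>) * (\<Prod>z\<in>T. 1 - r z) \<le> measure_pmf.prob ?P (Ev \<zeta>)" if \<zeta>: "\<zeta> \<in> PiE S Z" for \<zeta>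
  proof -
    have inj: "inj_on \<zeta> S"
      using \<zeta> Z(2) unfolding inj_on_def disjoint_family_on_def by (metis PiE_mem disjoint_iff)
    have sub: "\<zeta> ` S \<subseteq> T" using \<zeta> Z(1) by (auto dest: PiE_mem)
    let ?b = "\<lambda>z. if z \<in> \<zeta> ` S then a (the_inv_into S \<zeta> z) else 1 - r z"
    \<comment> \<open>Extending the product to all of \<open>T\<close> only lowers it, as each
      factor \<open>1 - r z\<close> lies between 0 and 1. The resulting bound is the same for all
      \<zeta>.\<close>
    have "(\<Prod>\<tau>\<in>S. a \<tau>) * (\<Prod>z\<in>T. 1 - r z) \<le> (\<Prod>\<tau>\<in>S. a \<tau>) * (\<Prod>z\<in>T - \<zeta> ` S. 1 - r z)"
    proof (rule mult_left_mono)
      have "(\<Prod>z\<in>T. 1 - r z) = (\<Prod>z\<in>T - \<zeta> ` S. 1 - r z) * (\<Prod>z\<in>\<zeta> ` S. 1 - r z)"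
        using prod.subset_diff[OF sub assms(2)] .
      also have "\<dots> \<le> (\<Prod>z\<in>T - \<zeta> ` S. 1 - r z) * 1"
        using r0 r(2) sub by (intro mult_left_mono prod_le_1 prod_nonneg) (auto simp: subset_iff)
      finally show "(\<Prod>z\<in>T. 1 - r z) \<le> (\<Prod>z\<in>T - \<zeta> ` S. 1 - r z)" by simp
    qed (use a in \<open>auto intro: prod_nonneg\<close>)
    also have "(\<Prod>\<tau>\<in>S. a \<tau>) * (\<Prod>z\<in>T - \<zeta> ` S. 1 - r z) = (\<Prod>z\<in>T. ?b z)"
    proof -
      have "(\<Prod>z\<in>T. ?b z) = (\<Prod>z\<in>T - \<zeta> ` S. ?b z) * (\<Prod>z\<in>\<zeta> ` S. ?b z)"
        using prod.subset_diff[OF sub assms(2)] .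
      also have "(\<Prod>z\<in>T - \<zeta> ` S. ?b z) = (\<Prod>z\<in>T - \<zeta> ` S. 1 - r z)" by (rule prod.cong) auto
      also have "(\<Prod>z\<in>\<zeta> ` S. ?b z) = (\<Prod>z\<in>\<zeta> ` S. a (the_inv_into S \<zeta> z))" by (rule prod.cong) auto
      also have "\<dots> = (\<Prod>\<tau>\<in>S. a \<tau>)"
        by (subst prod.reindex[OF inj]) (simp add: the_inv_into_f_f[OF inj])
      finally show ?thesis by (simp add: mult.commute)
    qed
    also have "\<dots> \<le> (\<Prod>z\<in>T. measure_pmf.prob ?P
        {f. (\<forall>\<tau>\<in>S. z = \<zeta> \<tau> \<longrightarrow> X z f = \<tau>) \<and> (z \<notin> \<zeta> ` S \<longrightarrow> X z f \<notin> R)})"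
    proof (rule prod_mono, intro conjI)
      fix z assume z: "z \<in> T"
      show "0 \<le> ?b z" using r(2)[OF z] a(1) inj by (auto simp: the_inv_into_f_f)
      show "?b z \<le> measure_pmf.prob ?P
        {f. (\<forall>\<tau>\<in>S. z = \<zeta> \<tau> \<longrightarrow> X z f = \<tau>) \<and> (z \<notin> \<zeta> ` S \<longrightarrow> X z f \<notin> R)}"
      proof (cases "z \<in> \<zeta> ` S")
        case True
        then obtain \<tau> where \<tau>: "\<tau> \<in> S" "z = \<zeta> \<tau>" by auto
        then have "{f. (\<forall>\<tau>\<in>S. z = \<zeta> \<tau> \<longrightarrow> X z f = \<tau>) \<and> (z \<notin> \<zeta> ` S \<longrightarrow> X z f \<notin> R)} = {f. X z f = \<tau>}"
          using inj True by (auto simp: inj_on_def)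
        moreover have "the_inv_into S \<zeta> z = \<tau>" using \<tau> inj by (simp add: the_inv_into_f_f)
        moreover have "z \<in> Z \<tau>" using \<tau> \<zeta> by (auto dest: PiE_mem)
        ultimately show ?thesis using True a(2)[OF \<tau>(1)] by simp
      next
        case False
        then have "{f. (\<forall>\<tau>\<in>S. z = \<zeta> \<tau> \<longrightarrow> X z f = \<tau>) \<and> (z \<notin> \<zeta> ` S \<longrightarrow> X z f \<notin> R)} = - {f. X z f \<in> R}"
          by auto
        moreover have "measure_pmf.prob ?P (- {f. X z f \<in> R}) = 1 - measure_pmf.prob ?P {f. X z f \<in> R}"
          using measure_pmf.prob_compl[of "{f. X z f \<in> R}" ?P] by (simp add: Compl_eq_Diff_UNIV)
        ultimately show ?thesis using False r(1)[OF z] by simp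
      qed
    qed
    also have "\<dots> = measure_pmf.prob ?P (Ev \<zeta>)"
      unfolding Ev_def
      by (rule prob_Pi_pmf_indep[OF assms(1,2) _ assms(4), symmetric])
         (rule depends_on_comp[OF assms(3)])
    finally show ?thesis .
  qed
  have disj: "disjoint_family_on Ev (PiE S Z)"
    unfolding disjoint_family_on_def
  proof (intro ballI impI)
    fix \<zeta> \<xi> assume *: "\<zeta> \<in> PiE S Z" "\<xi> \<in> PiE S Z" "\<zeta> \<noteq> \<xi>"
    show "Ev \<zeta> \<inter> Ev \<xi> = {}"
    proof (rule ccontr)
      assume "Ev \<zeta> \<inter> Ev \<xi> \<noteq> {}"
      then obtain f where f: "f \<in> Ev \<zeta>" "f \<in> Ev \<xi>" by auto
      have "\<zeta> \<tau> = \<xi> \<tau>" if \<tau>: "\<tau> \<in> S" for \<tau>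
      proof -
        have zT: "\<zeta> \<tau> \<in> T" using * \<tau> Z(1)[OF \<tau>] by (auto dest: PiE_mem)
        have X: "X (\<zeta> \<tau>) f = \<tau>" using f(1) zT \<tau> by (auto simp: Ev_def)
        \<comment> \<open>The value \<tau> at the index \<open>\<zeta> \<tau>\<close> lies in
          \<open>R\<close>, so \<xi> must have chosen this index too, and the value tells for which
          member of \<open>S\<close>. Thus \<open>f\<close> determines the choice function.\<close>
        have "\<tau> \<in> R" using S \<tau> by blast
        then have "\<zeta> \<tau> \<in> \<xi> ` S" using f(2) zT X unfolding Ev_def by force
        then obtain \<tau>' where \<tau>': "\<tau>' \<in> S" "\<zeta> \<tau> = \<xi> \<tau>'" by auto
        then have "X (\<zeta> \<tau>) f = \<tau>'" using f(2) zT by (auto simp: Ev_def)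
        then show ?thesis using X \<tau>' by simp
      qed
      then show False using *(3) PiE_ext[OF *(1,2)] by blast
    qed
  qed
  have "(\<Prod>\<tau>\<in>S. real (card (Z \<tau>)) * a \<tau>) * (\<Prod>z\<in>T. 1 - r z) =
      real (card (PiE S Z)) * ((\<Prod>\<tau>\<in>S. a \<tau>) * (\<Prod>z\<in>T. 1 - r z))"
    using S(1) by (simp add: card_PiE prod.distrib)
  also have "\<dots> = (\<Sum>\<zeta>\<in>PiE S Z. (\<Prod>\<tau>\<in>S. a \<tau>) * (\<Prod>z\<in>T. 1 - r z))" by simp
  also have "\<dots> \<le> (\<Sum>\<zeta>\<in>PiE S Z. measure_pmf.prob ?P (Ev \<zeta>))"
    using bound by (rule sum_mono)
  also have "\<dots> = measure_pmf.prob ?P (\<Union>\<zeta>\<in>PiE S Z. Ev \<zeta>)"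
    using fPiE disj by (intro measure_pmf.finite_measure_finite_Union[symmetric]) auto
  also have "\<dots> \<le> measure_pmf.prob ?P {f. (\<lambda>z. X z f) ` T \<inter> R = S}"
  proof (rule measure_pmf.finite_measure_mono)
    show "(\<Union>\<zeta>\<in>PiE S Z. Ev \<zeta>) \<subseteq> {f. (\<lambda>z. X z f) ` T \<inter> R = S}"
    proof
      fix f assume "f \<in> (\<Union>\<zeta>\<in>PiE S Z. Ev \<zeta>)"
      then obtain \<zeta> where \<zeta>: "\<zeta> \<in> PiE S Z" "f \<in> Ev \<zeta>" by auto
      have "\<tau> \<in> (\<lambda>z. X z f) ` T" if "\<tau> \<in> S" for \<tau>
      proof -
        have "\<zeta> \<tau> \<in> T" using \<zeta> that Z(1)[OF that] by (auto dest: PiE_mem)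
        moreover have "X (\<zeta> \<tau>) f = \<tau>" using \<zeta>(2) calculation that by (auto simp: Ev_def)
        ultimately show ?thesis by force
      qed
      moreover have "X z f \<in> S" if "z \<in> T" "X z f \<in> R" for z
      proof -
        have "z \<in> \<zeta> ` S" using \<zeta>(2) that by (auto simp: Ev_def)
        then show ?thesis using \<zeta>(2) that by (auto simp: Ev_def)
      qed
      ultimately show "f \<in> {f. (\<lambda>z. X z f) ` T \<inter> R = S}" using S(2) by auto
    qed
  qed auto
  finally show ?thesis .
qed

section \<open>Exposing the edges that meet the complement of a fixed vertex set\<close>

lemma exists_disjoint_subsets:
  assumes "finite I" "finite C" "card I * m \<le> card C"
  shows "\<exists>Z. (\<forall>i\<in>I. Z i \<subseteq> C \<and> card (Z i) = m) \<and> disjoint_family_on Z I"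
  using assms
proof (induction I arbitrary: C)
  case empty
  then show ?case by (auto simp: disjoint_family_on_def)
next
  case (insert i I)
  have "m \<le> card C" using insert.prems insert.hyps by simp
  then obtain D where D: "D \<subseteq> C" "card D = m" using obtain_subset_with_card_n by metis
  have "card I * m \<le> card (C - D)"
    using insert.prems insert.hyps D by (simp add: card_Diff_subset finite_subset)
  then obtain Z where Z: "\<forall>i\<in>I. Z i \<subseteq> C - D \<and> card (Z i) = m" "disjoint_family_on Z I"
    using insert.IH[of "C - D"] insert.prems by auto
  have "disjoint_family_on (Z(i := D)) (insert i I)"
    unfolding disjoint_family_on_def
  proof (intro ballI impI)
    fix a b assume ab: "a \<in> insert i I" "b \<in> insert i I" "a \<noteq> b"
    have "Z j \<inter> D = {}" if "j \<in> I" for j using Z(1) that by blast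
    moreover have "Z a \<inter> Z b = {}" if "a \<in> I" "b \<in> I"
      using Z(2) that ab(3) by (simp add: disjoint_family_on_def)
    ultimately show "(Z(i := D)) a \<inter> (Z(i := D)) b = {}" using ab by auto
  qed
  moreover have "\<forall>j\<in>insert i I. (Z(i := D)) j \<subseteq> C \<and> card ((Z(i := D)) j) = m"
    using Z D by auto
  ultimately show ?case by blast
qed

text \<open>A converse of \<open>1 - r \<le> exp (- r)\<close> at the price of a factor 2. It bounds
  the probability that no further rare pattern appears by an exponential of their expected
  number.\<close>

lemma one_minus_ge_exp:
  fixes r :: real
  assumes "0 \<le> r" "r \<le> 1 / 2"
  shows "exp (- 2 * r) \<le> 1 - r"
proof -
  have "1 \<le> (1 - r) * (1 + 2 * r)"
    using assms mult_nonneg_nonneg[of r "1 - 2 * r"] by (simp add: algebra_simps)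
  also have "\<dots> \<le> (1 - r) * exp (2 * r)"
    using assms exp_ge_add_one_self[of "2 * r"] by (intro mult_left_mono) auto
  finally show ?thesis by (simp add: exp_minus field_simps)
qed

lemma image_Int_shrink:
  assumes "B \<subseteq> A" "\<And>z. z \<in> A \<Longrightarrow> z \<notin> B \<Longrightarrow> g z \<notin> R"
  shows "g ` A \<inter> R = g ` B \<inter> R"
  using assms by blast

text \<open>The set \<open>W\<close> is fixed throughout. The relevant edges have one or two
  vertices outside \<open>W\<close>, and form the coordinate blocks \<open>E1 x\<close> and
  \<open>E2 x z\<close> accordingly.\<close>

locale exposure =
  fixes s n :: nat and W :: "nat set" and p :: real
  assumes s: "s \<ge> 3" and W: "W \<subseteq> {1..n}" and p: "0 \<le> p" "p \<le> 1"
begin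

definition "U = {1..n} - W"
definition "K1 = subs (s - 1) W"
definition "K2 = subs (s - 2) W"
definition "\<P> = Pi_pmf (possible_edges s n) False (\<lambda>_. bernoulli_pmf p)"
definition "lab f x = label {e. f e} s W x"
definition "plab f x z = pair_label {e. f e} s W x z"

lemma lab_eq: "lab f x = {Y \<in> K1. f (insert x Y)}"
  by (auto simp: lab_def label_def K1_def subs_def)

lemma plab_eq: "plab f x z = {Y \<in> K2. f (insert x (insert z Y))}"
  by (auto simp: plab_def pair_label_def K2_def subs_def)

lemma finite_W: "finite W" using W finite_subset by blast

lemma finite_K: "finite K1" "finite K2"
  using finite_W by (auto simp: K1_def K2_def finite_subs)

lemma finite_U: "finite U" by (simp add: U_def)

lemma finite_edges: "finite (possible_edges s n)"
  by (rule finite_subset[of _ "Pow {1..n}"]) (auto simp: possible_edges_def)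

lemma K1_K2_disjoint: "K1 \<inter> K2 = {}"
  using s by (auto simp: K1_def K2_def subs_def)

lemma lab_subset: "lab f x \<subseteq> K1" by (auto simp: lab_eq)

lemma plab_subset: "plab f x z \<subseteq> K2" by (auto simp: plab_eq)

text \<open>The part outside \<open>W\<close> and the trace on \<open>W\<close> recover
  \<open>x\<close> and \<open>Y\<close> from an edge. So distinct labels use distinct coordinates,
  and the exposures below can be described in terms of \<open>e - W\<close>.\<close>

lemma K1_edge:
  assumes "x \<in> U" "Y \<in> K1"
  shows "insert x Y - W = {x}" "insert x Y \<inter> W = Y" "insert x Y \<in> possible_edges s n"
proof -
  have Y: "Y \<subseteq> W" "card Y = s - 1" using assms by (auto simp: K1_def subs_def)
  then have "finite Y" "x \<notin> Y" using finite_W finite_subset assms by (auto simp: U_def)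
  then show "insert x Y - W = {x}" "insert x Y \<inter> W = Y" "insert x Y \<in> possible_edges s n"
    using assms Y W s by (auto simp: U_def possible_edges_def)
qed

lemma K2_edge:
  assumes "x \<in> U" "z \<in> U" "x \<noteq> z" "Y \<in> K2"
  shows "insert x (insert z Y) - W = {x, z}" "insert x (insert z Y) \<inter> W = Y"
    "insert x (insert z Y) \<in> possible_edges s n"
proof -
  have Y: "Y \<subseteq> W" "card Y = s - 2" using assms by (auto simp: K2_def subs_def)
  then have "finite Y" "x \<notin> Y" "z \<notin> Y" using finite_W finite_subset assms by (auto simp: U_def)
  then show "insert x (insert z Y) - W = {x, z}" "insert x (insert z Y) \<inter> W = Y"
    "insert x (insert z Y) \<in> possible_edges s n"
    using assms Y W s by (auto simp: U_def possible_edges_def)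
qed

definition "E1 x = insert x ` K1"
definition "E2 x z = (\<lambda>Y. insert x (insert z Y)) ` K2"

lemma lab_depends: "depends_on (\<lambda>f. lab f x) (E1 x)"
  by (rule depends_onI) (auto simp: lab_eq E1_def)

lemma plab_depends: "depends_on (\<lambda>f. plab f x z) (E2 x z)"
  by (rule depends_onI) (auto simp: plab_eq E2_def)

lemma E1_disjoint: "disjoint_family_on E1 U"
  unfolding disjoint_family_on_def
proof (intro ballI impI)
  fix x y assume xy: "x \<in> U" "y \<in> U" "x \<noteq> y"
  have "insert x Y \<noteq> insert y Y'" if "Y \<in> K1" "Y' \<in> K1" for Y Y'
    using K1_edge(1)[OF xy(1) that(1)] K1_edge(1)[OF xy(2) that(2)] xy(3) by auto
  then show "E1 x \<inter> E1 y = {}" by (auto simp: E1_def)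
qed

lemma E2_disjoint:
  assumes "x \<in> U" "z \<in> U" "x \<noteq> z" "x' \<in> U" "z' \<in> U" "x' \<noteq> z'" "{x, z} \<noteq> {x', z'}"
  shows "E2 x z \<inter> E2 x' z' = {}"
proof (rule ccontr)
  assume "E2 x z \<inter> E2 x' z' \<noteq> {}"
  then obtain Y Y' where Y: "Y \<in> K2" "Y' \<in> K2" "insert x (insert z Y) = insert x' (insert z' Y')"
    by (auto simp: E2_def)
  then have "{x, z} = {x', z'}" using K2_edge(1)[OF assms(1-3)] K2_edge(1)[OF assms(4-6)] by metis
  then show False using assms by simp
qed

section \<open>Probabilities of labels and pair labels, and sizes of label classes\<close>

lemma prob_lab:
  assumes "x \<in> U" "A \<subseteq> K1"
  shows "measure_pmf.prob \<P> {f. lab f x = A} = p ^ card A * (1 - p) ^ (card K1 - card A)"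
proof -
  have inj: "inj_on (insert x) K1" using K1_edge(2)[OF assms(1)] by (metis inj_onI)
  have "{f. lab f x = A} = {f. \<forall>j\<in>E1 x. f j \<longleftrightarrow> j \<in> insert x ` A}"
  proof -
    have "insert x Y \<in> insert x ` A \<longleftrightarrow> Y \<in> A" if "Y \<in> K1" for Y
      using inj that assms(2) by (simp add: inj_on_image_mem_iff)
    then show ?thesis using assms(2) by (auto simp: lab_eq E1_def)
  qed
  also have "measure_pmf.prob \<P> \<dots> = p ^ card (insert x ` A) * (1 - p) ^ (card (E1 x) - card (insert x ` A))"
    unfolding \<P>_def using finite_edges K1_edge(3)[OF assms(1)] assms p
    by (intro prob_Pi_pmf_bernoulli_pattern) (auto simp: E1_def)
  also have "card (insert x ` A) = card A" using inj assms by (simp add: card_image inj_on_subset)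
  also have "card (E1 x) = card K1" using inj by (simp add: card_image E1_def)
  finally show ?thesis .
qed

lemma prob_plab:
  assumes "x \<in> U" "z \<in> U" "x \<noteq> z" "L \<subseteq> K2"
  shows "measure_pmf.prob \<P> {f. plab f x z = L} = p ^ card L * (1 - p) ^ (card K2 - card L)"
proof -
  let ?i = "\<lambda>Y. insert x (insert z Y)"
  have inj: "inj_on ?i K2"
  proof (rule inj_onI)
    fix Y Y' assume Y: "Y \<in> K2" "Y' \<in> K2" "?i Y = ?i Y'"
    show "Y = Y'" using K2_edge(2)[OF assms(1-3) Y(1)] K2_edge(2)[OF assms(1-3) Y(2)] Y(3) by metis
  qed
  have "{f. plab f x z = L} = {f. \<forall>j\<in>E2 x z. f j \<longleftrightarrow> j \<in> ?i ` L}"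
  proof -
    have "?i Y \<in> ?i ` L \<longleftrightarrow> Y \<in> L" if "Y \<in> K2" for Y
      using inj_on_image_mem_iff[OF inj that assms(4)] .
    then have "(\<forall>j\<in>E2 x z. f j \<longleftrightarrow> j \<in> ?i ` L) \<longleftrightarrow> (\<forall>Y\<in>K2. f (?i Y) \<longleftrightarrow> Y \<in> L)" for f :: "nat set \<Rightarrow> bool"
      unfolding E2_def Set.ball_simps(9) by (intro ball_cong) (simp_all only:)
    then show ?thesis using assms(4) by (auto simp: plab_eq)
  qed
  also have "measure_pmf.prob \<P> \<dots> = p ^ card (?i ` L) * (1 - p) ^ (card (E2 x z) - card (?i ` L))"
    unfolding \<P>_def using finite_edges K2_edge(3)[OF assms(1-3)] assms p
    by (intro prob_Pi_pmf_bernoulli_pattern) (auto simp: E2_def)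
  also have "card (?i ` L) = card L" using inj assms by (simp add: card_image inj_on_subset)
  also have "card (E2 x z) = card K2" using inj by (simp add: card_image E2_def)
  finally show ?thesis .
qed

lemma prob_plab_le:
  assumes "x \<in> U" "z \<in> U" "x \<noteq> z"
  shows "measure_pmf.prob \<P> {f. Q (plab f x z)} \<le> (\<Sum>L\<in>{L. L \<subseteq> K2 \<and> Q L}. p ^ card L)"
proof -
  have fin: "finite {L. L \<subseteq> K2 \<and> Q L}" using finite_K by simp
  have "measure_pmf.prob \<P> {f. Q (plab f x z)} \<le>
      measure_pmf.prob \<P> (\<Union>L\<in>{L. L \<subseteq> K2 \<and> Q L}. {f. plab f x z = L})"
    using plab_subset by (intro measure_pmf.finite_measure_mono) auto
  also have "\<dots> \<le> (\<Sum>L\<in>{L. L \<subseteq> K2 \<and> Q L}. measure_pmf.prob \<P> {f. plab f x z = L})"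
    using fin by (intro measure_pmf.finite_measure_subadditive_finite) auto
  also have "\<dots> \<le> (\<Sum>L\<in>{L. L \<subseteq> K2 \<and> Q L}. p ^ card L)"
    using assms p by (intro sum_mono) (auto simp: prob_plab mult_left_le power_le_one)
  finally show ?thesis .
qed

text \<open>If fewer than \<open>lo\<close> vertices have the label, then at least
  \<open>card U - lo\<close> miss it, and the misses are independent. The crude count of the
  exceptional sets is affordable because \<open>lo\<close> will be smaller than the expected class
  size by a power of n.\<close>

lemma prob_label_count_less:
  assumes "A \<subseteq> K1" "lo \<le> card U"
  shows "measure_pmf.prob \<P> {f. card {x\<in>U. lab f x = A} < lo} \<le>
    real (card U choose lo) * (1 - p ^ card A * (1 - p) ^ (card K1 - card A)) ^ (card U - lo)"
proof -
  have cards: "card {x\<in>U. lab f x = A} + card {x\<in>U. lab f x \<noteq> A} = card U" for f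
  proof -
    have "{x\<in>U. lab f x = A} \<union> {x\<in>U. lab f x \<noteq> A} = U" by auto
    then show ?thesis
      using card_Un_disjoint[of "{x\<in>U. lab f x = A}" "{x\<in>U. lab f x \<noteq> A}"] finite_U
      by (simp add: disjoint_iff)
  qed
  have "card U - lo \<le> card {x\<in>U. lab f x \<noteq> A}" if "card {x\<in>U. lab f x = A} < lo" for f
    using cards[of f] that by linarith
  then have "{f. card {x\<in>U. lab f x = A} < lo} \<subseteq> {f. card U - lo \<le> card {x\<in>U. lab f x \<noteq> A}}"
    by blast
  then have "measure_pmf.prob \<P> {f. card {x\<in>U. lab f x = A} < lo} \<le>
      measure_pmf.prob \<P> {f. card U - lo \<le> card {x\<in>U. lab f x \<noteq> A}}"
    by (intro measure_pmf.finite_measure_mono) auto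
  also have "\<dots> \<le> real (card U choose (card U - lo)) *
      (1 - p ^ card A * (1 - p) ^ (card K1 - card A)) ^ (card U - lo)"
    unfolding \<P>_def
  proof (rule prob_Pi_pmf_count_ge[OF finite_edges finite_U _ E1_disjoint])
    fix x assume x: "x \<in> U"
    show "depends_on (\<lambda>f. lab f x \<noteq> A) (E1 x)" by (rule depends_on_comp[OF lab_depends])
    have "{f. lab f x \<noteq> A} = UNIV - {f. lab f x = A}" by auto
    then show "measure_pmf.prob (Pi_pmf (possible_edges s n) False (\<lambda>_. bernoulli_pmf p)) {f. lab f x \<noteq> A}
        \<le> 1 - p ^ card A * (1 - p) ^ (card K1 - card A)"
      using measure_pmf.prob_compl[of "{f. lab f x = A}" \<P>] prob_lab[OF x assms(1)]
      by (simp add: \<P>_def)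
  qed
  also have "card U choose (card U - lo) = card U choose lo"
    using binomial_symmetric[OF assms(2)] by simp
  finally show ?thesis .
qed

lemma prob_label_count_ge:
  assumes "A \<subseteq> K1"
  shows "measure_pmf.prob \<P> {f. hi \<le> card {x\<in>U. lab f x = A}} \<le>
    real (card U choose hi) * (p ^ card A) ^ hi"
  unfolding \<P>_def
proof (rule prob_Pi_pmf_count_ge[OF finite_edges finite_U _ E1_disjoint])
  fix x assume x: "x \<in> U"
  show "depends_on (\<lambda>f. lab f x = A) (E1 x)" by (rule depends_on_comp[OF lab_depends])
  show "measure_pmf.prob (Pi_pmf (possible_edges s n) False (\<lambda>_. bernoulli_pmf p)) {f. lab f x = A}
      \<le> p ^ card A"
    using prob_lab[OF x assms] p by (simp add: \<P>_def mult_left_le power_le_one)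
qed

text \<open>Orienting the pairs by \<open>\<rho>\<close> makes the events for distinct \<open>x\<close> independent; it is applied
  with \<open>(<)\<close> and \<open>(>)\<close>.\<close>

lemma prob_hits:
  assumes X: "X \<subseteq> U" "card X = 4 * t"
    and \<rho>: "\<And>x z. \<rho> x z \<Longrightarrow> \<not> \<rho> z x"
    and small: "\<And>L. L \<subseteq> K2 \<Longrightarrow> A \<union> L \<in> R \<Longrightarrow> 2 ^ card K2 * (4 * real t * p ^ card L) \<le> 1 / 32"
  shows "measure_pmf.prob \<P> {f. t \<le> card {x\<in>X. \<exists>z\<in>X. \<rho> x z \<and> A \<union> plab f x z \<in> R}} \<le> (1 / 2) ^ t"
proof -
  let ?J = "\<lambda>x. \<Union>z\<in>{z\<in>X. \<rho> x z}. E2 x z"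
  have fX: "finite X" using X finite_U finite_subset by blast
  have irr: "x \<noteq> z" if "\<rho> x z" for x z using \<rho> that by blast
  \<comment> \<open>The orientation charges each unordered pair of candidates to only one of its
    ends.\<close>
  have disj: "disjoint_family_on ?J X"
    unfolding disjoint_family_on_def
  proof (intro ballI impI)
    fix x x' assume x: "x \<in> X" "x' \<in> X" "x \<noteq> x'"
    have "E2 x z \<inter> E2 x' z' = {}" if "z \<in> X" "\<rho> x z" "z' \<in> X" "\<rho> x' z'" for z z'
    proof (rule E2_disjoint)
      show "{x, z} \<noteq> {x', z'}" using x(3) that \<rho> by (auto simp: doubleton_eq_iff)
    qed (use x that X irr in auto)
    then show "?J x \<inter> ?J x' = {}" by blast
  qed
  \<comment> \<open>Each candidate is hit with probability at most 1/32, and there are at most 2^(4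
    t) = 16^t sets of \<open>t\<close> candidates; this gives (16/32)^t.\<close>
  have "measure_pmf.prob \<P> {f. t \<le> card {x\<in>X. \<exists>z\<in>X. \<rho> x z \<and> A \<union> plab f x z \<in> R}} \<le>
      real (card X choose t) * (1 / 32) ^ t"
    unfolding \<P>_def
  proof (rule prob_Pi_pmf_count_ge[OF finite_edges fX _ disj])
    fix x assume x: "x \<in> X"
    show "depends_on (\<lambda>f. \<exists>z\<in>X. \<rho> x z \<and> A \<union> plab f x z \<in> R) (?J x)"
    proof (rule depends_onI)
      fix f g :: "nat set \<Rightarrow> bool" assume "\<And>i. i \<in> ?J x \<Longrightarrow> f i = g i"
      then have "plab f x z = plab g x z" if "z \<in> X" "\<rho> x z" for z
        using that by (intro depends_onD[OF plab_depends]) auto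
      then show "(\<exists>z\<in>X. \<rho> x z \<and> A \<union> plab f x z \<in> R) = (\<exists>z\<in>X. \<rho> x z \<and> A \<union> plab g x z \<in> R)"
        by auto
    qed
    let ?D = "{z\<in>X. \<rho> x z}" and ?Ls = "{L. L \<subseteq> K2 \<and> A \<union> L \<in> R}"
    have "measure_pmf.prob \<P> {f. \<exists>z\<in>X. \<rho> x z \<and> A \<union> plab f x z \<in> R} \<le>
        measure_pmf.prob \<P> (\<Union>z\<in>?D. {f. A \<union> plab f x z \<in> R})"
      by (intro measure_pmf.finite_measure_mono) auto
    also have "\<dots> \<le> (\<Sum>z\<in>?D. measure_pmf.prob \<P> {f. A \<union> plab f x z \<in> R})"
      using fX by (intro measure_pmf.finite_measure_subadditive_finite) auto
    also have "\<dots> \<le> (\<Sum>z\<in>?D. \<Sum>L\<in>?Ls. p ^ card L)"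
      using x X irr by (intro sum_mono prob_plab_le) auto
    also have "\<dots> = (\<Sum>L\<in>?Ls. real (card ?D) * p ^ card L)"
      by (simp add: sum_distrib_left)
    also have "\<dots> \<le> (\<Sum>L\<in>?Ls. 1 / 32 / 2 ^ card K2)"
    proof (rule sum_mono)
      fix L assume L: "L \<in> ?Ls"
      have "card ?D \<le> 4 * t" using X(2) card_mono[OF fX, of ?D] by auto
      then have "real (card ?D) \<le> 4 * real t" by linarith
      then have "real (card ?D) * p ^ card L \<le> 4 * real t * p ^ card L"
        using p by (intro mult_right_mono) auto
      also have "\<dots> \<le> 1 / 32 / 2 ^ card K2"
        using small[of L] L by (simp add: field_simps)
      finally show "real (card ?D) * p ^ card L \<le> 1 / 32 / 2 ^ card K2" .
    qed
    also have "\<dots> = real (card ?Ls) * (1 / 32 / 2 ^ card K2)" by simp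
    also have "\<dots> \<le> 2 ^ card K2 * (1 / 32 / 2 ^ card K2)"
    proof (rule mult_right_mono)
      have "card ?Ls \<le> card (Pow K2)" using finite_K by (intro card_mono) auto
      then show "real (card ?Ls) \<le> 2 ^ card K2"
        by (simp add: card_Pow finite_K)
    qed simp
    finally show "measure_pmf.prob (Pi_pmf (possible_edges s n) False (\<lambda>_. bernoulli_pmf p))
        {f. \<exists>z\<in>X. \<rho> x z \<and> A \<union> plab f x z \<in> R} \<le> 1 / 32"
      by (simp add: \<P>_def)
  qed
  also have "\<dots> \<le> 2 ^ (4 * t) * (1 / 32) ^ t"
  proof (rule mult_right_mono)
    have "card X choose t \<le> 2 ^ (4 * t)" using binomial_le_pow2[of "card X" t] X(2) by simp
    then show "real (card X choose t) \<le> 2 ^ (4 * t)" by (metis of_nat_le_iff of_nat_numeral of_nat_power)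
  qed simp
  also have "\<dots> = (1 / 2) ^ t" by (simp add: power_mult power_mult_distrib[symmetric])
  finally show ?thesis .
qed

text \<open>For one candidate \<open>x\<close> and fixed labels, the patterns seen from
  \<open>x\<close> depend on the disjoint blocks \<open>E2 x z\<close>, so
  \<open>prob_Pi_pmf_values_exactly\<close> applies. The product over \<open>S\<close> is the weight
  of choosing one vertex per prescribed pattern; the exponential is the price of avoiding all other
  rare patterns. \<kappa> bounds the expected number of vertices of one label class that produce a
  given rare pattern.\<close>

lemma prob_exact_ge:
  fixes \<nu> :: "nat \<Rightarrow> nat"
  assumes X: "X \<subseteq> U" "x \<in> X" and l: "\<And>z. z \<in> U \<Longrightarrow> l z \<subseteq> K1"
    and R: "R \<subseteq> Pow (K1 \<union> K2)" "S \<subseteq> R"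
    and many: "\<And>A. A \<subseteq> K1 \<Longrightarrow> 2 ^ card K2 * \<nu> (card A) \<le> card {z\<in>U - X. l z = A}"
    and few: "\<And>A L. A \<subseteq> K1 \<Longrightarrow> L \<subseteq> K2 \<Longrightarrow> A \<union> L \<in> R \<Longrightarrow>
        real (card {z\<in>U - X. l z = A}) * p ^ card L \<le> \<kappa>"
    and half: "2 ^ card K2 * p \<le> 1 / 2" "R \<inter> Pow K1 = {}" and \<kappa>: "0 \<le> \<kappa>"
  shows "(\<Prod>\<tau>\<in>S. real (\<nu> (card (\<tau> \<inter> K1))) * (p ^ card (\<tau> \<inter> K2) * (1 - p) ^ card K2))
      * exp (- 2 * (2 ^ card K1 * 2 ^ card K2 * \<kappa>))
    \<le> measure_pmf.prob \<P> {f. (\<lambda>z. l z \<union> plab f x z) ` (U - X) \<inter> R = S}"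
proof -
  \<comment> \<open>Inside a label class, disjoint sets of \<open>\<nu>\<close> vertices are
    reserved, one for each of the \<open>2 ^ card K2\<close> possible pair labels. This is the
    source of the factor in \<open>many\<close>.\<close>
  have "\<exists>Z. (\<forall>L\<in>Pow K2. Z L \<subseteq> {z\<in>U - X. l z = A} \<and> card (Z L) = \<nu> (card A)) \<and> disjoint_family_on Z (Pow K2)"
    if "A \<subseteq> K1" for A
    using many[OF that] finite_K finite_U by (intro exists_disjoint_subsets) (auto simp: card_Pow)
  then have "\<exists>g. \<forall>A. A \<subseteq> K1 \<longrightarrow> (\<forall>L\<in>Pow K2. g A L \<subseteq> {z\<in>U - X. l z = A} \<and> card (g A L) = \<nu> (card A))
      \<and> disjoint_family_on (g A) (Pow K2)"
    by (intro choice) auto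
  then obtain g where g0: "\<forall>A. A \<subseteq> K1 \<longrightarrow> (\<forall>L\<in>Pow K2. g A L \<subseteq> {z\<in>U - X. l z = A} \<and> card (g A L) = \<nu> (card A))
      \<and> disjoint_family_on (g A) (Pow K2)" ..
  have g: "g A L \<subseteq> {z\<in>U - X. l z = A}" "card (g A L) = \<nu> (card A)" "disjoint_family_on (g A) (Pow K2)"
    if "A \<subseteq> K1" "L \<subseteq> K2" for A L
    using g0 that by blast+
  define Z where "Z \<tau> = g (\<tau> \<inter> K1) (\<tau> \<inter> K2)" for \<tau>
  define r where "r z = (\<Sum>L\<in>{L. L \<subseteq> K2 \<and> l z \<union> L \<in> R}. p ^ card L)" for z
  let ?T = "U - X"
  have fT: "finite ?T" using finite_U by simp
  have fS: "finite S" using R finite_K finite_subset by (metis finite_Pow_iff finite_Un)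
  have xU: "x \<in> U" using X by auto
  have split: "\<tau> = (\<tau> \<inter> K1) \<union> (\<tau> \<inter> K2)" if "\<tau> \<in> R" for \<tau> using R that by auto
  have ZT: "Z \<tau> \<subseteq> {z\<in>U - X. l z = \<tau> \<inter> K1}" "card (Z \<tau>) = \<nu> (card (\<tau> \<inter> K1))" for \<tau>
    using g(1,2)[of "\<tau> \<inter> K1" "\<tau> \<inter> K2"] by (auto simp: Z_def)
  have disjZ: "disjoint_family_on Z S"
    unfolding disjoint_family_on_def
  proof (intro ballI impI)
    fix \<tau> \<tau>' assume t: "\<tau> \<in> S" "\<tau>' \<in> S" "\<tau> \<noteq> \<tau>'"
    show "Z \<tau> \<inter> Z \<tau>' = {}"
    proof (cases "\<tau> \<inter> K1 = \<tau>' \<inter> K1")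
      case True
      have "\<tau> = (\<tau> \<inter> K1) \<union> (\<tau> \<inter> K2)" "\<tau>' = (\<tau>' \<inter> K1) \<union> (\<tau>' \<inter> K2)"
        using split t R(2) by blast+
      then have "\<tau> \<inter> K2 \<noteq> \<tau>' \<inter> K2" using True t(3) by metis
      moreover have "disjoint_family_on (g (\<tau> \<inter> K1)) (Pow K2)" by (rule g(3)[of _ "{}"]) auto
      moreover have "\<tau> \<inter> K2 \<in> Pow K2" "\<tau>' \<inter> K2 \<in> Pow K2" by auto
      ultimately show ?thesis unfolding Z_def True[symmetric] disjoint_family_on_def by metis
    next
      case False
      then show ?thesis using ZT(1)[of \<tau>] ZT(1)[of \<tau>'] by blast
    qed
  qed
  have r_le: "r z \<le> 1 / 2" "0 \<le> r z" if "z \<in> ?T" for z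
  proof -
    show "0 \<le> r z" using p by (auto simp: r_def intro: sum_nonneg)
    have "r z \<le> (\<Sum>L\<in>{L. L \<subseteq> K2 \<and> l z \<union> L \<in> R}. p)"
      unfolding r_def
    proof (rule sum_mono)
      fix L assume L: "L \<in> {L. L \<subseteq> K2 \<and> l z \<union> L \<in> R}"
      \<comment> \<open>No subset of \<open>K1\<close> belongs to \<open>R\<close>, so reaching
        \<open>R\<close> takes a nonempty pair label and costs at least one factor
        \<open>p\<close>.\<close>
      have "L \<noteq> {}" using L half(2) l[of z] that by auto
      then have "card L \<noteq> 0" using L finite_K finite_subset by (auto simp: card_eq_0_iff)
      then have "p ^ card L \<le> p ^ 1" using p by (intro power_decreasing) auto
      then show "p ^ card L \<le> p" by simp
    qed
    also have "\<dots> = real (card {L. L \<subseteq> K2 \<and> l z \<union> L \<in> R}) * p" by simp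
    also have "\<dots> \<le> 2 ^ card K2 * p"
    proof (rule mult_right_mono)
      have "card {L. L \<subseteq> K2 \<and> l z \<union> L \<in> R} \<le> card (Pow K2)" using finite_K by (intro card_mono) auto
      then show "real (card {L. L \<subseteq> K2 \<and> l z \<union> L \<in> R}) \<le> 2 ^ card K2"
        by (simp add: card_Pow finite_K)
    qed (use p in simp)
    finally show "r z \<le> 1 / 2" using half(1) by simp
  qed
  \<comment> \<open>The bound on the expected number of values in \<open>R\<close> is split by label
    class and pair label, so that \<kappa> bounds each summand.\<close>
  have "(\<Sum>z\<in>?T. r z) = (\<Sum>A\<in>Pow K1. \<Sum>z\<in>{z\<in>?T. l z = A}. r z)"
    using fT finite_K l by (intro sum.group[symmetric]) auto
  also have "\<dots> = (\<Sum>A\<in>Pow K1. \<Sum>z\<in>{z\<in>?T. l z = A}. \<Sum>L\<in>{L. L \<subseteq> K2 \<and> A \<union> L \<in> R}. p ^ card L)"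
    by (intro sum.cong) (auto simp: r_def)
  also have "\<dots> = (\<Sum>A\<in>Pow K1. \<Sum>L\<in>{L. L \<subseteq> K2 \<and> A \<union> L \<in> R}. real (card {z\<in>?T. l z = A}) * p ^ card L)"
    by (simp add: sum_distrib_left)
  also have "\<dots> \<le> (\<Sum>A\<in>Pow K1. \<Sum>L\<in>{L. L \<subseteq> K2 \<and> A \<union> L \<in> R}. \<kappa>)"
    by (intro sum_mono few) auto
  also have "\<dots> \<le> (\<Sum>A\<in>Pow K1. \<Sum>L\<in>Pow K2. \<kappa>)"
    using finite_K \<kappa> by (intro sum_mono sum_mono2) auto
  also have "\<dots> = 2 ^ card K1 * 2 ^ card K2 * \<kappa>"
    using finite_K by (simp add: card_Pow)
  finally have sum_r: "(\<Sum>z\<in>?T. r z) \<le> 2 ^ card K1 * 2 ^ card K2 * \<kappa>" .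
  have "exp (- 2 * (2 ^ card K1 * 2 ^ card K2 * \<kappa>)) \<le> exp (\<Sum>z\<in>?T. - 2 * r z)"
    using sum_r unfolding sum_distrib_left[symmetric] by simp
  also have "\<dots> = (\<Prod>z\<in>?T. exp (- 2 * r z))" using fT by (simp add: exp_sum)
  also have "\<dots> \<le> (\<Prod>z\<in>?T. 1 - r z)"
    using r_le one_minus_ge_exp by (intro prod_mono) auto
  finally have prod_r: "exp (- 2 * (2 ^ card K1 * 2 ^ card K2 * \<kappa>)) \<le> (\<Prod>z\<in>?T. 1 - r z)" .
  let ?a = "\<lambda>\<tau>. p ^ card (\<tau> \<inter> K2) * (1 - p) ^ card K2"
  have "(\<Prod>\<tau>\<in>S. real (\<nu> (card (\<tau> \<inter> K1))) * ?a \<tau>) * exp (- 2 * (2 ^ card K1 * 2 ^ card K2 * \<kappa>))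
      \<le> (\<Prod>\<tau>\<in>S. real (card (Z \<tau>)) * ?a \<tau>) * (\<Prod>z\<in>?T. 1 - r z)"
    unfolding ZT(2) using prod_r p by (intro mult_left_mono prod_nonneg) auto
  also have "\<dots> \<le> measure_pmf.prob (Pi_pmf (possible_edges s n) False (\<lambda>_. bernoulli_pmf p))
      {f. (\<lambda>z. l z \<union> plab f x z) ` ?T \<inter> R = S}"
  proof (rule prob_Pi_pmf_values_exactly[OF finite_edges fT, where J = "\<lambda>z. E2 x z"])
    fix z assume z: "z \<in> ?T"
    then have xz: "z \<in> U" "x \<noteq> z" using X by auto
    show "depends_on (\<lambda>f. l z \<union> plab f x z) (E2 x z)" by (rule depends_on_comp[OF plab_depends])
    show "measure_pmf.prob (Pi_pmf (possible_edges s n) False (\<lambda>_. bernoulli_pmf p)) {f. l z \<union> plab f x z \<in> R} \<le> r z"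
      using prob_plab_le[OF xU xz, of "\<lambda>L. l z \<union> L \<in> R"] by (simp add: \<P>_def r_def)
    show "r z \<le> 1" using r_le[OF z] by simp
  next
    show "disjoint_family_on (E2 x) ?T"
      unfolding disjoint_family_on_def using X xU
      by (intro ballI impI E2_disjoint) (auto simp: doubleton_eq_iff)
    show "finite S" "S \<subseteq> R" using fS R by auto
    show "Z \<tau> \<subseteq> ?T" for \<tau> using ZT(1)[of \<tau>] by auto
    show "disjoint_family_on Z S" by (rule disjZ)
    show "0 \<le> ?a \<tau>" for \<tau> using p by simp
  next
    fix \<tau> z assume \<tau>: "\<tau> \<in> S" and z: "z \<in> Z \<tau>"
    have z': "z \<in> U" "z \<notin> X" "l z = \<tau> \<inter> K1" using z ZT(1)[of \<tau>] by auto
    then have "x \<noteq> z" using X by auto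
    have "?a \<tau> \<le> p ^ card (\<tau> \<inter> K2) * (1 - p) ^ (card K2 - card (\<tau> \<inter> K2))"
      using p by (intro mult_left_mono power_decreasing) auto
    also have "\<dots> = measure_pmf.prob \<P> {f. plab f x z = \<tau> \<inter> K2}"
      using prob_plab[OF xU z'(1) \<open>x \<noteq> z\<close>] by simp
    also have "\<dots> \<le> measure_pmf.prob \<P> {f. l z \<union> plab f x z = \<tau>}"
      using z'(3) split[of \<tau>] \<tau> R(2) by (intro measure_pmf.finite_measure_mono) auto
    finally show "?a \<tau> \<le> measure_pmf.prob (Pi_pmf (possible_edges s n) False (\<lambda>_. bernoulli_pmf p)) {f. l z \<union> plab f x z = \<tau>}"
      by (simp add: \<P>_def)
  qed
  finally show ?thesis by (simp add: \<P>_def)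
qed

text \<open>Pairs inside the candidate set \<open>X\<close> are shared by two candidates and are
  exposed first. A pair with only one vertex in \<open>X\<close> belongs to a single candidate. So
  the candidates without a hit inside \<open>X\<close> succeed independently, each with probability
  at least \<open>q\<close>.\<close>

lemma prob_not_exact_given_labels:
  fixes \<nu> :: "nat \<Rightarrow> nat"
  assumes l: "\<And>z. z \<in> U \<Longrightarrow> l z \<subseteq> K1" and A: "A \<subseteq> K1"
    and R: "R \<subseteq> Pow (K1 \<union> K2)" "S \<subseteq> R"
    and many: "\<And>B. B \<subseteq> K1 \<Longrightarrow>
        2 ^ card K2 * \<nu> (card B) + (if B = A then 4 * t else 0) \<le> card {z\<in>U. l z = B}"
    and few: "\<And>B L. B \<subseteq> K1 \<Longrightarrow> L \<subseteq> K2 \<Longrightarrow> B \<union> L \<in> R \<Longrightarrow>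
        real (card {z\<in>U. l z = B}) * p ^ card L \<le> \<kappa>"
    and small: "\<And>L. L \<subseteq> K2 \<Longrightarrow> A \<union> L \<in> R \<Longrightarrow> 2 ^ card K2 * (4 * real t * p ^ card L) \<le> 1 / 32"
    and half: "2 ^ card K2 * p \<le> 1 / 2" "R \<inter> Pow K1 = {}" and \<kappa>: "0 \<le> \<kappa>"
    and q: "0 \<le> q" "q \<le> (\<Prod>\<tau>\<in>S. real (\<nu> (card (\<tau> \<inter> K1))) * (p ^ card (\<tau> \<inter> K2) * (1 - p) ^ card K2))
      * exp (- 2 * (2 ^ card K1 * 2 ^ card K2 * \<kappa>))"
  shows "measure_pmf.prob \<P> {f. \<not> (\<exists>x\<in>U. l x = A \<and> (\<lambda>z. l z \<union> plab f x z) ` (U - {x}) \<inter> R = S)}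
    \<le> 2 * (1 / 2) ^ t + exp (- q) ^ t"
proof -
  have "4 * t \<le> card {z\<in>U. l z = A}" using many[OF A] by simp
  then obtain X where X: "X \<subseteq> {z\<in>U. l z = A}" "card X = 4 * t" and fX: "finite X"
    by (rule obtain_subset_with_card_n)
  have XU: "X \<subseteq> U" using X(1) by blast
  define hits where "hits \<rho> f = {x\<in>X. \<exists>z\<in>X. \<rho> x z \<and> A \<union> plab f x z \<in> R}" for \<rho> :: "nat \<Rightarrow> nat \<Rightarrow> bool" and f
  define G where "G f \<longleftrightarrow> \<not> t \<le> card (hits (<) f) \<and> \<not> t \<le> card (hits (>) f)" for f
  let ?ok = "\<lambda>f x. (\<lambda>z. l z \<union> plab f x z) ` (U - X) \<inter> R = S"
  have ok_prob: "q \<le> measure_pmf.prob \<P> {f. ?ok f x}" if x: "x \<in> X" for x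
  proof -
    have sub: "{z\<in>U - X. l z = B} \<subseteq> {z\<in>U. l z = B}" for B by auto
    have m1: "2 ^ card K2 * \<nu> (card B) \<le> card {z\<in>U - X. l z = B}" if B: "B \<subseteq> K1" for B
    proof (cases "B = A")
      case True
      \<comment> \<open>Removing \<open>X\<close> costs the class of \<open>A\<close> exactly the
        \<open>4 * t\<close> vertices that \<open>many\<close> has added for it.\<close>
      have "{z\<in>U - X. l z = A} = {z\<in>U. l z = A} - X" using X by auto
      then have "card {z\<in>U - X. l z = A} = card {z\<in>U. l z = A} - 4 * t"
        using X fX by (simp add: card_Diff_subset)
      then show ?thesis using many[OF B] True by auto
    next
      case False
      then have "{z\<in>U - X. l z = B} = {z\<in>U. l z = B}" using X by auto
      then show ?thesis using many[OF B] False by simp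
    qed
    have m2: "real (card {z\<in>U - X. l z = B}) * p ^ card L \<le> \<kappa>"
      if "B \<subseteq> K1" "L \<subseteq> K2" "B \<union> L \<in> R" for B L
    proof -
      have "real (card {z\<in>U - X. l z = B}) * p ^ card L \<le> real (card {z\<in>U. l z = B}) * p ^ card L"
        using p finite_U card_mono[OF _ sub[of B]] by (intro mult_right_mono) auto
      then show ?thesis using few[OF that] by simp
    qed
    show ?thesis by (rule order_trans[OF q(2) prob_exact_ge[OF XU x l R m1 m2 half \<kappa>]])
  qed
  have step: "measure_pmf.prob \<P>
      {h. \<not> (\<exists>x\<in>U. l x = A \<and> (\<lambda>z. l z \<union> plab (mix {e. e - W \<subseteq> X} g h) x z) ` (U - {x}) \<inter> R = S)}
      \<le> exp (- q) ^ t" if "G g" for g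
  proof -
    \<comment> \<open>The candidates that see no member of \<open>R\<close> inside \<open>X\<close>.
      Fewer than \<open>t\<close> are lost for each orientation, so of the \<open>4 * t\<close>
      candidates at least \<open>t\<close> remain.\<close>
    define H where "H = X - hits (<) g - hits (>) g"
    have fH: "finite H" using fX by (simp add: H_def)
    have "card (hits (<) g) < t" "card (hits (>) g) < t" using that by (auto simp: G_def)
    moreover have "card X \<le> card H + card (hits (<) g) + card (hits (>) g)"
    proof -
      have "X \<subseteq> (H \<union> hits (<) g) \<union> hits (>) g" by (auto simp: H_def)
      then have "card X \<le> card ((H \<union> hits (<) g) \<union> hits (>) g)"
        using fX fH by (intro card_mono) (auto simp: hits_def)
      also have "\<dots> \<le> card (H \<union> hits (<) g) + card (hits (>) g)" by (rule card_Un_le)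
      also have "\<dots> \<le> card H + card (hits (<) g) + card (hits (>) g)"
        using card_Un_le[of H "hits (<) g"] by simp
      finally show ?thesis .
    qed
    ultimately have cH: "t \<le> card H" using X(2) by linarith
    \<comment> \<open>For \<open>x\<close> in \<open>H\<close> success depends only on the second
      sample: towards vertices outside \<open>X\<close> the pair labels come from \<open>h\<close>,
      while inside \<open>X\<close> they come from \<open>g\<close> and give no member of
      \<open>R\<close>.\<close>
    have notok: "\<not> ?ok h x"
      if fail: "\<not> (\<exists>x\<in>U. l x = A \<and> (\<lambda>z. l z \<union> plab (mix {e. e - W \<subseteq> X} g h) x z) ` (U - {x}) \<inter> R = S)"
        and x: "x \<in> H" for h x
    proof
      assume ok: "?ok h x"
      have xX: "x \<in> X" using x by (simp add: H_def)
      then have xU: "x \<in> U" "l x = A" using X by auto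
      let ?m = "mix {e. e - W \<subseteq> X} g h"
      have out: "plab ?m x z = plab h x z" if "z \<in> U - X" for z
        using K2_edge(1)[OF xU(1)] that xX by (auto simp: plab_eq)
      have inn: "l z \<union> plab ?m x z \<notin> R" if z: "z \<in> X" "z \<noteq> x" for z
      proof -
        have "insert x (insert z Y) - W \<subseteq> X" if "Y \<in> K2" for Y
        proof -
          have "insert x (insert z Y) - W = {x, z}"
            using z XU by (intro K2_edge(1)[OF xU(1) _ _ that]) auto
          then show ?thesis using z xX by (simp only: insert_subset) simp
        qed
        then have "plab ?m x z = plab g x z"
          unfolding plab_eq by (intro Collect_cong conj_cong refl) simp
        moreover have "l z = A" using X z by auto
        moreover have "A \<union> plab g x z \<notin> R"
          using x z xX by (cases x z rule: linorder_cases) (auto simp: H_def hits_def)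
        ultimately show ?thesis by simp
      qed
      have "(\<lambda>z. l z \<union> plab ?m x z) ` (U - {x}) \<inter> R = (\<lambda>z. l z \<union> plab ?m x z) ` (U - X) \<inter> R"
        using inn xX by (intro image_Int_shrink) auto
      also have "(\<lambda>z. l z \<union> plab ?m x z) ` (U - X) = (\<lambda>z. l z \<union> plab h x z) ` (U - X)"
        using out by (intro image_cong) (simp_all only:)
      finally show False using fail ok xU by blast
    qed
    have "measure_pmf.prob \<P>
      {h. \<not> (\<exists>x\<in>U. l x = A \<and> (\<lambda>z. l z \<union> plab (mix {e. e - W \<subseteq> X} g h) x z) ` (U - {x}) \<inter> R = S)}
      \<le> measure_pmf.prob \<P> {h. \<forall>x\<in>H. \<not> ?ok h x}"
      by (intro measure_pmf.finite_measure_mono Collect_mono impI ballI) (erule (1) notok, simp)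
    also have "\<dots> = (\<Prod>x\<in>H. measure_pmf.prob \<P> {h. \<not> ?ok h x})"
      unfolding \<P>_def
    proof (rule prob_Pi_pmf_indep[OF finite_edges fH, where J = "\<lambda>x. \<Union>z\<in>U - X. E2 x z"])
      fix x
      show "depends_on (\<lambda>h. \<not> ?ok h x) (\<Union>z\<in>U - X. E2 x z)"
      proof (rule depends_onI)
        fix f g :: "nat set \<Rightarrow> bool" assume "\<And>i. i \<in> (\<Union>z\<in>U - X. E2 x z) \<Longrightarrow> f i = g i"
        then have "plab f x z = plab g x z" if "z \<in> U - X" for z
          using that by (intro depends_onD[OF plab_depends]) auto
        then have "(\<lambda>z. l z \<union> plab f x z) ` (U - X) = (\<lambda>z. l z \<union> plab g x z) ` (U - X)"
          by (intro image_cong) (simp_all only:)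
        then show "(\<not> ?ok f x) = (\<not> ?ok g x)" by simp
      qed
    next
      show "disjoint_family_on (\<lambda>x. \<Union>z\<in>U - X. E2 x z) H"
        unfolding disjoint_family_on_def
      proof (intro ballI impI)
        fix x x' assume x: "x \<in> H" "x' \<in> H" "x \<noteq> x'"
        have "E2 x z \<inter> E2 x' z' = {}" if "z \<in> U - X" "z' \<in> U - X" for z z'
        proof (rule E2_disjoint)
          show "{x, z} \<noteq> {x', z'}" using x that by (auto simp: doubleton_eq_iff H_def)
        qed (use x that XU in \<open>auto simp: H_def\<close>)
        then show "(\<Union>z\<in>U - X. E2 x z) \<inter> (\<Union>z\<in>U - X. E2 x' z) = {}" by blast
      qed
    qed
    also have "\<dots> \<le> (\<Prod>x\<in>H. exp (- q))"
    proof (rule prod_mono, intro conjI)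
      fix x assume "x \<in> H"
      then have "q \<le> measure_pmf.prob \<P> {f. ?ok f x}" using ok_prob by (simp add: H_def)
      moreover have "{h. \<not> ?ok h x} = UNIV - {h. ?ok h x}" by auto
      ultimately have "measure_pmf.prob \<P> {h. \<not> ?ok h x} \<le> 1 - q"
        using measure_pmf.prob_compl[of "{h. ?ok h x}" \<P>] by simp
      also have "\<dots> \<le> exp (- q)" using exp_ge_add_one_self[of "- q"] by simp
      finally show "measure_pmf.prob \<P> {h. \<not> ?ok h x} \<le> exp (- q)" .
    qed simp
    also have "\<dots> = exp (- q) ^ card H" by simp
    also have "\<dots> \<le> exp (- q) ^ t" using q(1) cH by (intro power_decreasing) auto
    finally show ?thesis .
  qed
  have "measure_pmf.prob \<P> {f. \<not> (\<exists>x\<in>U. l x = A \<and> (\<lambda>z. l z \<union> plab f x z) ` (U - {x}) \<inter> R = S)}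
    \<le> measure_pmf.prob \<P> {f. \<not> G f} + exp (- q) ^ t"
    unfolding \<P>_def
  proof (rule prob_Pi_pmf_expose[OF finite_edges, where J = "{e. e - W \<subseteq> X}"])
    fix g assume "G g"
    from step[OF this] show "measure_pmf.prob (Pi_pmf (possible_edges s n) False (\<lambda>_. bernoulli_pmf p))
      {h. \<not> (\<exists>x\<in>U. l x = A \<and> (\<lambda>z. l z \<union> plab (mix {e. e - W \<subseteq> X} g h) x z) ` (U - {x}) \<inter> R = S)}
      \<le> exp (- q) ^ t" by (simp add: \<P>_def)
  qed simp
  also have "measure_pmf.prob \<P> {f. \<not> G f} \<le>
      measure_pmf.prob \<P> ({f. t \<le> card (hits (<) f)} \<union> {f. t \<le> card (hits (>) f)})"
    by (intro measure_pmf.finite_measure_mono) (auto simp: G_def)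
  also have "\<dots> \<le> measure_pmf.prob \<P> {f. t \<le> card (hits (<) f)} + measure_pmf.prob \<P> {f. t \<le> card (hits (>) f)}"
    by (rule measure_Un_le) auto
  also have "\<dots> \<le> (1 / 2) ^ t + (1 / 2) ^ t"
    unfolding hits_def
    by (intro add_mono prob_hits[OF XU X(2) _ small]) auto
  finally show ?thesis by simp
qed

text \<open>The edges with exactly one vertex outside \<open>W\<close> are exposed first; they fix
  all labels and leave the pair labels untouched. \<open>G\<close> confines the sizes of the label
  classes by \<open>lo\<close> and \<open>hi\<close>, which depend only on the size of the label.
  The summands of the bound come from the failure of \<open>G\<close>, the hits inside the candidate
  set, and the failure of all remaining candidates.\<close>

lemma prob_not_exact:
  fixes \<nu> lo hi t :: "nat \<Rightarrow> nat"
  assumes A: "A \<subseteq> K1" and S: "S \<subseteq> rare \<alpha> s W" and \<alpha>: "\<alpha> * real (card K1) < 1" "0 \<le> \<alpha>"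
    and tails: "\<And>a. a \<le> card K1 \<Longrightarrow> lo a \<le> card U"
      "\<And>a. a \<le> card K1 \<Longrightarrow>
        real (card U choose lo a) * (1 - p ^ a * (1 - p) ^ (card K1 - a)) ^ (card U - lo a) \<le> b"
      "\<And>a. a \<le> card K1 \<Longrightarrow> real (card U choose hi a) * (p ^ a) ^ hi a \<le> b"
    and lo: "\<And>a. a \<le> card K1 \<Longrightarrow> 2 ^ card K2 * \<nu> a + 4 * t a \<le> lo a"
    and hi: "\<And>a i. a \<le> card K1 \<Longrightarrow> i \<le> card K2 \<Longrightarrow> \<alpha> * real (a + i) \<ge> 1 \<Longrightarrow> real (hi a) * p ^ i \<le> \<kappa>"
    and small: "\<And>a i. a \<le> card K1 \<Longrightarrow> i \<le> card K2 \<Longrightarrow> \<alpha> * real (a + i) \<ge> 1 \<Longrightarrow>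
        2 ^ card K2 * (4 * real (t a) * p ^ i) \<le> 1 / 32"
    and half: "2 ^ card K2 * p \<le> 1 / 2" and \<kappa>: "0 \<le> \<kappa>"
    and q: "0 \<le> q" "q \<le> (\<Prod>\<tau>\<in>S. real (\<nu> (card (\<tau> \<inter> K1))) * (p ^ card (\<tau> \<inter> K2) * (1 - p) ^ card K2))
      * exp (- 2 * (2 ^ card K1 * 2 ^ card K2 * \<kappa>))"
  shows "measure_pmf.prob \<P> {f. \<not> (\<exists>x\<in>U. lab f x = A \<and>
      (\<lambda>z. lab f z \<union> plab f x z) ` (U - {x}) \<inter> rare \<alpha> s W = S)}
    \<le> 2 ^ card K1 * (2 * b) + (2 * (1 / 2) ^ t (card A) + exp (- q) ^ t (card A))"
proof -
  define G where "G f \<longleftrightarrow> (\<forall>B\<in>Pow K1. lo (card B) \<le> card {x\<in>U. lab f x = B} \<and>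
      card {x\<in>U. lab f x = B} < hi (card B))" for f
  let ?R = "rare \<alpha> s W" and ?t = "t (card A)"
  let ?J = "{e. card (e - W) = 1}"
  have cK1: "card B \<le> card K1" if "B \<subseteq> K1" for B using that finite_K by (simp add: card_mono)
  have cK2: "card B \<le> card K2" if "B \<subseteq> K2" for B using that finite_K by (simp add: card_mono)
  have R: "?R \<subseteq> Pow (K1 \<union> K2)" by (auto simp: rare_def K1_def K2_def)
  have rareD: "\<alpha> * real (card B + card L) \<ge> 1" if "B \<subseteq> K1" "L \<subseteq> K2" "B \<union> L \<in> ?R" for B L
  proof -
    have "card (B \<union> L) = card B + card L"
      using that finite_K K1_K2_disjoint by (intro card_Un_disjoint) (auto intro: finite_subset)
    then show ?thesis using that(3) by (simp add: rare_def)
  qed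
  have disj: "?R \<inter> Pow K1 = {}"
  proof -
    have "\<alpha> * real (card B) < 1" if "B \<subseteq> K1" for B
    proof -
      have "\<alpha> * real (card B) \<le> \<alpha> * real (card K1)" using cK1[OF that] \<alpha>(2) by (intro mult_left_mono) auto
      then show ?thesis using \<alpha>(1) by simp
    qed
    then show ?thesis by (auto simp: rare_def not_le[symmetric])
  qed
  have mix1: "lab (mix ?J g h) x = lab g x" if "x \<in> U" for g h x
    using K1_edge(1)[OF that] by (auto simp: lab_eq)
  have mix2: "plab (mix ?J g h) x z = plab h x z" if "x \<in> U" "z \<in> U" "x \<noteq> z" for g h x z
    using K2_edge(1)[OF that] that(3) by (auto simp: plab_eq)
  have step: "measure_pmf.prob \<P> {h. \<not> (\<exists>x\<in>U. lab (mix ?J g h) x = A \<and>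
      (\<lambda>z. lab (mix ?J g h) z \<union> plab (mix ?J g h) x z) ` (U - {x}) \<inter> ?R = S)}
    \<le> 2 * (1 / 2) ^ ?t + exp (- q) ^ ?t" if "G g" for g
  proof -
    have im: "(\<lambda>z. lab (mix ?J g h) z \<union> plab (mix ?J g h) x z) ` (U - {x}) =
      (\<lambda>z. lab g z \<union> plab h x z) ` (U - {x})" if "x \<in> U" for h x
    proof (rule image_cong)
      fix z assume "z \<in> U - {x}"
      then show "lab (mix ?J g h) z \<union> plab (mix ?J g h) x z = lab g z \<union> plab h x z"
        using mix1[of z g h] mix2[of x z g h] that by auto
    qed simp
    have "{h. \<not> (\<exists>x\<in>U. lab (mix ?J g h) x = A \<and>
        (\<lambda>z. lab (mix ?J g h) z \<union> plab (mix ?J g h) x z) ` (U - {x}) \<inter> ?R = S)} =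
      {h. \<not> (\<exists>x\<in>U. lab g x = A \<and> (\<lambda>z. lab g z \<union> plab h x z) ` (U - {x}) \<inter> ?R = S)}"
      using mix1 im by (intro Collect_cong arg_cong[where f = Not] bex_cong) (simp_all only:)
    also have "measure_pmf.prob \<P> \<dots> \<le> 2 * (1 / 2) ^ ?t + exp (- q) ^ ?t"
    proof (rule prob_not_exact_given_labels[OF lab_subset A R S _ _ _ half disj \<kappa> q])
      fix B assume B: "B \<subseteq> K1"
      have "2 ^ card K2 * \<nu> (card B) + 4 * t (card B) \<le> lo (card B)" using lo cK1[OF B] by blast
      also have "\<dots> \<le> card {z\<in>U. lab g z = B}" using \<open>G g\<close> B by (auto simp: G_def)
      finally show "2 ^ card K2 * \<nu> (card B) + (if B = A then 4 * ?t else 0) \<le> card {z\<in>U. lab g z = B}"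
        by auto
    next
      fix B L assume BL: "B \<subseteq> K1" "L \<subseteq> K2" "B \<union> L \<in> ?R"
      have "card {z\<in>U. lab g z = B} < hi (card B)" using \<open>G g\<close> BL by (auto simp: G_def)
      then have "real (card {z\<in>U. lab g z = B}) * p ^ card L \<le> real (hi (card B)) * p ^ card L"
        using p by (intro mult_right_mono) auto
      also have "\<dots> \<le> \<kappa>" using hi[OF cK1 cK2 rareD] BL by blast
      finally show "real (card {z\<in>U. lab g z = B}) * p ^ card L \<le> \<kappa>" .
    next
      fix L assume L: "L \<subseteq> K2" "A \<union> L \<in> ?R"
      then show "2 ^ card K2 * (4 * real ?t * p ^ card L) \<le> 1 / 32"
        using small[OF cK1 cK2 rareD] A by blast
    qed
    finally show ?thesis .
  qed
  let ?rhs = "2 * (1 / 2) ^ ?t + exp (- q) ^ ?t"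
  have tail: "measure_pmf.prob \<P> {f. \<not> G f} \<le> 2 ^ card K1 * (2 * b)"
  proof -
    have "{f. \<not> G f} \<subseteq> (\<Union>B\<in>Pow K1. {f. card {x\<in>U. lab f x = B} < lo (card B)} \<union>
        {f. hi (card B) \<le> card {x\<in>U. lab f x = B}})"
      by (auto simp: G_def not_le not_less)
    then have "measure_pmf.prob \<P> {f. \<not> G f} \<le> measure_pmf.prob \<P>
       (\<Union>B\<in>Pow K1. {f. card {x\<in>U. lab f x = B} < lo (card B)} \<union>
        {f. hi (card B) \<le> card {x\<in>U. lab f x = B}})"
      by (intro measure_pmf.finite_measure_mono) auto
    also have "\<dots> \<le> (\<Sum>B\<in>Pow K1. measure_pmf.prob \<P> ({f. card {x\<in>U. lab f x = B} < lo (card B)} \<union>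
        {f. hi (card B) \<le> card {x\<in>U. lab f x = B}}))"
      using finite_K by (intro measure_pmf.finite_measure_subadditive_finite) auto
    also have "\<dots> \<le> (\<Sum>B\<in>Pow K1. b + b)"
    proof (rule sum_mono)
      fix B assume "B \<in> Pow K1"
      then have B: "B \<subseteq> K1" "card B \<le> card K1" using cK1 by auto
      have "measure_pmf.prob \<P> ({f. card {x\<in>U. lab f x = B} < lo (card B)} \<union>
        {f. hi (card B) \<le> card {x\<in>U. lab f x = B}}) \<le>
        measure_pmf.prob \<P> {f. card {x\<in>U. lab f x = B} < lo (card B)} +
        measure_pmf.prob \<P> {f. hi (card B) \<le> card {x\<in>U. lab f x = B}}"
        by (rule measure_Un_le) auto
      also have "\<dots> \<le> b + b"
        using order_trans[OF prob_label_count_less[OF B(1) tails(1)[OF B(2)]] tails(2)[OF B(2)]]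
          order_trans[OF prob_label_count_ge[OF B(1)] tails(3)[OF B(2)]] by (rule add_mono)
      finally show "measure_pmf.prob \<P> ({f. card {x\<in>U. lab f x = B} < lo (card B)} \<union>
        {f. hi (card B) \<le> card {x\<in>U. lab f x = B}}) \<le> b + b" .
    qed
    also have "\<dots> = 2 ^ card K1 * (2 * b)" using finite_K by (simp add: card_Pow)
    finally show ?thesis .
  qed
  have "measure_pmf.prob \<P> {f. \<not> (\<exists>x\<in>U. lab f x = A \<and>
      (\<lambda>z. lab f z \<union> plab f x z) ` (U - {x}) \<inter> ?R = S)} \<le> measure_pmf.prob \<P> {f. \<not> G f} + ?rhs"
    unfolding \<P>_def
  proof (rule prob_Pi_pmf_expose[OF finite_edges, where J = ?J])
    show "0 \<le> ?rhs" by simp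
  qed (rule step[unfolded \<P>_def])
  then show ?thesis using tail by simp
qed

end

section \<open>The density condition and asymptotics\<close>

text \<open>Over a set with \<open>c\<close> subsets of size \<open>s - 1\<close> and \<open>d\<close> of size \<open>s - 2\<close>, \<open>slack \<alpha> c d\<close> is the
  exponent of \<open>n\<close> in the expected number of vertices that have the full link and realise all rare
  families. The two \<open>max\<close> terms come from the family with \<open>c + d\<close> members and the \<open>c + d\<close> families with
  one member less; they vanish if these families are not rare.\<close>

definition slack :: "real \<Rightarrow> nat \<Rightarrow> nat \<Rightarrow> real" where
  "slack \<alpha> c d = 1 - \<alpha> * real c -
     (max 0 (\<alpha> * real (c + d) - 1) + real (c + d) * max 0 (\<alpha> * (real (c + d) - 1) - 1))"

text \<open>By absorption (k - 1) d = (s - 1) (c + d), so (s - 1) / (k - 1) = d / C with C = c + d.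
  Multiplying the hypothesis by C + 2 then turns its right-hand side into C^2 + C - d = C^2 +
  c.\<close>

lemma threshold_rewrite:
  fixes s k :: nat and \<alpha> :: real
  assumes s: "s \<ge> 3" and k: "k \<ge> s + 1" and \<alpha>: "\<alpha> > 0"
    and T: "1 / \<alpha> > real ((k - 1) choose (s - 1)) - 1 - (real s - 1) / (real k - 1)
           + 2 * (1 + (real s - 1) / (real k - 1)) / (real ((k - 1) choose (s - 1)) + 2)"
  defines "c \<equiv> (k - 2) choose (s - 1)" and "d \<equiv> (k - 2) choose (s - 2)"
  shows "(k - 1) choose (s - 1) = c + d" "d \<ge> 2" "c \<ge> 1"
    "\<alpha> * ((real c + real d)\<^sup>2 + real c) < real c + real d + 2"
proof -
  \<comment> \<open>Writing \<open>k\<close> and \<open>s\<close> as successors lets Pascal's rule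
    apply by simplification.\<close>
  define k' s' where "k' = k - 3" and "s' = s - 3"
  have k': "k = Suc (Suc (Suc k'))" and s': "s = Suc (Suc (Suc s'))"
    using k s by (simp_all add: k'_def s'_def)
  have ks: "Suc s' \<le> k'" using k by (simp add: k' s')
  show C: "(k - 1) choose (s - 1) = c + d" by (simp add: c_def d_def k' s')
  have "d = (k' choose s') + (k' choose Suc s')" by (simp add: d_def k' s')
  moreover have "k' choose s' \<ge> 1" "k' choose Suc s' \<ge> 1" using ks by (auto simp: Suc_le_eq)
  ultimately show "d \<ge> 2" by simp
  show "c \<ge> 1" using ks by (auto simp: c_def k' s' Suc_le_eq)
  let ?C = "real c + real d"
  define \<delta> where "\<delta> = (real s - 1) / (real k - 1)"
  have "Suc (k - 2) * d = (Suc (k - 2) choose Suc (s - 2)) * Suc (s - 2)"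
    unfolding d_def by (rule Suc_times_binomial_eq)
  then have "(k - 1) * d = (c + d) * (s - 1)"
    using C by (simp add: k' s')
  then have "real (k - 1) * real d = ?C * real (s - 1)" by (metis of_nat_add of_nat_mult)
  then have "(real k - 1) * real d = ?C * (real s - 1)" using k s by (simp add: of_nat_diff)
  then have \<delta>: "?C * \<delta> = real d" using k s by (simp add: \<delta>_def field_simps)
  have "1 / \<alpha> > ?C - 1 - \<delta> + 2 * (1 + \<delta>) / (?C + 2)"
    using T unfolding C \<delta>_def by simp
  then have "(?C + 2) * (1 / \<alpha>) > (?C + 2) * (?C - 1 - \<delta> + 2 * (1 + \<delta>) / (?C + 2))"
    by (intro mult_strict_left_mono) auto
  also have "(?C + 2) * (?C - 1 - \<delta> + 2 * (1 + \<delta>) / (?C + 2)) = (?C + 2) * (?C - 1 - \<delta>) + 2 * (1 + \<delta>)"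
  proof -
    have "?C + 2 \<noteq> 0" by linarith
    then have "(?C + 2) * (2 * (1 + \<delta>) / (?C + 2)) = 2 * (1 + \<delta>)" by simp
    then show ?thesis by (simp only: distrib_left)
  qed
  also have "\<dots> = ?C\<^sup>2 + ?C - ?C * \<delta>" by (simp add: algebra_simps power2_eq_square)
  also have "\<dots> = ?C\<^sup>2 + real c" by (simp add: \<delta>)
  finally show "\<alpha> * (?C\<^sup>2 + real c) < ?C + 2" using \<alpha> by (simp add: field_simps)
qed

text \<open>Put C = c + d. If \<alpha> (C - 2) were at least 1, then \<alpha> (C^2 - 4) would be at
  least C + 2, against \<open>H\<close>. For the slack, cases are split by which \<open>max\<close>
  terms are positive: with both it equals C + 2 - \<alpha> (C^2 + c); with only the first it is
  positive by c \<le> C - 2 and \<alpha> (C - 1) < 1; with none by \<alpha> c < 1.\<close>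

lemma slack_pos:
  assumes "d \<ge> 2" "c \<ge> 1" "\<alpha> > 0" and H: "\<alpha> * ((real c + real d)\<^sup>2 + real c) < real c + real d + 2"
  shows "slack \<alpha> c d > 0" "\<alpha> * real c < 1" "\<alpha> * (real (c + d) - 2) < 1"
proof -
  let ?C = "real c + real d"
  have C: "?C \<ge> 3" "real c \<le> ?C - 2" using assms by auto
  show 1: "\<alpha> * (real (c + d) - 2) < 1"
  proof (rule ccontr)
    assume "\<not> ?thesis"
    then have "1 \<le> \<alpha> * (?C - 2)" by simp
    then have "(?C + 2) * 1 \<le> (?C + 2) * (\<alpha> * (?C - 2))" by (intro mult_left_mono) auto
    also have "\<dots> = \<alpha> * (?C\<^sup>2 - 4)" by (simp add: algebra_simps power2_eq_square)
    also have "\<dots> \<le> \<alpha> * (?C\<^sup>2 + real c)" using assms by (intro mult_left_mono) auto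
    finally show False using H by simp
  qed
  have "\<alpha> * real c \<le> \<alpha> * (?C - 2)" using C assms by (intro mult_left_mono) auto
  then show 2: "\<alpha> * real c < 1" using 1 by simp
  show "slack \<alpha> c d > 0"
  proof (cases "\<alpha> * (?C - 1) \<ge> 1")
    case True
    then have "\<alpha> * ?C \<ge> 1" using assms by (simp add: algebra_simps)
    then have "slack \<alpha> c d = ?C + 2 - \<alpha> * (?C\<^sup>2 + real c)"
      using True by (simp add: slack_def max_def algebra_simps power2_eq_square)
    then show ?thesis using H by simp
  next
    case False
    show ?thesis
    proof (cases "\<alpha> * ?C \<ge> 1")
      case True
      have "\<alpha> * real c \<le> \<alpha> * (?C - 2)" using C assms by (intro mult_left_mono) auto
      moreover have "slack \<alpha> c d = 2 - \<alpha> * real c - \<alpha> * ?C"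
        using True False by (simp add: slack_def max_def)
      ultimately show ?thesis using False by (simp add: algebra_simps)
    next
      case F: False
      then show ?thesis using 2 False by (simp add: slack_def max_def)
    qed
  qed
qed

text \<open>Since \<alpha> (c + d - 2) < 1, a rare family omits at most one of the c + d sets. This
  leaves the full family and the c + d families with one member less, and \<open>slack\<close>
  charges for all of them.\<close>

lemma sum_rare_le:
  fixes W :: "'v set"
  assumes W: "finite W" and s: "s \<ge> 2" and S: "S \<subseteq> rare \<alpha> s W"
    and c: "c = card (subs (s - 1) W)" and d: "d = card (subs (s - 2) W)"
    and \<alpha>: "\<alpha> > 0" "\<alpha> * (real (c + d) - 2) < 1" "c + d \<ge> 1"
  shows "slack \<alpha> c d \<le> 1 - \<alpha> * real c - (\<Sum>\<tau>\<in>S. \<alpha> * real (card \<tau>) - 1)" "card S \<le> 2 ^ (c + d)"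
proof -
  let ?Y = "subs (s - 1) W \<union> subs (s - 2) W"
  have fY: "finite ?Y" using W by (simp add: finite_subs)
  have cY: "card ?Y = c + d"
    unfolding c d using W s by (intro card_Un_disjoint) (auto simp: finite_subs subs_def)
  have SY: "S \<subseteq> Pow ?Y" using S by (auto simp: rare_def)
  then show "card S \<le> 2 ^ (c + d)" using card_mono[OF _ SY] fY cY by (simp add: card_Pow)
  let ?w = "\<lambda>\<tau>. max 0 (\<alpha> * real (card \<tau>) - 1)"
  let ?T1 = "{\<tau>. \<tau> \<subseteq> ?Y \<and> card \<tau> = c + d}" and ?T2 = "{\<tau>. \<tau> \<subseteq> ?Y \<and> card \<tau> = c + d - 1}"
  have sub: "S \<subseteq> ?T1 \<union> ?T2"
  proof
    fix \<tau> assume \<tau>: "\<tau> \<in> S"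
    then have *: "\<tau> \<subseteq> ?Y" "\<alpha> * real (card \<tau>) \<ge> 1" using S by (auto simp: rare_def)
    have le: "card \<tau> \<le> c + d" using card_mono[OF fY *(1)] cY by simp
    have "\<alpha> * (real (c + d) - 2) < \<alpha> * real (card \<tau>)" using * \<alpha> by linarith
    then have "real (c + d) - 2 < real (card \<tau>)" using \<alpha>(1) by simp
    then have "c + d \<le> card \<tau> + 1" by linarith
    then have "card \<tau> = c + d \<or> card \<tau> = c + d - 1" using le by linarith
    then show "\<tau> \<in> ?T1 \<union> ?T2" using * by blast
  qed
  have fin: "finite ?T1" "finite ?T2" using fY by auto
  have "(\<Sum>\<tau>\<in>S. \<alpha> * real (card \<tau>) - 1) \<le> (\<Sum>\<tau>\<in>S. ?w \<tau>)" by (intro sum_mono) auto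
  also have "\<dots> \<le> (\<Sum>\<tau>\<in>?T1 \<union> ?T2. ?w \<tau>)" using sub fin by (intro sum_mono2) auto
  also have "\<dots> = (\<Sum>\<tau>\<in>?T1. ?w \<tau>) + (\<Sum>\<tau>\<in>?T2. ?w \<tau>)"
    using \<alpha>(3) fin by (intro sum.union_disjoint) auto
  also have "(\<Sum>\<tau>\<in>?T1. ?w \<tau>) = max 0 (\<alpha> * real (c + d) - 1)"
    using n_subsets[OF fY, of "c + d"] cY by simp
  also have "(\<Sum>\<tau>\<in>?T2. ?w \<tau>) = real (c + d) * max 0 (\<alpha> * (real (c + d) - 1) - 1)"
  proof -
    have "(c + d) choose (c + d - 1) = c + d"
      using binomial_symmetric[of 1 "c + d"] \<alpha>(3) by simp
    then have "card ?T2 = c + d" using n_subsets[OF fY, of "c + d - 1"] cY by simp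
    moreover have "(\<Sum>\<tau>\<in>?T2. ?w \<tau>) = (\<Sum>\<tau>\<in>?T2. max 0 (\<alpha> * (real (c + d) - 1) - 1))"
      using \<alpha>(3) by (intro sum.cong) (auto simp: of_nat_diff)
    ultimately show ?thesis by simp
  qed
  finally show "slack \<alpha> c d \<le> 1 - \<alpha> * real c - (\<Sum>\<tau>\<in>S. \<alpha> * real (card \<tau>) - 1)"
    by (simp add: slack_def)
qed

section \<open>Exponential bounds for binomial tails\<close>

lemma power_div_fact_le_exp: "real m ^ m / fact m \<le> exp (real m)"
proof -
  have "real m ^ m / fact m \<le> (\<Sum>i. real m ^ i / fact i)"
    using sum_le_suminf[of "\<lambda>i. real m ^ i / fact i" "{m}"] summable_exp[of "real m"]
    by (simp add: divide_inverse mult.commute)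
  then show ?thesis by (simp add: exp_def divide_inverse mult.commute)
qed

text \<open>The binomial coefficient is at most m^h / h!, and h! \<ge> (h / e)^h by
  \<open>power_div_fact_le_exp\<close>, so the product is at most (e \<mu> / h)^h. The constant 6
  makes the base at most e / 6 \<le> 1 / 2.\<close>

lemma binomial_upper_tail:
  fixes r \<mu> :: real
  assumes "0 \<le> r" "real m * r \<le> \<mu>" "6 * \<mu> \<le> real h"
  shows "real (m choose h) * r ^ h \<le> (1 / 2) ^ h"
proof -
  have "real ((m choose h) * fact h) \<le> real (m ^ h)"
    using binomial_fact_pow[of m h] of_nat_le_iff by blast
  then have 1: "real (m choose h) * fact h \<le> real m ^ h" by simp
  have "real (m choose h) * r ^ h * fact h \<le> (real m * r) ^ h"
    using mult_right_mono[OF 1, of "r ^ h"] assms by (simp add: power_mult_distrib mult_ac)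
  also have "\<dots> \<le> (real h / 6) ^ h" using assms by (intro power_mono) auto
  finally have "real (m choose h) * r ^ h \<le> (real h / 6) ^ h / fact h" by (simp add: field_simps)
  also have "\<dots> = real h ^ h / fact h * (1 / 6) ^ h" by (simp add: power_divide)
  also have "\<dots> \<le> exp (real h) * (1 / 6) ^ h"
    by (intro mult_right_mono power_div_fact_le_exp) auto
  also have "\<dots> = (exp 1 / 6) ^ h" by (simp add: power_divide exp_of_nat_mult[symmetric])
  also have "\<dots> \<le> (1 / 2) ^ h" using exp_le by (intro power_mono) auto
  finally show ?thesis .
qed

lemma binomial_lower_tail:
  fixes r :: real
  assumes "0 \<le> r" "r \<le> 1" "m \<ge> 1"
  shows "real (m choose h) * (1 - r) ^ i \<le> exp (real h * ln (real m) - r * real i)"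
proof -
  have "real (m choose h) \<le> real m ^ h"
    using binomial_le_pow[of h m] by (cases "h \<le> m") (auto simp: binomial_eq_0 simp flip: of_nat_power)
  also have "\<dots> = exp (real h * ln (real m))"
    using assms by (simp add: exp_of_nat_mult)
  finally have 1: "real (m choose h) \<le> exp (real h * ln (real m))" .
  have "(1 - r) ^ i \<le> exp (- r) ^ i"
    using assms exp_ge_add_one_self[of "- r"] by (intro power_mono) auto
  also have "\<dots> = exp (- (r * real i))" by (simp add: exp_of_nat_mult[symmetric] mult.commute)
  finally have 2: "(1 - r) ^ i \<le> exp (- (r * real i))" .
  have "real (m choose h) * (1 - r) ^ i \<le> exp (real h * ln (real m)) * exp (- (r * real i))"
    using assms by (intro mult_mono 1 2) auto
  then show ?thesis by (simp add: exp_add[symmetric])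
qed

lemma half_power_le_exp: "(1 / 2) ^ t \<le> exp (- (real t / 2))"
proof -
  have "(1 / 2 :: real) \<le> exp (- (1 / 2))" using exp_ge_add_one_self[of "- (1 / 2)"] by simp
  then have "(1 / 2 :: real) ^ t \<le> exp (- (1 / 2)) ^ t" by (intro power_mono) auto
  then show ?thesis by (simp add: exp_of_nat_mult[symmetric])
qed

lemma nat_floor_ge_half:
  fixes x :: real
  assumes "x \<ge> 2"
  shows "x / 2 \<le> real (nat \<lfloor>x\<rfloor>)"
  using assms by linarith

section \<open>Choice of the parameters as powers of n\<close>

context exposure
begin

text \<open>With \<gamma> a = 1 - \<alpha> a, about n^(\<gamma> a) vertices have a given label of
  size a. Up to rounding and the factor 6 in \<open>hi\<close>, the parameters \<open>hi\<close>,
  \<open>lo\<close>, \<open>t\<close> and \<open>\<nu>\<close> are n to the powers \<gamma> a,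
  \<gamma> a - \<epsilon>, \<gamma> a - 2 \<epsilon> and \<gamma> a - 3 \<epsilon>. Each gap is a
  factor \<open>y\<close>, which absorbs the constants. The first condition in \<open>room\<close>
  keeps all these exponents at least 5 \<epsilon>; the second one makes \<open>q\<close> times the
  number of candidates at least \<open>y\<close>.\<close>

lemma prob_not_exact_le:
  fixes \<alpha> \<epsilon> :: real
  defines "x \<equiv> real n" and "y \<equiv> real n powr \<epsilon>"
  assumes A: "A \<subseteq> K1" and S: "S \<subseteq> rare \<alpha> s W" and \<alpha>: "\<alpha> > 0" and \<epsilon>: "\<epsilon> > 0"
    and p_eq: "p = real n powr (- \<alpha>)"
    and room: "8 * \<epsilon> \<le> 1 - \<alpha> * real (card K1)"
      "(4 * real (card S) + 4) * \<epsilon> \<le> 1 - \<alpha> * real (card K1) - (\<Sum>\<tau>\<in>S. \<alpha> * real (card \<tau>) - 1)"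
    and n: "real n \<ge> 16" "3 / 4 * real n \<le> real (card U)"
    and y: "y \<ge> 256 * 2 ^ card K2" "y \<ge> 2 * exp (2 * (2 ^ card K1 * 2 ^ card K2 * 7))"
    and ln_le: "16 * ln (real n) \<le> y"
    and half: "2 ^ card K2 * p \<le> 1 / 2" "(1 - p) ^ card K1 \<ge> 1 / 2" "(1 - p) ^ card K2 \<ge> 1 / 2"
  shows "measure_pmf.prob \<P> {f. \<not> (\<exists>x\<in>U. lab f x = A \<and>
      (\<lambda>z. lab f z \<union> plab f x z) ` (U - {x}) \<inter> rare \<alpha> s W = S)}
    \<le> (2 * 2 ^ card K1 + 3) * exp (- y)"
proof -
  define \<gamma> where "\<gamma> a = 1 - \<alpha> * real a" for a :: nat
  define \<nu> where "\<nu> a = nat \<lfloor>x powr (\<gamma> a - 3 * \<epsilon>)\<rfloor>" for a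
  define t where "t a = nat \<lfloor>x powr (\<gamma> a - 2 * \<epsilon>)\<rfloor>" for a
  define lo where "lo a = nat \<lceil>x powr (\<gamma> a - \<epsilon>)\<rceil>" for a
  define hi where "hi a = nat \<lceil>6 * x powr (\<gamma> a)\<rceil>" for a
  have x: "x \<ge> 16" using n by (simp add: x_def)
  have x1: "x \<ge> 1" and x0: "x > 0" using x by auto
  have K2ge: "(1::real) \<le> 2 ^ card K2" by simp
  have y256: "y \<ge> 256" using y(1) K2ge by linarith
  have yx: "y = x powr \<epsilon>" by (simp add: y_def x_def)
  have mono: "x powr a \<le> x powr b" if "a \<le> b" for a b using x1 that by (simp add: powr_mono)
  have shift: "x powr (a + \<epsilon>) = y * x powr a" for a by (simp add: yx powr_add)
  have ppow: "p ^ i = x powr (- (\<alpha> * real i))" for i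
    using x0 unfolding p_eq x_def by (simp add: powr_realpow[symmetric] powr_powr)
  have \<gamma>8: "8 * \<epsilon> \<le> \<gamma> a" "1 - \<alpha> * real (card K1) \<le> \<gamma> a" if "a \<le> card K1" for a
  proof -
    have "\<alpha> * real a \<le> \<alpha> * real (card K1)" using that \<alpha> by (intro mult_left_mono) auto
    then show "8 * \<epsilon> \<le> \<gamma> a" "1 - \<alpha> * real (card K1) \<le> \<gamma> a" using room(1) by (auto simp: \<gamma>_def)
  qed
  have \<gamma>1: "\<gamma> a \<le> 1" for a using \<alpha> by (simp add: \<gamma>_def)
  have p1: "p \<le> 1" "0 \<le> p" using p by auto
  have mU: "real (card U) \<le> x"
    using card_mono[of "{1..n}" U] by (simp add: U_def x_def)
  have U1: "card U \<ge> 1" using n by linarith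
  have x_split: "x powr (\<gamma> a) * p ^ i = x powr (1 - \<alpha> * real (a + i))" for a i
    by (simp add: ppow \<gamma>_def powr_add[symmetric] algebra_simps)
  \<comment> \<open>For a rare family the expected number of vertices realising it is at most
    1.\<close>
  have rare_le: "x powr (\<gamma> a) * p ^ i \<le> 1" if "\<alpha> * real (a + i) \<ge> 1" for a i
    unfolding x_split using mono[of "1 - \<alpha> * real (a + i)" 0] x0 that by simp
  have lo_le: "real (lo a) \<le> x powr (\<gamma> a - \<epsilon>) + 1" for a
    unfolding lo_def by (simp add: of_nat_nat ceiling_correct le_of_int_ceiling)
  have lo_quarter: "real (lo a) \<le> x / 4" for a
  proof -
    have "x powr (\<gamma> a - \<epsilon>) * y \<le> x"
    proof -
      have "x powr (\<gamma> a - \<epsilon>) * y = x powr (\<gamma> a)" using shift[of "\<gamma> a - \<epsilon>"] by (simp add: mult.commute)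
      also have "\<dots> \<le> x powr 1" using \<gamma>1 by (intro mono)
      finally show ?thesis using x0 by simp
    qed
    moreover have "x powr (\<gamma> a - \<epsilon>) * 256 \<le> x powr (\<gamma> a - \<epsilon>) * y"
      using y256 by (intro mult_left_mono) auto
    ultimately show ?thesis using lo_le[of a] x by linarith
  qed
  have lo_card: "real (lo a) + x / 2 \<le> real (card U)" for a
    using lo_quarter[of a] n(2) by (simp add: x_def)
  have \<gamma>_y: "x powr (\<gamma> a) \<ge> y * y" if "a \<le> card K1" for a
  proof -
    have "y * y = x powr (\<epsilon> + \<epsilon>)" by (simp only: yx powr_add)
    also have "\<dots> \<le> x powr (\<gamma> a)" using \<gamma>8[OF that] \<epsilon> by (intro mono) linarith
    finally show ?thesis .
  qed
  have t_ge: "x powr (\<gamma> a - 2 * \<epsilon>) / 2 \<le> real (t a)" and t_y: "2 * y \<le> real (t a)" if "a \<le> card K1" for a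
  proof -
    have "y * y = x powr (\<epsilon> + \<epsilon>)" by (simp only: yx powr_add)
    also have "\<dots> \<le> x powr (\<gamma> a - 2 * \<epsilon>)" using \<gamma>8[OF that] \<epsilon> by (intro mono) linarith
    finally have yy: "y * y \<le> x powr (\<gamma> a - 2 * \<epsilon>)" .
    have "256 * y \<le> y * y" using y256 by (intro mult_right_mono) auto
    then have "x powr (\<gamma> a - 2 * \<epsilon>) \<ge> 256 * y" using yy by simp
    moreover from this show "x powr (\<gamma> a - 2 * \<epsilon>) / 2 \<le> real (t a)"
      unfolding t_def using y256 by (intro nat_floor_ge_half) linarith
    ultimately show "2 * y \<le> real (t a)" using y256 by linarith
  qed
  have t_le: "real (t a) \<le> x powr (\<gamma> a - 2 * \<epsilon>)" for a
    unfolding t_def by (simp add: of_nat_nat)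
  have \<nu>_le: "real (\<nu> a) \<le> x powr (\<gamma> a - 3 * \<epsilon>)" for a
    unfolding \<nu>_def by (simp add: of_nat_nat)
  have \<nu>_ge: "x powr (\<gamma> a - 3 * \<epsilon>) / 2 \<le> real (\<nu> a)" if "a \<le> card K1" for a
  proof -
    have "y \<le> x powr (\<gamma> a - 3 * \<epsilon>)" unfolding yx using \<gamma>8[OF that] \<epsilon> by (intro mono) linarith
    then show ?thesis unfolding \<nu>_def using y256 by (intro nat_floor_ge_half) linarith
  qed
  define q where "q = (\<Prod>\<tau>\<in>S. real (\<nu> (card (\<tau> \<inter> K1))) * (p ^ card (\<tau> \<inter> K2) * (1 - p) ^ card K2))
      * exp (- 2 * (2 ^ card K1 * 2 ^ card K2 * 7))"
  have cA: "card A \<le> card K1" using A finite_K by (simp add: card_mono)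
  have qt: "y \<le> q * real (t (card A))"
  proof -
    \<comment> \<open>The loss 4 \<epsilon> is 3 \<epsilon> from \<open>\<nu>\<close> and one
      further \<epsilon> for the constant 4, which combines a factor 2 from rounding with a factor 2
      from \<open>(1 - p) ^ card K2\<close>.\<close>
    have factor: "x powr (1 - \<alpha> * real (card \<tau>) - 4 * \<epsilon>) \<le>
        real (\<nu> (card (\<tau> \<inter> K1))) * (p ^ card (\<tau> \<inter> K2) * (1 - p) ^ card K2)" if "\<tau> \<in> S" for \<tau>
    proof -
      have "\<tau> \<subseteq> K1 \<union> K2" using S that by (auto simp: rare_def K1_def K2_def)
      then have "\<tau> = (\<tau> \<inter> K1) \<union> (\<tau> \<inter> K2)" by auto
      then have c\<tau>: "card \<tau> = card (\<tau> \<inter> K1) + card (\<tau> \<inter> K2)"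
        using card_Un_disjoint[of "\<tau> \<inter> K1" "\<tau> \<inter> K2"] finite_K K1_K2_disjoint by fastforce
      have cK1: "card (\<tau> \<inter> K1) \<le> card K1" using finite_K by (simp add: card_mono)
      let ?a = "card (\<tau> \<inter> K1)" and ?i = "card (\<tau> \<inter> K2)"
      have "x powr (1 - \<alpha> * real (card \<tau>) - 4 * \<epsilon>) * 4 \<le> x powr (1 - \<alpha> * real (card \<tau>) - 4 * \<epsilon>) * y"
        using y256 by (intro mult_left_mono) auto
      also have "\<dots> = x powr (1 - \<alpha> * real (card \<tau>) - 3 * \<epsilon>)"
        using shift[of "1 - \<alpha> * real (card \<tau>) - 4 * \<epsilon>"] by (simp add: mult.commute algebra_simps)
      also have "\<dots> = x powr (\<gamma> ?a - 3 * \<epsilon>) * p ^ ?i"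
        by (simp add: ppow \<gamma>_def powr_add[symmetric] c\<tau> algebra_simps)
      finally have "x powr (1 - \<alpha> * real (card \<tau>) - 4 * \<epsilon>) \<le>
          x powr (\<gamma> ?a - 3 * \<epsilon>) / 2 * (p ^ ?i * (1 / 2))" by simp
      also have "\<dots> \<le> real (\<nu> ?a) * (p ^ ?i * (1 - p) ^ card K2)"
        using \<nu>_ge[OF cK1] half(3) p1 by (intro mult_mono) auto
      finally show ?thesis .
    qed
    have "x powr (\<Sum>\<tau>\<in>S. 1 - \<alpha> * real (card \<tau>) - 4 * \<epsilon>) = (\<Prod>\<tau>\<in>S. x powr (1 - \<alpha> * real (card \<tau>) - 4 * \<epsilon>))"
      using x0 by (intro powr_sum) auto
    also have "\<dots> \<le> (\<Prod>\<tau>\<in>S. real (\<nu> (card (\<tau> \<inter> K1))) * (p ^ card (\<tau> \<inter> K2) * (1 - p) ^ card K2))"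
      using factor by (intro prod_mono) auto
    finally have prod_ge: "x powr (\<Sum>\<tau>\<in>S. 1 - \<alpha> * real (card \<tau>) - 4 * \<epsilon>) \<le>
      (\<Prod>\<tau>\<in>S. real (\<nu> (card (\<tau> \<inter> K1))) * (p ^ card (\<tau> \<inter> K2) * (1 - p) ^ card K2))" .
    let ?s = "\<Sum>\<tau>\<in>S. 1 - \<alpha> * real (card \<tau>) - 4 * \<epsilon>"
    let ?E = "exp (- 2 * (2 ^ card K1 * 2 ^ card K2 * 7) :: real)"
    have s_eq: "?s = - (\<Sum>\<tau>\<in>S. \<alpha> * real (card \<tau>) - 1) - 4 * real (card S) * \<epsilon>"
      by (simp add: sum_subtractf sum.distrib algebra_simps)
    \<comment> \<open>Besides 4 \<epsilon> for each member of \<open>S\<close>, the budget pays 2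
      \<epsilon> in \<open>t\<close> and \<epsilon> for \<open>?E\<close> and the rounding of
      \<open>t\<close>, and leaves \<epsilon> over. This explains the summand 4 in
      \<open>room\<close>.\<close>
    have expo: "\<epsilon> \<le> ?s + (\<gamma> (card A) - 2 * \<epsilon>) - \<epsilon>"
      using room(2) \<gamma>8(2)[OF cA] unfolding s_eq by (simp add: algebra_simps)
    have E: "1 / y \<le> ?E / 2"
    proof -
      have "2 * exp (2 * (2 ^ card K1 * 2 ^ card K2 * 7)) \<le> y" by (rule y(2))
      then have "1 / y \<le> 1 / (2 * exp (2 * (2 ^ card K1 * 2 ^ card K2 * 7)))"
        by (intro divide_left_mono mult_pos_pos) (use y256 in auto)
      also have "\<dots> = ?E / 2" by (simp add: exp_minus field_simps)
      finally show ?thesis .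
    qed
    have "y \<le> x powr (?s + (\<gamma> (card A) - 2 * \<epsilon>) - \<epsilon>)" unfolding yx using expo by (rule mono)
    also have "\<dots> = x powr ?s * x powr (\<gamma> (card A) - 2 * \<epsilon>) * (1 / y)"
      unfolding powr_diff[of _ _ \<epsilon>] powr_add[of x ?s] yx by simp
    also have "\<dots> \<le> x powr ?s * x powr (\<gamma> (card A) - 2 * \<epsilon>) * (?E / 2)"
      using E by (intro mult_left_mono) auto
    also have "\<dots> = (x powr ?s * ?E) * (x powr (\<gamma> (card A) - 2 * \<epsilon>) / 2)" by simp
    also have "\<dots> \<le> q * real (t (card A))"
      unfolding q_def using prod_ge t_ge[OF cA] p1 by (intro mult_mono mult_nonneg_nonneg prod_nonneg) auto
    finally show ?thesis .
  qed
  have q0: "0 \<le> q" unfolding q_def using p1 by (intro mult_nonneg_nonneg prod_nonneg) auto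
  have main: "measure_pmf.prob \<P> {f. \<not> (\<exists>x\<in>U. lab f x = A \<and>
      (\<lambda>z. lab f z \<union> plab f x z) ` (U - {x}) \<inter> rare \<alpha> s W = S)}
    \<le> 2 ^ card K1 * (2 * exp (- y)) + (2 * (1 / 2) ^ t (card A) + exp (- q) ^ t (card A))"
  \<comment> \<open>The value 7 of \<kappa> is 6 from the definition of \<open>hi\<close> plus 1 for
    rounding up.\<close>
  proof (rule prob_not_exact[where lo = lo and hi = hi and \<nu> = \<nu> and \<kappa> = 7, OF A S])
    show "\<alpha> * real (card K1) < 1" "0 \<le> \<alpha>" using room(1) \<epsilon> \<alpha> by auto
    show "lo a \<le> card U" for a using lo_card[of a] x by linarith
    show "2 ^ card K2 * p \<le> 1 / 2" "(0::real) \<le> 7" "0 \<le> q" using half q0 by auto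
    show "q \<le> (\<Prod>\<tau>\<in>S. real (\<nu> (card (\<tau> \<inter> K1))) * (p ^ card (\<tau> \<inter> K2) * (1 - p) ^ card K2))
      * exp (- 2 * (2 ^ card K1 * 2 ^ card K2 * 7))" by (simp add: q_def)
  next
    fix a assume a: "a \<le> card K1"
    have pa: "p ^ a \<le> 1" "0 \<le> p ^ a" using p1 by (auto simp: power_le_one)
    let ?r = "p ^ a * (1 - p) ^ (card K1 - a)"
    have r: "0 \<le> ?r" "?r \<le> 1" "p ^ a / 2 \<le> ?r"
    proof -
      show "0 \<le> ?r" using p1 by simp
      show "?r \<le> 1" using p1 pa by (intro mult_le_one) (auto simp: power_le_one)
      have "(1 - p) ^ card K1 \<le> (1 - p) ^ (card K1 - a)" using p1 by (intro power_decreasing) auto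
      then have "p ^ a * (1 / 2) \<le> ?r" using half(2) pa by (intro mult_left_mono) auto
      then show "p ^ a / 2 \<le> ?r" by simp
    qed
    have xpa: "x * p ^ a = x powr (\<gamma> a)"
      using x0 by (simp add: ppow \<gamma>_def powr_diff powr_minus field_simps)
    have "real (card U choose lo a) * (1 - ?r) ^ (card U - lo a) \<le>
        exp (real (lo a) * ln (real (card U)) - ?r * real (card U - lo a))"
      by (rule binomial_lower_tail[OF r(1,2) U1])
    \<comment> \<open>The choice of exceptional vertices adds at most n^(\<gamma> a) / 16 + y / 16
      to the exponent. The misses subtract at least n^(\<gamma> a) / 4, with one half from
      \<open>?r \<ge> p ^ a / 2\<close> and one half from
      \<open>card U - lo a \<ge> x / 2\<close>.\<close>
    also have "\<dots> \<le> exp (- y)"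
    proof -
      have "real (lo a) * ln (real (card U)) \<le> (x powr (\<gamma> a - \<epsilon>) + 1) * (y / 16)"
      proof (rule mult_mono)
        have "ln (real (card U)) \<le> ln x" using mU U1 by simp
        then show "ln (real (card U)) \<le> y / 16" using ln_le by (simp add: x_def)
      qed (use lo_le U1 in auto)
      also have "\<dots> = x powr (\<gamma> a) / 16 + y / 16"
        using shift[of "\<gamma> a - \<epsilon>"] by (simp add: algebra_simps)
      finally have 1: "real (lo a) * ln (real (card U)) \<le> x powr (\<gamma> a) / 16 + y / 16" .
      have "p ^ a / 2 * (x / 2) \<le> ?r * real (card U - lo a)"
        using r x0 lo_card[of a] pa by (intro mult_mono) (auto simp: of_nat_diff)
      then have 2: "x powr (\<gamma> a) / 4 \<le> ?r * real (card U - lo a)" using xpa by (simp add: mult.commute)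
      have "256 * y \<le> y * y" using y256 by (intro mult_right_mono) auto
      then have "256 * y \<le> x powr (\<gamma> a)" using \<gamma>_y[OF a] by simp
      then have "real (lo a) * ln (real (card U)) - ?r * real (card U - lo a) \<le> - y"
        using 1 2 y256 by linarith
      then show ?thesis by (simp only: exp_le_cancel_iff)
    qed
    finally show "real (card U choose lo a) * (1 - ?r) ^ (card U - lo a) \<le> exp (- y)" .
    have hi_ge: "6 * x powr (\<gamma> a) \<le> real (hi a)" unfolding hi_def by (rule real_nat_ceiling_ge)
    have "real (card U) * p ^ a \<le> x * p ^ a" using mU pa by (intro mult_right_mono) auto
    then have "real (card U choose hi a) * (p ^ a) ^ hi a \<le> (1 / 2) ^ hi a"
      using hi_ge pa xpa by (intro binomial_upper_tail[where \<mu> = "x powr (\<gamma> a)"]) auto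
    also have "\<dots> \<le> exp (- (real (hi a) / 2))" by (rule half_power_le_exp)
    also have "\<dots> \<le> exp (- y)"
    proof -
      have "y * 1 \<le> y * y" using y256 by (intro mult_left_mono) auto
      then have "- (real (hi a) / 2) \<le> - y" using \<gamma>_y[OF a] hi_ge y256 by linarith
      then show ?thesis by (simp only: exp_le_cancel_iff)
    qed
    finally show "real (card U choose hi a) * (p ^ a) ^ hi a \<le> exp (- y)" .
    \<comment> \<open>The reserved sets and the candidates fit into a label class, since one factor
      \<open>y\<close> exceeds \<open>2 ^ card K2 + 4\<close>.\<close>
    have "2 ^ card K2 * real (\<nu> a) + 4 * real (t a) \<le> x powr (\<gamma> a - \<epsilon>)"
    proof -
      have ts: "x powr (\<gamma> a - 2 * \<epsilon>) * y = x powr (\<gamma> a - \<epsilon>)"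
        using shift[of "\<gamma> a - 2 * \<epsilon>"] by (simp add: mult.commute algebra_simps)
      have "x powr (\<gamma> a - 3 * \<epsilon>) \<le> x powr (\<gamma> a - 2 * \<epsilon>)" using \<epsilon> by (intro mono) simp
      then have "2 ^ card K2 * real (\<nu> a) \<le> 2 ^ card K2 * x powr (\<gamma> a - 2 * \<epsilon>)"
        using \<nu>_le[of a] by (intro mult_left_mono) auto
      then have "2 ^ card K2 * real (\<nu> a) + 4 * real (t a) \<le> (2 ^ card K2 + 4) * x powr (\<gamma> a - 2 * \<epsilon>)"
        unfolding distrib_right using t_le[of a] by linarith
      also have "\<dots> \<le> y * x powr (\<gamma> a - 2 * \<epsilon>)"
      proof (rule mult_right_mono)
        show "2 ^ card K2 + 4 \<le> y" using y(1) K2ge by linarith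
      qed simp
      finally show ?thesis using ts by (simp add: mult.commute)
    qed
    also have "\<dots> \<le> real (lo a)" unfolding lo_def by (rule real_nat_ceiling_ge)
    finally have "real (2 ^ card K2 * \<nu> a + 4 * t a) \<le> real (lo a)" by simp
    then show "2 ^ card K2 * \<nu> a + 4 * t a \<le> lo a" by linarith
    fix i assume i: "\<alpha> * real (a + i) \<ge> 1"
    have pi: "0 \<le> p ^ i" "p ^ i \<le> 1" using p1 by (auto simp: power_le_one)
    have "real (hi a) * p ^ i \<le> (6 * x powr (\<gamma> a) + 1) * p ^ i"
    proof (rule mult_right_mono)
      have "0 \<le> 6 * x powr (\<gamma> a)" by simp
      then show "real (hi a) \<le> 6 * x powr (\<gamma> a) + 1" unfolding hi_def by linarith
    qed (rule pi)
    also have "\<dots> = 6 * (x powr (\<gamma> a) * p ^ i) + p ^ i" by (simp add: algebra_simps)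
    also have "\<dots> \<le> 7" using rare_le[OF i] pi by simp
    finally show "real (hi a) * p ^ i \<le> 7" .
    \<comment> \<open>Two factors \<open>y\<close> separate \<open>t a\<close> from n^(\<gamma> a),
      which makes hits inside the candidate set unlikely.\<close>
    have "2 ^ card K2 * (4 * real (t a) * p ^ i) \<le> 2 ^ card K2 * (4 * x powr (\<gamma> a - 2 * \<epsilon>) * p ^ i)"
      using t_le[of a] pi by (intro mult_left_mono mult_right_mono) auto
    also have "\<dots> = 4 * 2 ^ card K2 / (y * y) * (x powr (\<gamma> a) * p ^ i)"
      using x0 by (simp add: yx powr_add[symmetric] powr_diff)
    also have "\<dots> \<le> 4 * 2 ^ card K2 / (y * y) * 1"
      using rare_le[OF i] by (intro mult_left_mono) auto
    also have "\<dots> \<le> 1 / 32"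
    proof -
      have "y * 1 \<le> y * y" using y256 by (intro mult_left_mono) auto
      then have "128 * 2 ^ card K2 \<le> y * y" using y(1) K2ge by linarith
      then show ?thesis using y256 by (simp add: field_simps)
    qed
    finally show "2 ^ card K2 * (4 * real (t a) * p ^ i) \<le> 1 / 32" .
  qed
  have "(1 / 2) ^ t (card A) \<le> exp (- (real (t (card A)) / 2))" by (rule half_power_le_exp)
  also have "\<dots> \<le> exp (- y)" using t_y[OF cA] by simp
  finally have h: "(1 / 2) ^ t (card A) \<le> exp (- y)" .
  have "exp (- q) ^ t (card A) = exp (- (q * real (t (card A))))"
    by (simp add: exp_of_nat_mult[symmetric] mult.commute)
  also have "\<dots> \<le> exp (- y)" using qt by simp
  finally show ?thesis using main h by (simp add: algebra_simps)
qed

end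

section \<open>Union bounds and the zero-one law\<close>

lemma tendsto_zero_if_eventually_le:
  fixes f g :: "nat \<Rightarrow> real"
  assumes "eventually (\<lambda>n. f n \<le> g n) sequentially" "g \<longlonglongrightarrow> 0" "\<And>n. 0 \<le> f n"
  shows "f \<longlonglongrightarrow> 0"
  using tendsto_sandwich[OF always_eventually assms(1) tendsto_const assms(2)] assms(3) by blast

text \<open>A sample is almost surely \<open>False\<close> off \<open>possible_edges\<close>, so its
  edge set can be read off directly, in the form in which \<open>lab\<close> and \<open>plab\<close>
  are stated.\<close>

lemma prob_random_hypergraph:
  "measure_pmf.prob (random_hypergraph s n p) {E. Q E} =
    measure_pmf.prob (Pi_pmf (possible_edges s n) False (\<lambda>_. bernoulli_pmf p)) {f. Q {e. f e}}"
proof -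
  let ?P = "Pi_pmf (possible_edges s n) False (\<lambda>_. bernoulli_pmf p)"
  have fin: "finite (possible_edges s n)"
    by (rule finite_subset[of _ "Pow {1..n}"]) (auto simp: possible_edges_def)
  have "random_hypergraph s n p = map_pmf (\<lambda>f. {e. f e}) ?P"
    unfolding random_hypergraph_def
  proof (rule map_pmf_cong[OF refl])
    fix f assume "f \<in> set_pmf ?P"
    then have "f e = False" if "e \<notin> possible_edges s n" for e
      using set_Pi_pmf_subset[OF fin, of False "\<lambda>_. bernoulli_pmf p"] that by blast
    then show "{e \<in> possible_edges s n. f e} = {e. f e}" by auto
  qed
  then show ?thesis by (simp add: vimage_def)
qed

lemma card_subsets_le: "real (card {W. W \<subseteq> {1..n::nat} \<and> card W = j}) \<le> real n ^ j"
proof -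
  have "n choose j \<le> n ^ j" using binomial_le_pow[of j n] by (cases "j \<le> n") (auto simp: binomial_eq_0)
  then have "real (n choose j) \<le> real (n ^ j)" using of_nat_le_iff by blast
  then show ?thesis by (simp add: n_subsets)
qed

lemma prob_union_bound:
  assumes "finite I" "\<And>i. i \<in> I \<Longrightarrow> measure_pmf.prob M {x. B i x} \<le> b"
  shows "measure_pmf.prob M {x. \<exists>i\<in>I. B i x} \<le> real (card I) * b"
proof -
  have "{x. \<exists>i\<in>I. B i x} = (\<Union>i\<in>I. {x. B i x})" by auto
  then have "measure_pmf.prob M {x. \<exists>i\<in>I. B i x} \<le> (\<Sum>i\<in>I. measure_pmf.prob M {x. B i x})"
    using measure_pmf.finite_measure_subadditive_finite[OF assms(1), of "\<lambda>i. {x. B i x}" M] by simp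
  also have "\<dots> \<le> (\<Sum>i\<in>I. b)" using assms(2) by (rule sum_mono)
  finally show ?thesis by simp
qed

text \<open>There are at most n^(k - 2) sets \<open>W\<close>, each with boundedly many choices of
  \<open>A\<close> and \<open>S\<close>. A failure probability of order exp (- n^\<epsilon>)
  outweighs this polynomial.\<close>

lemma prob_not_rich_tendsto:
  fixes s k :: nat and \<alpha> :: real
  assumes s: "s \<ge> 3" and k: "k \<ge> s + 1" and \<alpha>: "\<alpha> > 0"
    and T: "1 / \<alpha> > real ((k - 1) choose (s - 1)) - 1 - (real s - 1) / (real k - 1)
           + 2 * (1 + (real s - 1) / (real k - 1)) / (real ((k - 1) choose (s - 1)) + 2)"
  shows "(\<lambda>n. measure_pmf.prob (random_hypergraph s n (real n powr (- \<alpha>))) {E. \<not> rich \<alpha> s k {1..n} E}) \<longlonglongrightarrow> 0"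
proof -
  define c where "c = (k - 2) choose (s - 1)"
  define d where "d = (k - 2) choose (s - 2)"
  note thr = threshold_rewrite[OF s k \<alpha> T, folded c_def d_def]
  define \<eta> where "\<eta> = slack \<alpha> c d"
  have pos: "\<eta> > 0" "\<alpha> * real c < 1" "\<alpha> * (real (c + d) - 2) < 1"
    using slack_pos[OF thr(2,3) \<alpha> thr(4)] by (auto simp: \<eta>_def)
  define M :: real where "M = 2 ^ (c + d)"
  have M: "M \<ge> 1" by (simp add: M_def)
  \<comment> \<open>\<open>M\<close> bounds \<open>card S\<close>, so this \<epsilon> meets the
    second condition \<open>room\<close> of \<open>prob_not_exact_le\<close> for every
    \<open>S\<close>. The first one follows from \<open>M \<ge> 1\<close>, because the slack is at
    most 1 - \<alpha> c.\<close>
  define \<epsilon> where "\<epsilon> = \<eta> / (4 * M + 4)"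
  have \<epsilon>: "\<epsilon> > 0" using pos(1) M by (simp add: \<epsilon>_def)
  have \<epsilon>\<eta>: "(4 * M + 4) * \<epsilon> = \<eta>" using M by (simp add: \<epsilon>_def)
  let ?b = "\<lambda>n. (2 * 2 ^ c + 3) * exp (- (real n powr \<epsilon>))"
  \<comment> \<open>An upper bound for the number of pairs of a prescribed link and a prescribed set
    of rare families.\<close>
  let ?N = "2 ^ c * 2 ^ (2 ^ (c + d)) :: real"
  have ev: "eventually (\<lambda>n. real n \<ge> 16) sequentially"
    "eventually (\<lambda>n. 3 / 4 * real n \<le> real n - real (k - 2)) sequentially"
    "eventually (\<lambda>n. real n powr \<epsilon> \<ge> 256 * 2 ^ d) sequentially"
    "eventually (\<lambda>n. real n powr \<epsilon> \<ge> 2 * exp (2 * (2 ^ c * 2 ^ d * 7))) sequentially"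
    "eventually (\<lambda>n. 16 * ln (real n) \<le> real n powr \<epsilon>) sequentially"
    "eventually (\<lambda>n. 2 ^ d * real n powr (- \<alpha>) \<le> 1 / 2) sequentially"
    "eventually (\<lambda>n. (1 - real n powr (- \<alpha>)) ^ c \<ge> 1 / 2) sequentially"
    "eventually (\<lambda>n. (1 - real n powr (- \<alpha>)) ^ d \<ge> 1 / 2) sequentially"
    using \<epsilon> \<alpha> by real_asymp+
  have "eventually (\<lambda>n. measure_pmf.prob (random_hypergraph s n (real n powr (- \<alpha>))) {E. \<not> rich \<alpha> s k {1..n} E}
      \<le> real n ^ (k - 2) * (?N * ?b n)) sequentially"
    using ev
  proof eventually_elim
    case (elim n)
    define p where "p = real n powr (- \<alpha>)"
    have p01: "0 \<le> p" "p \<le> 1"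
      using elim(1) \<alpha> powr_mono[of "- \<alpha>" 0 "real n"] by (auto simp: p_def)
    let ?P = "Pi_pmf (possible_edges s n) False (\<lambda>_. bernoulli_pmf p)"
    let ?Ws = "{W. W \<subseteq> {1..n} \<and> card W = k - 2}"
    define fails where "fails W A S E \<longleftrightarrow> \<not> (\<exists>x\<in>{1..n} - W. label E s W x = A \<and>
               pattern E s W x ` ({1..n} - W - {x}) \<inter> rare \<alpha> s W = S)"
      for W A S and E :: "nat set set"
    have fail_le: "measure_pmf.prob ?P {f. fails W A S {e. f e}} \<le> ?b n"
      if Wk: "W \<in> ?Ws" and A: "A \<subseteq> subs (s - 1) W" and S: "S \<subseteq> rare \<alpha> s W" for W A S
    proof -
      interpret exposure s n W p
        using s Wk p01 by unfold_locales auto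
      have cK: "card K1 = c" "card K2 = d"
        using Wk finite_W by (simp_all add: K1_def K2_def card_subs c_def d_def)
      have cU: "real (card U) = real n - real (k - 2)"
      proof -
        have "card W \<le> card {1..n}" using Wk by (intro card_mono) auto
        then show ?thesis using Wk finite_W by (simp add: U_def card_Diff_subset of_nat_diff)
      qed
      have sr: "\<eta> \<le> 1 - \<alpha> * real c - (\<Sum>\<tau>\<in>S. \<alpha> * real (card \<tau>) - 1)" "card S \<le> 2 ^ (c + d)"
        using sum_rare_le[OF finite_W _ S, of c d] s cK \<alpha> pos thr(2)
        unfolding \<eta>_def K1_def K2_def by auto
      have "real (card S) \<le> M" using sr(2) unfolding M_def
        by (metis of_nat_le_iff of_nat_numeral of_nat_power)
      then have "(4 * real (card S) + 4) * \<epsilon> \<le> (4 * M + 4) * \<epsilon>" using \<epsilon> by (intro mult_right_mono) auto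
      then have room2: "(4 * real (card S) + 4) * \<epsilon> \<le> 1 - \<alpha> * real (card K1) - (\<Sum>\<tau>\<in>S. \<alpha> * real (card \<tau>) - 1)"
        using sr(1) \<epsilon>\<eta> cK by simp
      have "8 * \<epsilon> \<le> (4 * M + 4) * \<epsilon>" using \<epsilon> M by (intro mult_right_mono) auto
      also have "\<dots> \<le> 1 - \<alpha> * real (card K1)"
      proof -
        have "0 \<le> real (c + d) * max 0 (\<alpha> * (real (c + d) - 1) - 1)"
          by (intro mult_nonneg_nonneg) auto
        moreover have "0 \<le> max 0 (\<alpha> * real (c + d) - 1)" by simp
        ultimately have "slack \<alpha> c d \<le> 1 - \<alpha> * real c" unfolding slack_def by linarith
        then show ?thesis using \<epsilon>\<eta> cK by (simp add: \<eta>_def)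
      qed
      finally have room1: "8 * \<epsilon> \<le> 1 - \<alpha> * real (card K1)" .
      have pat: "pattern E s W x = (\<lambda>z. label E s W z \<union> pair_label E s W x z)" for E x
        by (simp add: fun_eq_iff pattern_def)
      have "{f. fails W A S {e. f e}} = {f. \<not> (\<exists>x\<in>U. lab f x = A \<and>
          (\<lambda>z. lab f z \<union> plab f x z) ` (U - {x}) \<inter> rare \<alpha> s W = S)}"
        unfolding fails_def pat lab_def plab_def U_def ..
      also have "measure_pmf.prob \<P> \<dots> \<le> (2 * 2 ^ card K1 + 3) * exp (- (real n powr \<epsilon>))"
        using elim room1 room2
        by (intro prob_not_exact_le[OF A[folded K1_def] S \<alpha> \<epsilon>]) (simp_all add: cK cU p_def)
      finally show ?thesis by (simp add: cK \<P>_def)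
    qed
    have N: "real (card (Pow (subs (s - 1) W) \<times> Pow (rare \<alpha> s W))) \<le> ?N"
      "finite (Pow (subs (s - 1) W) \<times> Pow (rare \<alpha> s W))" if W: "W \<in> ?Ws" for W
    proof -
      have fW: "finite W" using W finite_subset by auto
      let ?Y = "subs (s - 1) W \<union> subs (s - 2) W"
      have fY: "finite ?Y" using fW by (simp add: finite_subs)
      have cY: "card ?Y \<le> c + d"
        using card_Un_le[of "subs (s - 1) W" "subs (s - 2) W"] W fW by (simp add: card_subs c_def d_def)
      have sub: "rare \<alpha> s W \<subseteq> Pow ?Y" by (auto simp: rare_def)
      then have fr: "finite (rare \<alpha> s W)" using fY finite_subset by blast
      have "card (rare \<alpha> s W) \<le> 2 ^ card ?Y" using card_mono[OF _ sub] fY by (simp add: card_Pow)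
      also have "\<dots> \<le> 2 ^ (c + d)" using cY by simp
      finally have "card (Pow (rare \<alpha> s W)) \<le> 2 ^ 2 ^ (c + d)" using fr by (simp add: card_Pow)
      moreover have "card (Pow (subs (s - 1) W)) = 2 ^ c"
        using W fW by (simp add: card_Pow finite_subs card_subs c_def)
      ultimately have "card (Pow (subs (s - 1) W) \<times> Pow (rare \<alpha> s W)) \<le> 2 ^ c * 2 ^ 2 ^ (c + d)"
        by (simp add: card_cartesian_product)
      then have "real (card (Pow (subs (s - 1) W) \<times> Pow (rare \<alpha> s W))) \<le> real (2 ^ c * 2 ^ 2 ^ (c + d))"
        using of_nat_le_iff by blast
      then show "real (card (Pow (subs (s - 1) W) \<times> Pow (rare \<alpha> s W))) \<le> ?N" by simp
      show "finite (Pow (subs (s - 1) W) \<times> Pow (rare \<alpha> s W))" using fr fW by (simp add: finite_subs)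
    qed
    have "measure_pmf.prob (random_hypergraph s n p) {E. \<not> rich \<alpha> s k {1..n} E} =
        measure_pmf.prob ?P {f. \<exists>W\<in>?Ws. \<exists>AS\<in>Pow (subs (s - 1) W) \<times> Pow (rare \<alpha> s W).
          fails W (fst AS) (snd AS) {e. f e}}"
    proof -
      have "\<not> rich \<alpha> s k {1..n} E \<longleftrightarrow> (\<exists>W\<in>?Ws. \<exists>AS\<in>Pow (subs (s - 1) W) \<times> Pow (rare \<alpha> s W).
          fails W (fst AS) (snd AS) E)" for E
      proof -
        have "rich \<alpha> s k {1..n} E \<longleftrightarrow> (\<forall>W A S. W \<subseteq> {1..n} \<and> card W = k - 2 \<and> A \<subseteq> subs (s - 1) W \<and>
            S \<subseteq> rare \<alpha> s W \<longrightarrow> \<not> fails W A S E)"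
          unfolding rich_def fails_def not_not ..
        then show ?thesis by (simp only: Bex_def split_paired_Ex mem_Sigma_iff fst_conv snd_conv) blast
      qed
      then show ?thesis unfolding prob_random_hypergraph by simp
    qed
    also have "\<dots> \<le> real (card ?Ws) * (?N * ?b n)"
    proof (rule prob_union_bound)
      show "finite ?Ws" by (rule finite_subset[of _ "Pow {1..n}"]) auto
      fix W assume W: "W \<in> ?Ws"
      have "measure_pmf.prob ?P {f. \<exists>AS\<in>Pow (subs (s - 1) W) \<times> Pow (rare \<alpha> s W).
          fails W (fst AS) (snd AS) {e. f e}} \<le> real (card (Pow (subs (s - 1) W) \<times> Pow (rare \<alpha> s W))) * ?b n"
        using W by (intro prob_union_bound N(2) fail_le) auto
      also have "\<dots> \<le> ?N * ?b n" using N(1)[OF W] by (intro mult_right_mono) auto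
      finally show "measure_pmf.prob ?P {f. \<exists>AS\<in>Pow (subs (s - 1) W) \<times> Pow (rare \<alpha> s W).
          fails W (fst AS) (snd AS) {e. f e}} \<le> ?N * ?b n" .
    qed
    also have "\<dots> \<le> real n ^ (k - 2) * (?N * ?b n)"
      by (intro mult_right_mono card_subsets_le) auto
    finally show ?case by (simp only: p_def)
  qed
  moreover have "(\<lambda>n. real n ^ (k - 2) * (?N * ?b n)) \<longlonglongrightarrow> 0"
    using \<epsilon> by real_asymp
  ultimately show ?thesis
    by (rule tendsto_zero_if_eventually_le) simp
qed

text \<open>A family fails to be a link over \<open>W\<close> exactly when its label class is empty,
  which is the lower tail with \<open>lo = 1\<close>. The expected class size is a power of n with
  positive exponent, so a union bound over \<open>W\<close> and \<open>B\<close> is enough.\<close>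

lemma prob_not_common_links_tendsto:
  fixes s k :: nat and \<alpha> :: real
  assumes s: "s \<ge> 3" and \<alpha>: "\<alpha> > 0"
  shows "(\<lambda>n. measure_pmf.prob (random_hypergraph s n (real n powr (- \<alpha>))) {E. \<not> common_links \<alpha> s k {1..n} E}) \<longlonglongrightarrow> 0"
proof -
  define c where "c = (k - 1) choose (s - 1)"
  \<comment> \<open>The exponents 1 - \<alpha> b for the sizes b of families that are not rare. This
    set is finite, contains the exponent for b = 0 and has only positive members, so its minimum
    \<theta> is a uniform positive exponent.\<close>
  define D where "D = (\<lambda>b. 1 - \<alpha> * real b) ` {b. b \<le> c \<and> \<alpha> * real b < 1}"
  define \<theta> where "\<theta> = Min D"
  have "finite D" "D \<noteq> {}" by (auto simp: D_def)
  then have "\<theta> \<in> D" unfolding \<theta>_def by (rule Min_in)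
  then have \<theta>: "\<theta> > 0" by (auto simp: D_def)
  have \<theta>_le: "\<theta> \<le> 1 - \<alpha> * real b" if "b \<le> c" "\<alpha> * real b < 1" for b
    unfolding \<theta>_def using \<open>finite D\<close> that by (intro Min_le) (auto simp: D_def)
  let ?b = "\<lambda>n. exp (ln (real n) - real n powr \<theta> / 4)"
  have ev: "eventually (\<lambda>n. real n \<ge> 16) sequentially"
    "eventually (\<lambda>n. real n / 2 \<le> real n - real (k - 1) - 1) sequentially"
    "eventually (\<lambda>n. (1 - real n powr (- \<alpha>)) ^ c \<ge> 1 / 2) sequentially"
    using \<alpha> by real_asymp+
  have "eventually (\<lambda>n. measure_pmf.prob (random_hypergraph s n (real n powr (- \<alpha>))) {E. \<not> common_links \<alpha> s k {1..n} E}
      \<le> real n ^ (k - 1) * (2 ^ c * ?b n)) sequentially"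
    using ev
  proof eventually_elim
    case (elim n)
    define p where "p = real n powr (- \<alpha>)"
    have p01: "0 \<le> p" "p \<le> 1"
      using elim(1) \<alpha> powr_mono[of "- \<alpha>" 0 "real n"] by (auto simp: p_def)
    let ?P = "Pi_pmf (possible_edges s n) False (\<lambda>_. bernoulli_pmf p)"
    let ?Ws = "{W. W \<subseteq> {1..n} \<and> card W = k - 1}"
    let ?Bs = "\<lambda>W. {B. B \<subseteq> subs (s - 1) W \<and> \<alpha> * real (card B) < 1}"
    have fail_le: "measure_pmf.prob ?P {f. \<not> link_realised {1..n} {e. f e} s W B} \<le> ?b n"
      if Wk: "W \<in> ?Ws" and B: "B \<in> ?Bs W" for W B
    proof -
      interpret exposure s n W p
        using s Wk p01 by unfold_locales auto
      have cK: "card K1 = c" using Wk finite_W by (simp add: K1_def card_subs c_def)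
      have BK: "B \<subseteq> K1" using B by (simp add: K1_def)
      have cB: "card B \<le> c" using card_mono[OF finite_K(1) BK] cK by simp
      have cU: "real (card U) = real n - real (k - 1)"
      proof -
        have "card W \<le> card {1..n}" using Wk by (intro card_mono) auto
        then show ?thesis using Wk finite_W by (simp add: U_def card_Diff_subset of_nat_diff)
      qed
      have U: "1 \<le> card U" "real n / 2 \<le> real (card U - 1)"
      proof -
        show "1 \<le> card U" using elim(1,2) cU by linarith
        then show "real n / 2 \<le> real (card U - 1)" using elim(2) cU by (simp add: of_nat_diff)
      qed
      have none: "card {x\<in>U. lab f x = B} < 1 \<longleftrightarrow> \<not> link_realised {1..n} {e. f e} s W B" for f
      proof -
        have "finite {x\<in>U. lab f x = B}" using finite_U by simp
        then have "card {x\<in>U. lab f x = B} < 1 \<longleftrightarrow> {x\<in>U. lab f x = B} = {}" by auto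
        then show ?thesis by (auto simp: link_realised_def U_def lab_def)
      qed
      let ?r = "p ^ card B * (1 - p) ^ (card K1 - card B)"
      have r01: "0 \<le> ?r" "?r \<le> 1" using p01 by (auto intro!: mult_le_one simp: power_le_one)
      have "(1 - p) ^ card K1 \<le> (1 - p) ^ (card K1 - card B)" using p01 by (intro power_decreasing) auto
      then have "1 / 2 \<le> (1 - p) ^ (card K1 - card B)" using elim(3) by (simp add: cK p_def)
      then have "p ^ card B * (1 / 2) \<le> ?r" using p01 by (intro mult_left_mono) auto
      \<comment> \<open>The constant 1/4 in the exponent arises here: one half for the power of
        \<open>1 - p\<close>, one half for \<open>card U - 1 \<ge> n / 2\<close>.\<close>
      then have "p ^ card B * (1 / 2) * (real n / 2) \<le> ?r * real (card U - 1)"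
        by (rule mult_mono[OF _ U(2) r01(1)]) simp
      moreover have "p ^ card B * real n = real n powr (1 - \<alpha> * real (card B))"
        using elim(1) unfolding p_def by (simp add: powr_realpow[symmetric] powr_powr powr_diff powr_minus field_simps)
      moreover have "real n powr \<theta> \<le> real n powr (1 - \<alpha> * real (card B))"
        using elim(1) \<theta>_le[OF cB] B by (intro powr_mono) auto
      ultimately have low: "real n powr \<theta> / 4 \<le> ?r * real (card U - 1)" by simp
      have "measure_pmf.prob \<P> {f. \<not> link_realised {1..n} {e. f e} s W B} \<le>
          real (card U choose 1) * (1 - ?r) ^ (card U - 1)"
        using prob_label_count_less[OF BK U(1)] unfolding none .
      also have "\<dots> \<le> exp (real 1 * ln (real (card U)) - ?r * real (card U - 1))"
        using r01 U by (intro binomial_lower_tail) auto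
      also have "\<dots> \<le> ?b n"
      proof -
        have "ln (real (card U)) \<le> ln (real n)" using U(1) cU by simp
        then have "real 1 * ln (real (card U)) - ?r * real (card U - 1) \<le> ln (real n) - real n powr \<theta> / 4"
          using low by simp
        then show ?thesis by (simp only: exp_le_cancel_iff)
      qed
      finally show ?thesis by (simp add: \<P>_def)
    qed
    have N: "real (card (?Bs W)) \<le> 2 ^ c" "finite (?Bs W)" if W: "W \<in> ?Ws" for W
    proof -
      have "finite W" using W finite_subset[of W "{1..n}"] by simp
      then have fW: "finite (subs (s - 1) W)" by (rule finite_subs)
      then show "finite (?Bs W)" by simp
      have "card (?Bs W) \<le> card (Pow (subs (s - 1) W))" using fW by (intro card_mono) auto
      also have "\<dots> = 2 ^ c"
        using W fW \<open>finite W\<close> by (simp add: card_Pow card_subs c_def)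
      finally have "real (card (?Bs W)) \<le> real (2 ^ c)" using of_nat_le_iff by blast
      then show "real (card (?Bs W)) \<le> 2 ^ c" by simp
    qed
    have "measure_pmf.prob (random_hypergraph s n p) {E. \<not> common_links \<alpha> s k {1..n} E} =
        measure_pmf.prob ?P {f. \<exists>W\<in>?Ws. \<exists>B\<in>?Bs W. \<not> link_realised {1..n} {e. f e} s W B}"
    proof -
      have "\<not> common_links \<alpha> s k {1..n} E \<longleftrightarrow> (\<exists>W\<in>?Ws. \<exists>B\<in>?Bs W. \<not> link_realised {1..n} E s W B)" for E
        unfolding common_links_def by blast
      then show ?thesis unfolding prob_random_hypergraph by simp
    qed
    also have "\<dots> \<le> real (card ?Ws) * (2 ^ c * ?b n)"
    proof (rule prob_union_bound)
      show "finite ?Ws" by (rule finite_subset[of _ "Pow {1..n}"]) auto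
      fix W assume W: "W \<in> ?Ws"
      have "measure_pmf.prob ?P {f. \<exists>B\<in>?Bs W. \<not> link_realised {1..n} {e. f e} s W B} \<le> real (card (?Bs W)) * ?b n"
        using W by (intro prob_union_bound N(2) fail_le) auto
      also have "\<dots> \<le> 2 ^ c * ?b n" using N(1)[OF W] by (intro mult_right_mono) auto
      finally show "measure_pmf.prob ?P {f. \<exists>B\<in>?Bs W. \<not> link_realised {1..n} {e. f e} s W B} \<le> 2 ^ c * ?b n" .
    qed
    also have "\<dots> \<le> real n ^ (k - 1) * (2 ^ c * ?b n)"
      by (intro mult_right_mono card_subsets_le) auto
    finally show ?case by (simp only: p_def)
  qed
  moreover have "(\<lambda>n. real n ^ (k - 1) * (2 ^ c * ?b n)) \<longlonglongrightarrow> 0"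
    using \<theta> by real_asymp
  ultimately show ?thesis
    by (rule tendsto_zero_if_eventually_le) simp
qed

lemma random_hypergraph_edges:
  assumes "E \<in> set_pmf (random_hypergraph s n p)" "e \<in> E"
  shows "card e = s"
  using assms by (auto simp: random_hypergraph_def possible_edges_def)

text \<open>For \<open>n \<ge> k\<close> a sample can fail to be good only through
  \<open>common_links\<close> or \<open>rich\<close>; the condition on edge sizes holds on the
  support of the distribution.\<close>

lemma prob_good_tendsto:
  fixes s k :: nat and \<alpha> :: real
  assumes s: "s \<ge> 3" and k: "k \<ge> s + 1" and \<alpha>: "\<alpha> > 0"
    and T: "1 / \<alpha> > real ((k - 1) choose (s - 1)) - 1 - (real s - 1) / (real k - 1)
           + 2 * (1 + (real s - 1) / (real k - 1)) / (real ((k - 1) choose (s - 1)) + 2)"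
  shows "(\<lambda>n. measure_pmf.prob (random_hypergraph s n (real n powr (- \<alpha>))) {E. \<not> good \<alpha> s k {1..n} E}) \<longlonglongrightarrow> 0"
proof -
  let ?M = "\<lambda>n. random_hypergraph s n (real n powr (- \<alpha>))"
  have "eventually (\<lambda>n. measure_pmf.prob (?M n) {E. \<not> good \<alpha> s k {1..n} E} \<le>
      measure_pmf.prob (?M n) {E. \<not> common_links \<alpha> s k {1..n} E} +
      measure_pmf.prob (?M n) {E. \<not> rich \<alpha> s k {1..n} E}) sequentially"
    using eventually_ge_at_top[of k]
  proof eventually_elim
    case (elim n)
    have "measure_pmf.prob (?M n) {E. \<not> good \<alpha> s k {1..n} E} =
        measure_pmf.prob (?M n) ({E. \<not> good \<alpha> s k {1..n} E} \<inter> set_pmf (?M n))"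
      by (simp add: measure_Int_set_pmf)
    also have "\<dots> \<le> measure_pmf.prob (?M n) ({E. \<not> common_links \<alpha> s k {1..n} E} \<union> {E. \<not> rich \<alpha> s k {1..n} E})"
    proof (rule measure_pmf.finite_measure_mono)
      show "{E. \<not> good \<alpha> s k {1..n} E} \<inter> set_pmf (?M n) \<subseteq>
          {E. \<not> common_links \<alpha> s k {1..n} E} \<union> {E. \<not> rich \<alpha> s k {1..n} E}"
      proof
        fix E assume E: "E \<in> {E. \<not> good \<alpha> s k {1..n} E} \<inter> set_pmf (?M n)"
        have "\<forall>e\<in>E. card e = s" using random_hypergraph_edges E by blast
        moreover have "finite {1..n}" "k \<le> card {1..n}" using elim by auto
        ultimately show "E \<in> {E. \<not> common_links \<alpha> s k {1..n} E} \<union> {E. \<not> rich \<alpha> s k {1..n} E}"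
          using E unfolding good_def by blast
      qed
    qed simp
    also have "\<dots> \<le> measure_pmf.prob (?M n) {E. \<not> common_links \<alpha> s k {1..n} E} +
      measure_pmf.prob (?M n) {E. \<not> rich \<alpha> s k {1..n} E}"
      by (rule measure_Un_le) auto
    finally show ?case .
  qed
  moreover have "(\<lambda>n. measure_pmf.prob (?M n) {E. \<not> common_links \<alpha> s k {1..n} E} +
      measure_pmf.prob (?M n) {E. \<not> rich \<alpha> s k {1..n} E}) \<longlonglongrightarrow> 0"
    using tendsto_add[OF prob_not_common_links_tendsto[OF s \<alpha>, of k] prob_not_rich_tendsto[OF s k \<alpha> T]] by simp
  ultimately show ?thesis
    by (rule tendsto_zero_if_eventually_le) simp
qed

theorem theorem6:
  fixes s k :: nat and \<alpha> :: real
  assumes "s \<ge> 3" and "k \<ge> s + 1" and "\<alpha> > 0"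
    and "1 / \<alpha> > real ((k - 1) choose (s - 1)) - 1 - (real s - 1) / (real k - 1)
           + 2 * (1 + (real s - 1) / (real k - 1)) / (real ((k - 1) choose (s - 1)) + 2)"
  shows "zero_one_law k s (\<lambda>n. real n powr (- \<alpha>))"
  unfolding zero_one_law_def Let_def
proof (intro allI impI)
  fix \<phi> assume \<phi>: "arity_ok s \<phi> \<and> free_vars \<phi> = {} \<and> quantifier_depth \<phi> \<le> k"
  let ?M = "\<lambda>n. random_hypergraph s n (real n powr (- \<alpha>))"
  let ?good = "\<lambda>n. good \<alpha> s k {1..n::nat}"
  note bad0 = prob_good_tendsto[OF assms]
  have same: "models {1..m} E \<phi> \<longleftrightarrow> models {1..n} E' \<phi>" if "?good m E" "?good n E'" for m n E E'
    using models_transfer[OF that assms(1,2)] \<phi> by blast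
  show "(\<lambda>n. measure_pmf.prob (?M n) {E. models {1..n} E \<phi>}) \<longlonglongrightarrow> 0 \<or>
      (\<lambda>n. measure_pmf.prob (?M n) {E. models {1..n} E \<phi>}) \<longlonglongrightarrow> 1"
  \<comment> \<open>Good hypergraphs of all orders agree on \<phi>, so either each of them satisfies
    \<phi> or none does. The limit is 1 or 0 accordingly, because the probability of not being good
    tends to 0.\<close>
  proof (cases "\<exists>m E. ?good m E \<and> models {1..m} E \<phi>")
    case True
    then have all: "models {1..n} E \<phi>" if "?good n E" for n E using same that by blast
    have compl: "1 - measure_pmf.prob (?M n) {E. models {1..n} E \<phi>} =
        measure_pmf.prob (?M n) (UNIV - {E. models {1..n} E \<phi>})" for n
      using measure_pmf.prob_compl[of "{E. models {1..n} E \<phi>}" "?M n"] by simp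
    have "1 - measure_pmf.prob (?M n) {E. models {1..n} E \<phi>} \<le> measure_pmf.prob (?M n) {E. \<not> ?good n E}" for n
      unfolding compl using all by (intro measure_pmf.finite_measure_mono) auto
    then have "(\<lambda>n. 1 - measure_pmf.prob (?M n) {E. models {1..n} E \<phi>}) \<longlonglongrightarrow> 0"
      by (intro tendsto_zero_if_eventually_le[OF always_eventually bad0]) auto
    from tendsto_diff[OF tendsto_const this, of 1]
    have "(\<lambda>n. measure_pmf.prob (?M n) {E. models {1..n} E \<phi>}) \<longlonglongrightarrow> 1" by simp
    then show ?thesis ..
  next
    case False
    then have "measure_pmf.prob (?M n) {E. models {1..n} E \<phi>} \<le> measure_pmf.prob (?M n) {E. \<not> ?good n E}" for n
      by (intro measure_pmf.finite_measure_mono) auto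
    then have "(\<lambda>n. measure_pmf.prob (?M n) {E. models {1..n} E \<phi>}) \<longlonglongrightarrow> 0"
      by (intro tendsto_zero_if_eventually_le[OF always_eventually bad0]) auto
    then show ?thesis ..
  qed
qed

end
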